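(* Let $\Gamma=(V,E,o,t)$ be a locally finite graph with no isolated vertices. Then $\bar\delta(\widehat{\mathrm{Cl}}{}^0(\Gamma))=\mathrm{Pic}^0(|\Gamma|)$; the map $q_*\colon H^1(\Gamma)\to\mathrm{Pic}(|\Gamma|)$ vanishes on $\beta(\mathcal{H}^1(\Gamma))$ and induces an isomorphism $\bar q_*\colon\mathrm{P}(\Gamma)\xrightarrow{\sim}\mathrm{Pic}^0(|\Gamma|)$; and $-\bar\delta\circ\chi=\bar q_*$, where $\chi\colon\mathrm{P}(\Gamma)\xrightarrow{\sim}\widehat{\mathrm{Cl}}{}^0(\Gamma)$ is induced by $d^*$.
   Context: Graph: $V\ne\emptyset$, $E$, $o,t\colon E\to V$, locally finite, countable; no vertex is isolated (i.e. every vertex is the origin or terminus of some edge). $|\Gamma|$: quotient of $V\sqcup E\times[0,1]$ identifying $(e,0)\sim o(e)$, $(e,1)\sim t(e)$; $\tilde e\colon[0,1]\to|\Gamma|$, coordinate $x$. $\mathcal{PL}$: sheaf of continuous real functions on $|\Gamma|$ that are locally $a+bx$ ($a,b\in\mathbb{Z}$) on each edge. If $\tilde e^*h=a+bx$ near a vertex $v$, the incoming derivative of $h$ at $v$ along $e$ is $-b$ if $v=o(e)$ and $b$ if $v=t(e)$ (a loop contributes both). $\mathrm{diff}_v\colon\mathcal{PL}_v\to\mathbb{Z}$ is the sum of incoming derivatives at $v$; $\mathcal{H}arm=\ker(\mathrm{diff}\colon\mathcal{PL}\to\prod_{v}v_*\mathbb{Z})$ (skyscraper sheaves), giving an exact sequence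 $0\to\mathcal{H}arm\to\mathcal{PL}\to\prod_v v_*\mathbb{Z}\to0$. $\mathrm{Pic}(|\Gamma|)=H^1(|\Gamma|,\mathcal{H}arm)$ (isomorphism classes of $\mathcal{H}arm$-torsors). $\delta\colon\mathbb{Z}^V=H^0(|\Gamma|,\prod_v v_*\mathbb{Z})\to H^1(|\Gamma|,\mathcal{H}arm)$ is the connecting map; it kills $\square_0(\mathbb{Z}^V)$ and induces $\bar\delta\colon\widehat{\mathrm{Cl}}(\Gamma)=\mathbb{Z}^V/\square_0\mathbb{Z}^V\to\mathrm{Pic}(|\Gamma|)$. Here $d\colon\mathbb{Z}^V\to\mathbb{Z}^E$, $(df)(e)=f(t(e))-f(o(e))$; $d^*\colon\mathbb{Z}^E\to\mathbb{Z}^V$, $(d^*\omega)(v)=\sum_{t(e)=v}\omega(e)-\sum_{o(e)=v}\omega(e)$; $\square_0=d^*d$; $\widehat{\mathrm{Cl}}{}^0(\Gamma)=\operatorname{im}(d^* )/\square_0\mathbb{Z}^V$. $\Omega$ is the kernel of the sheaf map $\prod_e\tilde e_*\mathbb{Z}\to\prod_v v_*\mathbb{Z}$ which at a vertex $v$ sends the integers $(c_e)$ attached to edge-ends at $v$ to $\sum_{t(e)=v}c_e-\sum_{o(e)=v}c_e$ (on global sections this is $d^*$). The edge derivative $\mathcal{H}arm\to\Omega$ (taking the slope $b$ on each edge) gives an exact sequence $0\to\mathbb{Z}\xrightarrow{q}\mathcal{H}arm\to\Omega\to0$ with $q$ the inclusion of constants; $q_*\colon H^1(\Gamma)=H^1(|\Gamma|,\mathbb{Z})\to\mathrm{Pic}(|\Gamma|)$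 is the induced map, with $H^1(\Gamma)=\mathbb{Z}^E/d\mathbb{Z}^V$. $\mathrm{Pic}^0(|\Gamma|)=\ker(\mathrm{Pic}(|\Gamma|)\to H^1(|\Gamma|,\Omega))$. $\mathcal{H}^1(\Gamma)=\ker d^*$, $\beta\colon\mathcal{H}^1\to H^1$ natural map, $\mathrm{P}(\Gamma)=H^1(\Gamma)/\beta(\mathcal{H}^1(\Gamma))$. *)

theory Defs
  imports
    "HOL-Analysis.Analysis"
    "HOL-Algebra.Coset"
    "HOL-Library.Function_Algebras"
    "Graph_Theory.Digraph"
begin

section \<open>Sheaves, torsors and first cohomology\<close>

text \<open>
  \<open>restr F U V\<close> is the restriction from \<open>U\<close> to \<open>V \<subseteq> U\<close>. Only values at open sets of the space at
  hand, and at members of \<open>sections F U\<close>, are meaningful.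
\<close>

record ('p, 's) presheaf =
  sections :: "'p set \<Rightarrow> 's set"
  restr :: "'p set \<Rightarrow> 'p set \<Rightarrow> 's \<Rightarrow> 's"

definition sheaf :: "'p topology \<Rightarrow> ('p, 's, 'm) presheaf_scheme \<Rightarrow> bool" where
  "sheaf X F \<longleftrightarrow>
    (\<forall>U V. openin X U \<and> openin X V \<and> V \<subseteq> U \<longrightarrow> restr F U V \<in> sections F U \<rightarrow> sections F V) \<and>
    (\<forall>U s. openin X U \<and> s \<in> sections F U \<longrightarrow> restr F U U s = s) \<and>
    (\<forall>U V W s. openin X U \<and> openin X V \<and> openin X W \<and> W \<subseteq> V \<and> V \<subseteq> U \<and> s \<in> sections F U
       \<longrightarrow> restr F V W (restr F U V s) = restr F U W s) \<and>
    (\<forall>\<U> s. (\<forall>U\<in>\<U>. openin X U \<and> s U \<in> sections F U) \<and>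
       (\<forall>U\<in>\<U>. \<forall>V\<in>\<U>. restr F U (U \<inter> V) (s U) = restr F V (U \<inter> V) (s V))
       \<longrightarrow> (\<exists>!r. r \<in> sections F (\<Union>\<U>) \<and> (\<forall>U\<in>\<U>. restr F (\<Union>\<U>) U r = s U)))"

text \<open>
  A sheaf of abelian groups has its sections in a type of class \<^class>\<open>ab_group_add\<close>, each
  \<open>sections F U\<close> being a subgroup of that type. Sections that are functions on a domain
  depending on \<open>U\<close> are extended by \<open>0\<close> outside this domain.
\<close>

definition kernel_sheaf ::
  "('p, 's) presheaf \<Rightarrow> ('p set \<Rightarrow> 's \<Rightarrow> 'r::ab_group_add) \<Rightarrow> ('p, 's) presheaf" where
  "kernel_sheaf F \<phi> = F\<lparr>sections := \<lambda>U. {s \<in> sections F U. \<phi> U s = 0}\<rparr>"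

definition prod_presheaf ::
  "('p, 's) presheaf \<Rightarrow> ('p, 'r) presheaf \<Rightarrow> ('p, 's \<times> 'r) presheaf" where
  "prod_presheaf F F' =
    \<lparr>sections = \<lambda>U. sections F U \<times> sections F' U,
     restr = \<lambda>U V. map_prod (restr F U V) (restr F' U V)\<rparr>"

record ('p, 's, 't) torsor = "('p, 't) presheaf" +
  act :: "'p set \<Rightarrow> 's \<Rightarrow> 't \<Rightarrow> 't"

definition is_torsor ::
  "'p topology \<Rightarrow> ('p, 's::ab_group_add) presheaf \<Rightarrow> ('p, 's, 't) torsor \<Rightarrow> bool" where
  "is_torsor X F T \<longleftrightarrow>
    sheaf X T \<and>
    (\<forall>U. openin X U \<longrightarrow>
      (\<forall>g\<in>sections F U. \<forall>t\<in>sections T U. act T U g t \<in> sections T U) \<and>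
      (\<forall>t\<in>sections T U. act T U 0 t = t) \<and>
      (\<forall>g\<in>sections F U. \<forall>h\<in>sections F U. \<forall>t\<in>sections T U.
         act T U (g + h) t = act T U g (act T U h t)) \<and>
      (\<forall>V. openin X V \<and> V \<subseteq> U \<longrightarrow> (\<forall>g\<in>sections F U. \<forall>t\<in>sections T U.
         restr T U V (act T U g t) = act T V (restr F U V g) (restr T U V t))) \<and>
      (\<forall>s\<in>sections T U. \<forall>t\<in>sections T U. \<exists>!g. g \<in> sections F U \<and> t = act T U g s)) \<and>
    (\<forall>x\<in>topspace X. \<exists>U. openin X U \<and> x \<in> U \<and> sections T U \<noteq> {})"

text \<open>\<open>m\<close> is a morphism of sheaves \<open>T \<rightarrow> T'\<close> that is equivariant along \<open>\<phi>\<close>, a map from the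
  structure sheaf \<open>F\<close> of \<open>T\<close> to that of \<open>T'\<close>.\<close>

definition equivariant ::
  "'p topology \<Rightarrow> ('p, 's) presheaf \<Rightarrow> ('p set \<Rightarrow> 's \<Rightarrow> 'r) \<Rightarrow>
   ('p, 's, 't) torsor \<Rightarrow> ('p, 'r, 'u) torsor \<Rightarrow> ('p set \<Rightarrow> 't \<Rightarrow> 'u) \<Rightarrow> bool" where
  "equivariant X F \<phi> T T' m \<longleftrightarrow>
    (\<forall>U. openin X U \<longrightarrow>
      m U \<in> sections T U \<rightarrow> sections T' U \<and>
      (\<forall>V. openin X V \<and> V \<subseteq> U \<longrightarrow>
         (\<forall>t\<in>sections T U. m V (restr T U V t) = restr T' U V (m U t))) \<and>
      (\<forall>g\<in>sections F U. \<forall>t\<in>sections T U. m U (act T U g t) = act T' U (\<phi> U g) (m U t)))"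

definition torsor_iso ::
  "'p topology \<Rightarrow> ('p, 's) presheaf \<Rightarrow> ('p, 's, 't) torsor \<Rightarrow> ('p, 's, 'u) torsor \<Rightarrow> bool" where
  "torsor_iso X F T T' \<longleftrightarrow>
    (\<exists>m. equivariant X F (\<lambda>U g. g) T T' m \<and>
      (\<forall>U. openin X U \<longrightarrow> bij_betw (m U) (sections T U) (sections T' U)))"

text \<open>
  Isomorphism classes are formed among the torsors with sections in \<open>'p \<Rightarrow> 's\<close>. This type is large
  enough for every \<open>F\<close>-torsor \<open>T\<close>: choosing for each point \<open>x\<close> a section \<open>t x\<close> on a neighbourhood
  \<open>N x\<close>, a section of \<open>T\<close> over \<open>U\<close> is determined by its differences in \<open>F (U \<inter> N x)\<close> with the \<open>t x\<close>.
\<close>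

definition torsor_class ::
  "'p topology \<Rightarrow> ('p, 's::ab_group_add) presheaf \<Rightarrow> ('p, 's, 't) torsor
    \<Rightarrow> ('p, 's, 'p \<Rightarrow> 's) torsor set" where
  "torsor_class X F T = {S. is_torsor X F S \<and> torsor_iso X F T S}"

definition trivial_torsor :: "('p, 's::ab_group_add) presheaf \<Rightarrow> ('p, 's, 's) torsor" where
  "trivial_torsor F = \<lparr>sections = sections F, restr = restr F, act = \<lambda>U g t. g + t\<rparr>"

definition prod_torsor ::
  "('p, 's, 't) torsor \<Rightarrow> ('p, 'r, 'u) torsor \<Rightarrow> ('p, 's \<times> 'r, 't \<times> 'u) torsor" where
  "prod_torsor T T' =
    \<lparr>sections = \<lambda>U. sections T U \<times> sections T' U,
     restr = \<lambda>U V. map_prod (restr T U V) (restr T' U V),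
     act = \<lambda>U (g, h). map_prod (act T U g) (act T' U h)\<rparr>"

text \<open>
  The pushforward of an \<open>F\<close>-torsor \<open>T\<close> along \<open>\<phi> : F \<rightarrow> F'\<close> (change of structure group) is the
  \<open>F'\<close>-torsor, unique up to isomorphism, that receives a \<open>\<phi>\<close>-equivariant morphism from \<open>T\<close>.
  The sum of two classes is the pushforward of the product along addition \<open>F \<times> F \<rightarrow> F\<close>.
\<close>

definition H1_map ::
  "'p topology \<Rightarrow> ('p, 's::ab_group_add) presheaf \<Rightarrow> ('p, 'r::ab_group_add) presheaf \<Rightarrow>
   ('p set \<Rightarrow> 's \<Rightarrow> 'r) \<Rightarrow> ('p, 's, 'p \<Rightarrow> 's) torsor set \<Rightarrow> ('p, 'r, 'p \<Rightarrow> 'r) torsor set" where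
  "H1_map X F F' \<phi> c = {S. is_torsor X F' S \<and> (\<exists>T\<in>c. \<exists>m. equivariant X F \<phi> T S m)}"

definition H1 ::
  "'p topology \<Rightarrow> ('p, 's::ab_group_add) presheaf \<Rightarrow> ('p, 's, 'p \<Rightarrow> 's) torsor set monoid" where
  "H1 X F =
    \<lparr>carrier = {torsor_class X F T |T :: ('p, 's, 'p \<Rightarrow> 's) torsor. is_torsor X F T},
     mult = \<lambda>c c'. {S. is_torsor X F S \<and> (\<exists>T\<in>c. \<exists>T'\<in>c'. \<exists>m.
       equivariant X (prod_presheaf F F) (\<lambda>U (g, h). g + h) (prod_torsor T T') S m)},
     one = torsor_class X F (trivial_torsor F)\<rparr>"

text \<open>
  For a surjection of sheaves \<open>\<phi> : F \<rightarrow> F'\<close>, the connecting map sends a global section \<open>s\<close> of \<open>F'\<close>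
  to the class of the torsor of local lifts of \<open>s\<close> to \<open>F\<close>. In terms of cocycles, a torsor with
  local sections \<open>t\<^sub>i\<close> has cocycle \<open>t\<^sub>j - t\<^sub>i\<close>.
\<close>

definition lift_torsor ::
  "'p topology \<Rightarrow> ('p, 's::ab_group_add) presheaf \<Rightarrow> ('p, 'r) presheaf \<Rightarrow>
   ('p set \<Rightarrow> 's \<Rightarrow> 'r) \<Rightarrow> 'r \<Rightarrow> ('p, 's, 's) torsor" where
  "lift_torsor X F F' \<phi> s =
    \<lparr>sections = \<lambda>U. {b \<in> sections F U. \<phi> U b = restr F' (topspace X) U s},
     restr = restr F, act = \<lambda>U g t. g + t\<rparr>"

definition connecting_map ::
  "'p topology \<Rightarrow> ('p, 's::ab_group_add) presheaf \<Rightarrow> ('p, 'r::ab_group_add) presheaf \<Rightarrow>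
   ('p set \<Rightarrow> 's \<Rightarrow> 'r) \<Rightarrow> 'r \<Rightarrow> ('p, 's, 'p \<Rightarrow> 's) torsor set" where
  "connecting_map X F F' \<phi> s =
     torsor_class X (kernel_sheaf F \<phi>) (lift_torsor X F F' \<phi> s)"

section \<open>The realization of a graph and its sheaves\<close>

text \<open>
  The map \<open>o\<close> is \<^const>\<open>tail\<close> and \<open>t\<close> is \<^const>\<open>head\<close>. The quotient of \<open>V \<squnion> E \<times> [0,1]\<close> is realized on
  representatives: \<open>Inl v\<close> for vertices and \<open>Inr (e, x)\<close> with \<open>0 < x < 1\<close> for the other points.
  Its topology is the quotient topology: \<open>V\<close> and \<open>E\<close> being discrete, a set is open iff its
  preimages under all \<open>edge_map G e : [0,1] \<rightarrow> |G|\<close> are open.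
\<close>

type_synonym ('v, 'e) point = "'v + 'e \<times> real"

definition edge_map :: "('v, 'e) pre_digraph \<Rightarrow> 'e \<Rightarrow> real \<Rightarrow> ('v, 'e) point" where
  "edge_map G e x =
    (if x = 0 then Inl (tail G e) else if x = 1 then Inl (head G e) else Inr (e, x))"

definition points :: "('v, 'e) pre_digraph \<Rightarrow> ('v, 'e) point set" where
  "points G = Inl ` verts G \<union> (\<Union>e\<in>arcs G. edge_map G e ` {0..1})"

definition realization :: "('v, 'e) pre_digraph \<Rightarrow> ('v, 'e) point topology" where
  "realization G = topology (\<lambda>U. U \<subseteq> points G \<and>
     (\<forall>e\<in>arcs G. openin (top_of_set {0..1}) {x \<in> {0..1}. edge_map G e x \<in> U}))"

lemma openin_realization:
  "openin (realization G) U \<longleftrightarrow> U \<subseteq> points G \<and>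
     (\<forall>e\<in>arcs G. openin (top_of_set {0..1}) {x \<in> {0..1}. edge_map G e x \<in> U})"
proof -
  have "istopology (\<lambda>U. U \<subseteq> points G \<and>
     (\<forall>e\<in>arcs G. openin (top_of_set {0..1}) {x \<in> {0..1}. edge_map G e x \<in> U}))"
    unfolding istopology_def
  proof (intro conjI allI impI)
    fix S T assume S: "S \<subseteq> points G \<and>
        (\<forall>e\<in>arcs G. openin (top_of_set {0..1}) {x \<in> {0..1}. edge_map G e x \<in> S})"
      and T: "T \<subseteq> points G \<and>
        (\<forall>e\<in>arcs G. openin (top_of_set {0..1}) {x \<in> {0..1}. edge_map G e x \<in> T})"
    show "S \<inter> T \<subseteq> points G" using S by blast
    have "{x \<in> {0..1}. edge_map G e x \<in> S \<inter> T} =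
        {x \<in> {0..1}. edge_map G e x \<in> S} \<inter> {x \<in> {0..1}. edge_map G e x \<in> T}" for e
      by auto
    then show "\<forall>e\<in>arcs G. openin (top_of_set {0..1}) {x \<in> {0..1}. edge_map G e x \<in> S \<inter> T}"
      using S T by (simp add: openin_Int)
  next
    fix K assume K: "\<forall>S\<in>K. S \<subseteq> points G \<and>
        (\<forall>e\<in>arcs G. openin (top_of_set {0..1}) {x \<in> {0..1}. edge_map G e x \<in> S})"
    show "\<Union>K \<subseteq> points G" using K by blast
    have "{x \<in> {0..1}. edge_map G e x \<in> \<Union>K} = (\<Union>S\<in>K. {x \<in> {0..1}. edge_map G e x \<in> S})" for e
      by auto
    then show "\<forall>e\<in>arcs G. openin (top_of_set {0..1}) {x \<in> {0..1}. edge_map G e x \<in> \<Union>K}"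
      using K by (auto intro!: openin_Union)
  qed
  then show ?thesis by (simp add: realization_def)
qed

definition constant_sheaf_Z :: "'p topology \<Rightarrow> ('p, 'p \<Rightarrow> int) presheaf" where
  "constant_sheaf_Z X =
    \<lparr>sections = \<lambda>U. {f. continuous_map (subtopology X U) (discrete_topology UNIV) f \<and>
       (\<forall>p. p \<notin> U \<longrightarrow> f p = 0)},
     restr = \<lambda>U V f p. if p \<in> V then f p else 0\<rparr>"

text \<open>Near the point \<open>x\<close> of \<open>[0,1]\<close>, \<open>h\<close> is \<open>a + b y\<close> on the edge \<open>e\<close>.\<close>

definition affine_near ::
  "('v, 'e) pre_digraph \<Rightarrow> (('v, 'e) point \<Rightarrow> real) \<Rightarrow> 'e \<Rightarrow> real \<Rightarrow> int \<Rightarrow> int \<Rightarrow> bool" where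
  "affine_near G h e x a b \<longleftrightarrow>
    (\<forall>\<^sub>F y in nhds x. y \<in> {0..1} \<longrightarrow> h (edge_map G e y) = of_int a + of_int b * y)"

definition slope ::
  "('v, 'e) pre_digraph \<Rightarrow> (('v, 'e) point \<Rightarrow> real) \<Rightarrow> 'e \<Rightarrow> real \<Rightarrow> int" where
  "slope G h e x = (THE b. \<exists>a. affine_near G h e x a b)"

definition PL :: "('v, 'e) pre_digraph \<Rightarrow> (('v, 'e) point, ('v, 'e) point \<Rightarrow> real) presheaf" where
  "PL G =
    \<lparr>sections = \<lambda>U. {h. continuous_map (subtopology (realization G) U) euclideanreal h \<and>
       (\<forall>e\<in>arcs G. \<forall>x\<in>{0..1}. edge_map G e x \<in> U \<longrightarrow> (\<exists>a b. affine_near G h e x a b)) \<and>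
       (\<forall>p. p \<notin> U \<longrightarrow> h p = 0)},
     restr = \<lambda>U V h p. if p \<in> V then h p else 0\<rparr>"

text \<open>The sheaf \<open>\<Prod>\<^sub>v v\<^sub>*\<int>\<close>.\<close>

definition vertex_sheaf :: "('v, 'e) pre_digraph \<Rightarrow> (('v, 'e) point, 'v \<Rightarrow> int) presheaf" where
  "vertex_sheaf G =
    \<lparr>sections = \<lambda>U. {f. \<forall>v. \<not> (v \<in> verts G \<and> Inl v \<in> U) \<longrightarrow> f v = 0},
     restr = \<lambda>U V f v. if Inl v \<in> V then f v else 0\<rparr>"

text \<open>
  The sheaf \<open>\<Prod>\<^sub>e e\<^sub>*\<int>\<close>, the pushforward being along \<open>edge_map G e\<close>: a section over \<open>U\<close> is, for each
  edge, a locally constant function on the preimage of \<open>U\<close> in \<open>[0,1]\<close>.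
\<close>

definition edge_sheaf :: "('v, 'e) pre_digraph \<Rightarrow> (('v, 'e) point, 'e \<Rightarrow> real \<Rightarrow> int) presheaf" where
  "edge_sheaf G =
    \<lparr>sections = \<lambda>U. {c. (\<forall>e\<in>arcs G. continuous_map (top_of_set {x \<in> {0..1}. edge_map G e x \<in> U})
         (discrete_topology UNIV) (c e)) \<and>
       (\<forall>e x. \<not> (e \<in> arcs G \<and> x \<in> {0..1} \<and> edge_map G e x \<in> U) \<longrightarrow> c e x = 0)},
     restr = \<lambda>U V c e x. if edge_map G e x \<in> V then c e x else 0\<rparr>"

text \<open>
  The sum of incoming derivatives at \<open>v\<close>: an edge with \<open>t e = v\<close> contributes its slope at \<open>1\<close>, an
  edge with \<open>o e = v\<close> minus its slope at \<open>0\<close>; a loop is in both sums.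
\<close>

definition diff ::
  "('v, 'e) pre_digraph \<Rightarrow> ('v, 'e) point set \<Rightarrow> (('v, 'e) point \<Rightarrow> real) \<Rightarrow> 'v \<Rightarrow> int" where
  "diff G U h v =
    (if v \<in> verts G \<and> Inl v \<in> U
     then (\<Sum>e\<in>in_arcs G v. slope G h e 1) + (\<Sum>e\<in>out_arcs G v. - slope G h e 0) else 0)"

definition edge_to_vertex ::
  "('v, 'e) pre_digraph \<Rightarrow> ('v, 'e) point set \<Rightarrow> ('e \<Rightarrow> real \<Rightarrow> int) \<Rightarrow> 'v \<Rightarrow> int" where
  "edge_to_vertex G U c v =
    (if v \<in> verts G \<and> Inl v \<in> U
     then (\<Sum>e\<in>in_arcs G v. c e 1) - (\<Sum>e\<in>out_arcs G v. c e 0) else 0)"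

definition edge_derivative ::
  "('v, 'e) pre_digraph \<Rightarrow> ('v, 'e) point set \<Rightarrow> (('v, 'e) point \<Rightarrow> real) \<Rightarrow> 'e \<Rightarrow> real \<Rightarrow> int" where
  "edge_derivative G U h e x =
    (if e \<in> arcs G \<and> x \<in> {0..1} \<and> edge_map G e x \<in> U then slope G h e x else 0)"

definition Harm :: "('v, 'e) pre_digraph \<Rightarrow> (('v, 'e) point, ('v, 'e) point \<Rightarrow> real) presheaf" where
  "Harm G = kernel_sheaf (PL G) (diff G)"

definition Omega :: "('v, 'e) pre_digraph \<Rightarrow> (('v, 'e) point, 'e \<Rightarrow> real \<Rightarrow> int) presheaf" where
  "Omega G = kernel_sheaf (edge_sheaf G) (edge_to_vertex G)"

definition Pic ::
  "('v, 'e) pre_digraph \<Rightarrow>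
    (('v, 'e) point, ('v, 'e) point \<Rightarrow> real, ('v, 'e) point \<Rightarrow> ('v, 'e) point \<Rightarrow> real) torsor set monoid"
  where
  "Pic G = H1 (realization G) (Harm G)"

definition Pic0 ::
  "('v, 'e) pre_digraph \<Rightarrow>
    (('v, 'e) point, ('v, 'e) point \<Rightarrow> real, ('v, 'e) point \<Rightarrow> ('v, 'e) point \<Rightarrow> real) torsor set monoid"
  where
  "Pic0 G = (Pic G)\<lparr>carrier := kernel (Pic G) (H1 (realization G) (Omega G))
     (H1_map (realization G) (Harm G) (Omega G) (edge_derivative G))\<rparr>"

section \<open>Cochains of a graph\<close>

definition Z_pow :: "'a set \<Rightarrow> ('a \<Rightarrow> int) monoid" where
  "Z_pow A = \<lparr>carrier = {f. \<forall>a. a \<notin> A \<longrightarrow> f a = 0}, mult = (+), one = 0\<rparr>"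

definition coboundary :: "('v, 'e) pre_digraph \<Rightarrow> ('v \<Rightarrow> int) \<Rightarrow> 'e \<Rightarrow> int" where
  "coboundary G f e = (if e \<in> arcs G then f (head G e) - f (tail G e) else 0)"

definition codifferential :: "('v, 'e) pre_digraph \<Rightarrow> ('e \<Rightarrow> int) \<Rightarrow> 'v \<Rightarrow> int" where
  "codifferential G \<omega> v =
    (if v \<in> verts G then (\<Sum>e\<in>in_arcs G v. \<omega> e) - (\<Sum>e\<in>out_arcs G v. \<omega> e) else 0)"

definition box0 :: "('v, 'e) pre_digraph \<Rightarrow> ('v \<Rightarrow> int) \<Rightarrow> 'v \<Rightarrow> int" where
  "box0 G f = codifferential G (coboundary G f)"

definition box0_image :: "('v, 'e) pre_digraph \<Rightarrow> ('v \<Rightarrow> int) set" where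
  "box0_image G = box0 G ` carrier (Z_pow (verts G))"

definition Cl_hat :: "('v, 'e) pre_digraph \<Rightarrow> ('v \<Rightarrow> int) set monoid" where
  "Cl_hat G = Z_pow (verts G) Mod box0_image G"

definition Cl_hat0 :: "('v, 'e) pre_digraph \<Rightarrow> ('v \<Rightarrow> int) set monoid" where
  "Cl_hat0 G =
    (Z_pow (verts G))\<lparr>carrier := codifferential G ` carrier (Z_pow (arcs G))\<rparr> Mod box0_image G"

definition coboundaries :: "('v, 'e) pre_digraph \<Rightarrow> ('e \<Rightarrow> int) set" where
  "coboundaries G = coboundary G ` carrier (Z_pow (verts G))"

definition graph_H1 :: "('v, 'e) pre_digraph \<Rightarrow> ('e \<Rightarrow> int) set monoid" where
  "graph_H1 G = Z_pow (arcs G) Mod coboundaries G"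

definition harmonic_cochains :: "('v, 'e) pre_digraph \<Rightarrow> ('e \<Rightarrow> int) set" where
  "harmonic_cochains G = kernel (Z_pow (arcs G)) (Z_pow (verts G)) (codifferential G)"

definition beta :: "('v, 'e) pre_digraph \<Rightarrow> ('e \<Rightarrow> int) \<Rightarrow> ('e \<Rightarrow> int) set" where
  "beta G \<omega> = coboundaries G #>\<^bsub>Z_pow (arcs G)\<^esub> \<omega>"

definition P_group :: "('v, 'e) pre_digraph \<Rightarrow> ('e \<Rightarrow> int) set set monoid" where
  "P_group G = graph_H1 G Mod (beta G ` harmonic_cochains G)"

section \<open>The maps\<close>

text \<open>The map on a quotient, whose elements are cosets, induced by a map that is constant on
  each coset.\<close>

definition induced :: "('a \<Rightarrow> 'b) \<Rightarrow> 'a set \<Rightarrow> 'b" where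
  "induced f C = the_elem (f ` C)"

definition chi :: "('v, 'e) pre_digraph \<Rightarrow> ('e \<Rightarrow> int) set set \<Rightarrow> ('v \<Rightarrow> int) set" where
  "chi G = induced (induced (\<lambda>\<omega>. box0_image G #>\<^bsub>Z_pow (verts G)\<^esub> codifferential G \<omega>))"

definition delta ::
  "('v, 'e) pre_digraph \<Rightarrow> ('v \<Rightarrow> int) \<Rightarrow>
    (('v, 'e) point, ('v, 'e) point \<Rightarrow> real, ('v, 'e) point \<Rightarrow> ('v, 'e) point \<Rightarrow> real) torsor set" where
  "delta G = connecting_map (realization G) (PL G) (vertex_sheaf G) (diff G)"

definition delta_bar ::
  "('v, 'e) pre_digraph \<Rightarrow> ('v \<Rightarrow> int) set \<Rightarrow>
    (('v, 'e) point, ('v, 'e) point \<Rightarrow> real, ('v, 'e) point \<Rightarrow> ('v, 'e) point \<Rightarrow> real) torsor set" where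
  "delta_bar G = induced (delta G)"

text \<open>
  The identification of \<open>\<int>\<^sup>E / d \<int>\<^sup>V\<close> with \<open>H\<^sup>1(|G|, \<int>)\<close> is the one given by \<open>\<int>\<close>-valued Cech cocycles
  for the open cover of \<open>|G|\<close> by the half stars and the open edges, with the convention
  \<open>t\<^sub>j - t\<^sub>i\<close> above. A \<open>\<int>\<close>-torsor has a section \<open>t v\<close> on each half star; extending \<open>t (tail G e)\<close>
  along the open edge \<open>e\<close> to a section \<open>s e\<close>, the class of the torsor is that of the cochain
  \<open>e \<mapsto> t (head G e) - s e\<close>, the difference being taken on the second half of \<open>e\<close>; a change of
  the \<open>t v\<close> by \<open>f v\<close> adds \<open>d f\<close>. Full open stars would not do because of loops.
\<close>

definition half_star :: "('v, 'e) pre_digraph \<Rightarrow> 'v \<Rightarrow> ('v, 'e) point set" where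
  "half_star G v = {Inl v} \<union> (\<Union>e\<in>out_arcs G v. edge_map G e ` {0<..<1/2})
     \<union> (\<Union>e\<in>in_arcs G v. edge_map G e ` {1/2<..<1})"

definition cochain_class ::
  "('v, 'e) pre_digraph \<Rightarrow> ('e \<Rightarrow> int) \<Rightarrow>
    (('v, 'e) point, ('v, 'e) point \<Rightarrow> int, ('v, 'e) point \<Rightarrow> ('v, 'e) point \<Rightarrow> int) torsor set" where
  "cochain_class G \<omega> =
    {T. is_torsor (realization G) (constant_sheaf_Z (realization G)) T \<and>
      (\<exists>t s. (\<forall>v\<in>verts G. t v \<in> sections T (half_star G v)) \<and>
        (\<forall>e\<in>arcs G.
          let I = edge_map G e ` {0<..<1};
              J = edge_map G e ` {0<..<1/2};
              K = edge_map G e ` {1/2<..<1}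
          in s e \<in> sections T I \<and>
             restr T I J (s e) = restr T (half_star G (tail G e)) J (t (tail G e)) \<and>
             restr T (half_star G (head G e)) K (t (head G e)) =
               act T K (\<lambda>p. if p \<in> K then \<omega> e else 0) (restr T I K (s e))))}"

definition const_inclusion :: "'p set \<Rightarrow> ('p \<Rightarrow> int) \<Rightarrow> 'p \<Rightarrow> real" where
  "const_inclusion U f p = of_int (f p)"

definition q_star ::
  "('v, 'e) pre_digraph \<Rightarrow> ('e \<Rightarrow> int) set \<Rightarrow>
    (('v, 'e) point, ('v, 'e) point \<Rightarrow> real, ('v, 'e) point \<Rightarrow> ('v, 'e) point \<Rightarrow> real) torsor set" where
  "q_star G c =
    H1_map (realization G) (constant_sheaf_Z (realization G)) (Harm G) const_inclusion
      (induced (cochain_class G) c)"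

definition q_bar ::
  "('v, 'e) pre_digraph \<Rightarrow> ('e \<Rightarrow> int) set set \<Rightarrow>
    (('v, 'e) point, ('v, 'e) point \<Rightarrow> real, ('v, 'e) point \<Rightarrow> ('v, 'e) point \<Rightarrow> real) torsor set" where
  "q_bar G = induced (q_star G)"

end

theory Submission
  imports Defs
begin

text \<open>
  For \<open>f \<in> \<int>\<^sup>V\<close>, the class \<open>\<delta> f\<close> is that of the torsor \<open>lift f\<close> of local piecewise linear
  functions with \<open>diff\<close> equal to \<open>f\<close>. An isomorphism \<open>lift f \<rightarrow> lift g\<close> is addition of a global
  piecewise linear function; such a function is affine with integral coefficients on every edge, so
  that its \<open>diff\<close> is \<open>\<box>\<^sub>0\<close> of its values at the vertices. Hence the kernel of \<open>\<delta>\<close> is the image of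
  \<open>\<box>\<^sub>0\<close>. A trivialization of the image of \<open>lift f\<close> in \<open>H\<^sup>1(\<Omega>)\<close> differs from the edge derivative by
  a global \<open>\<omega> \<in> \<int>\<^sup>E\<close> with \<open>d\<^sup>* \<omega> = f\<close>, so that \<open>\<delta> f\<close> lies in \<open>Pic\<^sup>0\<close> iff \<open>f\<close> is in the image of
  \<open>d\<^sup>*\<close>.

  Conversely, a torsor under harmonic functions has sections near each vertex and on each open
  edge, and the latter may be chosen to agree with the former near the tail of the edge. Near the
  head they then differ by \<open>a + b x\<close>, and these discrepancies can be absorbed by functions affine on
  the edges, which identifies the torsor with some \<open>lift f\<close>. So \<open>\<delta>\<close> is onto, and for a torsor
  induced from the \<open>\<int>\<close>-torsor of a cochain \<open>\<omega>\<close>, where \<open>a = \<omega>\<close> and \<open>b = 0\<close>, one finds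
  \<open>f = - d\<^sup>* \<omega>\<close>, that is, \<open>q\<^sub>* \<omega> = - \<delta> (d\<^sup>* \<omega>)\<close>. All claims follow from these facts.
\<close>

section \<open>Sheaves and torsors\<close>

text \<open>In terms of exact sequences, the kernel of \<open>\<delta>\<close> comes from the global
  sections of \<open>PL\<close> being \<int>^V, and its surjectivity from the map H^1(Harm)
  \<rightarrow> H^1(PL) being zero. Neither sequence is set up. Classes are sets of torsors, so each
  identity between them is reduced to writing down an equivariant map. This suffices because a
  morphism of torsors is an isomorphism, and because the torsor that receives an equivariant map
  from a given one is unique up to isomorphism. One obstacle is of type: lift torsors have functions
  as sections, members of classes have families of functions, so the former are transported along
  constant families. Two geometric facts carry the rest. An open edge contains no vertex, so
  harmonic functions on an interval in it are affine and extend, and every torsor has a section on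
  it. At a vertex, a single incident edge can realize any value of \<open>diff\<close>, so lifts
  exist locally. The minus sign appears when the jump of a section of the \<int>-torsor at the
  midpoint of \<open>e\<close> is smoothed out into the constant slope
  \<open>- \<omega> e\<close>.\<close>

lemma sheaf_restr_in:
  assumes "sheaf X F" "openin X U" "openin X V" "V \<subseteq> U" "s \<in> sections F U"
  shows "restr F U V s \<in> sections F V"
  using assms(1)[unfolded sheaf_def, THEN conjunct1, rule_format, of U V] assms(2-5)
  by (simp add: Pi_iff)

lemma sheaf_restr_id:
  assumes "sheaf X F" "openin X U" "s \<in> sections F U"
  shows "restr F U U s = s"
  using assms(1)[unfolded sheaf_def, THEN conjunct2, THEN conjunct1, rule_format, of U s] assms(2,3)
  by simp

lemma sheaf_restr_restr:
  assumes "sheaf X F" "openin X U" "openin X V" "openin X W" "W \<subseteq> V" "V \<subseteq> U" "s \<in> sections F U"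
  shows "restr F V W (restr F U V s) = restr F U W s"
  using assms(1)[unfolded sheaf_def, THEN conjunct2, THEN conjunct2, THEN conjunct1, rule_format,
      of U V W s] assms(2-7) by simp

lemma sheaf_glue:
  assumes "sheaf X F" "\<And>U. U \<in> \<U> \<Longrightarrow> openin X U" "\<And>U. U \<in> \<U> \<Longrightarrow> s U \<in> sections F U"
    "\<And>U V. U \<in> \<U> \<Longrightarrow> V \<in> \<U> \<Longrightarrow> restr F U (U \<inter> V) (s U) = restr F V (U \<inter> V) (s V)"
  shows "\<exists>!r. r \<in> sections F (\<Union>\<U>) \<and> (\<forall>U\<in>\<U>. restr F (\<Union>\<U>) U r = s U)"
  by (rule assms(1)[unfolded sheaf_def, THEN conjunct2, THEN conjunct2, THEN conjunct2,
      rule_format, of \<U> s]) (use assms(2-4) in blast)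

text \<open>Both sections solve the gluing problem posed by the restrictions of \<open>r\<close>,
  and that problem has only one solution.\<close>

lemma sheaf_separated:
  assumes "sheaf X F" "\<And>U. U \<in> \<U> \<Longrightarrow> openin X U"
    "r \<in> sections F (\<Union>\<U>)" "r' \<in> sections F (\<Union>\<U>)"
    "\<And>U. U \<in> \<U> \<Longrightarrow> restr F (\<Union>\<U>) U r = restr F (\<Union>\<U>) U r'"
  shows "r = r'"
proof -
  have o: "openin X (\<Union>\<U>)" using assms(2) by blast
  have "\<exists>!q. q \<in> sections F (\<Union>\<U>) \<and> (\<forall>U\<in>\<U>. restr F (\<Union>\<U>) U q = restr F (\<Union>\<U>) U r)"
  proof (rule sheaf_glue[OF assms(1,2)])
    fix U assume "U \<in> \<U>"
    then show "restr F (\<Union>\<U>) U r \<in> sections F U"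
      using sheaf_restr_in[OF assms(1) o _ _ assms(3)] assms(2) by blast
  next
    fix U V assume UV: "U \<in> \<U>" "V \<in> \<U>"
    have oo: "openin X U" "openin X V" "openin X (U \<inter> V)" using UV assms(2) by blast+
    have sub: "U \<subseteq> \<Union>\<U>" "V \<subseteq> \<Union>\<U>" using UV by blast+
    show "restr F U (U \<inter> V) (restr F (\<Union>\<U>) U r) = restr F V (U \<inter> V) (restr F (\<Union>\<U>) V r)"
      using sheaf_restr_restr[OF assms(1) o oo(1) oo(3) Int_lower1 sub(1) assms(3)]
        sheaf_restr_restr[OF assms(1) o oo(2) oo(3) Int_lower2 sub(2) assms(3)] by simp
  qed
  then show ?thesis using assms(3-5) by metis
qed

lemma sheaf_glue2:
  assumes F: "sheaf X F" and U: "openin X U" and V: "openin X V"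
    and s: "s \<in> sections F U" and t: "t \<in> sections F V"
    and eq: "restr F U (U \<inter> V) s = restr F V (U \<inter> V) t"
  obtains r where "r \<in> sections F (U \<union> V)" "restr F (U \<union> V) U r = s" "restr F (U \<union> V) V r = t"
\<comment> \<open>The gluing axiom indexes sections by the open sets themselves, so a family cannot
  hold two sections when \<open>U = V\<close>.\<close>
proof (cases "U = V")
  case True
  then have "s = t" using eq sheaf_restr_id[OF F] U s t by simp
  then show ?thesis using True that[of s] sheaf_restr_id[OF F] U s by simp
next
  case False
  define \<sigma> where "\<sigma> W = (if W = U then s else t)" for W
  have "\<exists>!r. r \<in> sections F (\<Union>{U, V}) \<and> (\<forall>W\<in>{U, V}. restr F (\<Union>{U, V}) W r = \<sigma> W)"
  proof (rule sheaf_glue[OF F])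
    fix W W' assume W: "W \<in> {U, V}" "W' \<in> {U, V}"
    show "restr F W (W \<inter> W') (\<sigma> W) = restr F W' (W \<inter> W') (\<sigma> W')"
      using W eq False by (auto simp: \<sigma>_def Int_commute)
  qed (use U V s t in \<open>auto simp: \<sigma>_def\<close>)
  then show ?thesis using that False by (auto simp: \<sigma>_def)
qed

section \<open>Presheaves of groups, torsors and differences of sections\<close>

definition group_presheaf :: "'p topology \<Rightarrow> ('p, 's::ab_group_add, 'm) presheaf_scheme \<Rightarrow> bool" where
  "group_presheaf X F \<longleftrightarrow> (\<forall>U. openin X U \<longrightarrow>
     0 \<in> sections F U \<and> (\<forall>g\<in>sections F U. \<forall>h\<in>sections F U. g - h \<in> sections F U) \<and>
     (\<forall>V. openin X V \<and> V \<subseteq> U \<longrightarrow> (\<forall>g\<in>sections F U. restr F U V g \<in> sections F V)) \<and>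
     (\<forall>V. openin X V \<and> V \<subseteq> U \<longrightarrow> (\<forall>g\<in>sections F U. \<forall>h\<in>sections F U.
        restr F U V (g - h) = restr F U V g - restr F U V h)))"

context
  fixes X :: "'p topology" and F :: "('p, 's::ab_group_add) presheaf"
  assumes F: "group_presheaf X F"
begin

lemma group_presheaf_zero: "openin X U \<Longrightarrow> 0 \<in> sections F U"
  using F unfolding group_presheaf_def by simp

lemma group_presheaf_minus:
  "openin X U \<Longrightarrow> g \<in> sections F U \<Longrightarrow> h \<in> sections F U \<Longrightarrow> g - h \<in> sections F U"
  using F unfolding group_presheaf_def by simp

lemma group_presheaf_uminus:
  "openin X U \<Longrightarrow> g \<in> sections F U \<Longrightarrow> - g \<in> sections F U"
  using group_presheaf_minus[of U 0 g] group_presheaf_zero by simp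

lemma group_presheaf_plus:
  "openin X U \<Longrightarrow> g \<in> sections F U \<Longrightarrow> h \<in> sections F U \<Longrightarrow> g + h \<in> sections F U"
  using group_presheaf_minus[of U g "- h"] group_presheaf_uminus by simp

lemma group_presheaf_restr:
  "openin X U \<Longrightarrow> openin X V \<Longrightarrow> V \<subseteq> U \<Longrightarrow> g \<in> sections F U \<Longrightarrow> restr F U V g \<in> sections F V"
  using F unfolding group_presheaf_def by simp

end

context
  fixes X :: "'p topology" and F :: "('p, 's::ab_group_add) presheaf" and T :: "('p, 's, 't) torsor"
  assumes T: "is_torsor X F T"
begin

lemma torsor_sheaf: "sheaf X T"
  using T unfolding is_torsor_def by simp

lemma torsor_act_in:
  "openin X U \<Longrightarrow> g \<in> sections F U \<Longrightarrow> t \<in> sections T U \<Longrightarrow> act T U g t \<in> sections T U"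
  using T unfolding is_torsor_def by simp

lemma torsor_act_zero: "openin X U \<Longrightarrow> t \<in> sections T U \<Longrightarrow> act T U 0 t = t"
  using T unfolding is_torsor_def by simp

lemma torsor_act_plus:
  "openin X U \<Longrightarrow> g \<in> sections F U \<Longrightarrow> h \<in> sections F U \<Longrightarrow> t \<in> sections T U \<Longrightarrow>
    act T U (g + h) t = act T U g (act T U h t)"
  using T unfolding is_torsor_def by simp

lemma torsor_restr_act:
  "openin X U \<Longrightarrow> openin X V \<Longrightarrow> V \<subseteq> U \<Longrightarrow> g \<in> sections F U \<Longrightarrow> t \<in> sections T U \<Longrightarrow>
    restr T U V (act T U g t) = act T V (restr F U V g) (restr T U V t)"
  using T unfolding is_torsor_def by simp

lemma torsor_transitive:
  "openin X U \<Longrightarrow> s \<in> sections T U \<Longrightarrow> t \<in> sections T U \<Longrightarrow> \<exists>!g. g \<in> sections F U \<and> t = act T U g s"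
  using T unfolding is_torsor_def by simp

lemma torsor_free:
  "openin X U \<Longrightarrow> g \<in> sections F U \<Longrightarrow> h \<in> sections F U \<Longrightarrow> t \<in> sections T U \<Longrightarrow>
    act T U g t = act T U h t \<Longrightarrow> g = h"
  using torsor_transitive[of U t "act T U g t"] torsor_act_in by metis

lemma torsor_locally_nonempty:
  "x \<in> topspace X \<Longrightarrow> \<exists>U. openin X U \<and> x \<in> U \<and> sections T U \<noteq> {}"
  using T unfolding is_torsor_def by simp

lemma torsor_restr_in:
  "openin X U \<Longrightarrow> openin X V \<Longrightarrow> V \<subseteq> U \<Longrightarrow> t \<in> sections T U \<Longrightarrow> restr T U V t \<in> sections T V"
  using sheaf_restr_in[OF torsor_sheaf] .

lemma torsor_restr_restr:
  "openin X U \<Longrightarrow> openin X V \<Longrightarrow> openin X W \<Longrightarrow> W \<subseteq> V \<Longrightarrow> V \<subseteq> U \<Longrightarrow>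
    t \<in> sections T U \<Longrightarrow> restr T V W (restr T U V t) = restr T U W t"
  using sheaf_restr_restr[OF torsor_sheaf] .

end

text \<open>The difference \<open>t - s\<close> in the cocycle convention. It has a meaning only for
  two sections over the same open set.\<close>

definition torsor_diff ::
  "('p, 's) presheaf \<Rightarrow> ('p, 's, 't) torsor \<Rightarrow> 'p set \<Rightarrow> 't \<Rightarrow> 't \<Rightarrow> 's" where
  "torsor_diff F T U t s = (THE g. g \<in> sections F U \<and> t = act T U g s)"

lemma torsor_diff_in:
  assumes "is_torsor X F T" "openin X U" "s \<in> sections T U" "t \<in> sections T U"
  shows "torsor_diff F T U t s \<in> sections F U" "act T U (torsor_diff F T U t s) s = t"
  using theI'[OF torsor_transitive[OF assms]] unfolding torsor_diff_def by auto

lemma torsor_diff_act: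
  assumes "is_torsor X F T" "openin X U" "s \<in> sections T U" "g \<in> sections F U"
  shows "torsor_diff F T U (act T U g s) s = g"
  using torsor_free[OF assms(1,2) _ assms(4,3)] torsor_diff_in[OF assms(1-3)]
    torsor_act_in[OF assms(1,2,4,3)] by metis

lemma torsor_diff_restr:
  assumes F: "group_presheaf X F" and T: "is_torsor X F T" and U: "openin X U" "openin X V" "V \<subseteq> U"
    and s: "s \<in> sections T U" "t \<in> sections T U"
  shows "torsor_diff F T V (restr T U V t) (restr T U V s) = restr F U V (torsor_diff F T U t s)"
proof -
  note d = torsor_diff_in[OF T U(1) s]
  have "restr T U V t = act T V (restr F U V (torsor_diff F T U t s)) (restr T U V s)"
    using torsor_restr_act[OF T U d(1) s(1)] d(2) by simp
  then show ?thesis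
    using torsor_diff_act[OF T U(2) torsor_restr_in[OF T U s(1)] group_presheaf_restr[OF F U d(1)]]
    by simp
qed

section \<open>Equivariant maps and uniqueness of pushforwards\<close>

context
  fixes X :: "'p topology" and F :: "('p, 's) presheaf" and \<phi> :: "'p set \<Rightarrow> 's \<Rightarrow> 'r"
    and T :: "('p, 's, 't) torsor" and T' :: "('p, 'r, 'u) torsor" and m
  assumes m: "equivariant X F \<phi> T T' m"
begin

lemma equivariant_in: "openin X U \<Longrightarrow> t \<in> sections T U \<Longrightarrow> m U t \<in> sections T' U"
  using m unfolding equivariant_def by (simp add: Pi_iff)

lemma equivariant_restr:
  "openin X U \<Longrightarrow> openin X V \<Longrightarrow> V \<subseteq> U \<Longrightarrow> t \<in> sections T U \<Longrightarrow>
    m V (restr T U V t) = restr T' U V (m U t)"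
  using m unfolding equivariant_def by (simp add: Pi_iff)

lemma equivariant_act:
  "openin X U \<Longrightarrow> g \<in> sections F U \<Longrightarrow> t \<in> sections T U \<Longrightarrow>
    m U (act T U g t) = act T' U (\<phi> U g) (m U t)"
  using m unfolding equivariant_def by (simp add: Pi_iff)

end

abbreviation "morphism X F \<equiv> equivariant X F (\<lambda>U g. g)"

lemma equivariant_comp:
  assumes m: "equivariant X F \<phi> T T' m" and m': "equivariant X F' \<psi> T' T'' m'"
    and \<phi>: "\<And>U g. openin X U \<Longrightarrow> g \<in> sections F U \<Longrightarrow> \<phi> U g \<in> sections F' U"
  shows "equivariant X F (\<lambda>U g. \<psi> U (\<phi> U g)) T T'' (\<lambda>U t. m' U (m U t))"
  unfolding equivariant_def
  using equivariant_in[OF m] equivariant_in[OF m'] equivariant_restr[OF m] equivariant_restr[OF m']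
    equivariant_act[OF m] equivariant_act[OF m'] \<phi> by auto

text \<open>The image of a section \<open>s\<close> of \<open>S\<close> is glued from the local sections \<open>g \<cdot> m' t\<close>, where
  \<open>s = g \<cdot> m t\<close>.\<close>

lemma pushforward_unique:
  assumes F': "group_presheaf X F'" and S: "is_torsor X F' S" and S': "is_torsor X F' S'"
    and m: "equivariant X F \<phi> T S m" and m': "equivariant X F \<phi> T S' m'"
    and \<phi>: "\<And>U g. openin X U \<Longrightarrow> g \<in> sections F U \<Longrightarrow> \<phi> U g \<in> sections F' U"
    and res: "\<And>U V t. openin X U \<Longrightarrow> openin X V \<Longrightarrow> V \<subseteq> U \<Longrightarrow> t \<in> sections T U \<Longrightarrow>
      restr T U V t \<in> sections T V"
    and trans: "\<And>U t t'. openin X U \<Longrightarrow> t \<in> sections T U \<Longrightarrow> t' \<in> sections T U \<Longrightarrow>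
      \<exists>g\<in>sections F U. t' = act T U g t"
    and loc: "\<And>x. x \<in> topspace X \<Longrightarrow> \<exists>U. openin X U \<and> x \<in> U \<and> sections T U \<noteq> {}"
  shows "\<exists>k. morphism X F' S S' k"
proof -
  \<comment> \<open>The condition refers to every open set on which \<open>T\<close> has a section,
    not to a chosen cover. Once \<open>R\<close> is known to be a function, compatibility with
    restriction and action follows by checking that the expected value satisfies
    \<open>R\<close>.\<close>
  define R where "R U s s' \<longleftrightarrow> s' \<in> sections S' U \<and> (\<forall>W t g. openin X W \<and> W \<subseteq> U \<and>
     t \<in> sections T W \<and> g \<in> sections F' W \<and> restr S U W s = act S W g (m W t) \<longrightarrow>
     restr S' U W s' = act S' W g (m' W t))" for U s s'
  have cover: "\<Union>{W. openin X W \<and> W \<subseteq> U \<and> sections T W \<noteq> {}} = U" if U: "openin X U" for U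
  proof
    show "U \<subseteq> \<Union>{W. openin X W \<and> W \<subseteq> U \<and> sections T W \<noteq> {}}"
    proof
      fix x assume x: "x \<in> U"
      then obtain N t where N: "openin X N" "x \<in> N" "t \<in> sections T N"
        using loc[of x] openin_subset[OF U] by blast
      then have "restr T N (N \<inter> U) t \<in> sections T (N \<inter> U)" using U by (intro res) auto
      then show "x \<in> \<Union>{W. openin X W \<and> W \<subseteq> U \<and> sections T W \<noteq> {}}"
        using N x U by (intro UnionI[of "N \<inter> U"]) auto
    qed
  qed blast
  \<comment> \<open>Two sections of \<open>T\<close> differ by some \<open>k\<close>, and both
    \<open>m\<close> and \<open>m'\<close> turn it into the same \<open>\<phi> W k\<close>. Freeness
    of the action on \<open>S\<close> then gives \<open>g = h + \<phi> W k\<close>, and the same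
    relation equates the two values in \<open>S'\<close>.\<close>
  have indep: "act S' W g (m' W t) = act S' W h (m' W u)"
    if W: "openin X W" and t: "t \<in> sections T W" "u \<in> sections T W"
      and g: "g \<in> sections F' W" "h \<in> sections F' W"
      and eq: "act S W g (m W t) = act S W h (m W u)" for W t u g h
  proof -
    obtain k where k: "k \<in> sections F W" "u = act T W k t" using trans[OF W t] by blast
    note pk = \<phi>[OF W k(1)]
    note sum = group_presheaf_plus[OF F' W g(2) pk]
    have "act S W h (m W u) = act S W (h + \<phi> W k) (m W t)"
      using equivariant_act[OF m W k(1) t(1)] torsor_act_plus[OF S W g(2) pk equivariant_in[OF m W t(1)]]
        k(2) by simp
    then have "g = h + \<phi> W k"
      using torsor_free[OF S W g(1) sum equivariant_in[OF m W t(1)]] eq by simp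
    moreover have "act S' W h (m' W u) = act S' W (h + \<phi> W k) (m' W t)"
      using equivariant_act[OF m' W k(1) t(1)]
        torsor_act_plus[OF S' W g(2) pk equivariant_in[OF m' W t(1)]] k(2) by simp
    ultimately show ?thesis by simp
  qed
  have ex: "\<exists>s'. R U s s'" if U: "openin X U" and s: "s \<in> sections S U" for U s
  proof -
    let ?C = "{W. openin X W \<and> W \<subseteq> U \<and> sections T W \<noteq> {}}"
    have "\<forall>W\<in>?C. \<exists>p. fst p \<in> sections T W \<and> snd p \<in> sections F' W \<and>
        restr S U W s = act S W (snd p) (m W (fst p))"
    proof
      fix W assume W: "W \<in> ?C"
      then obtain t where t: "t \<in> sections T W" by blast
      have "m W t \<in> sections S W" "restr S U W s \<in> sections S W"
        using equivariant_in[OF m _ t] torsor_restr_in[OF S U _ _ s] W by auto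
      then obtain g where "g \<in> sections F' W" "restr S U W s = act S W g (m W t)"
        using torsor_transitive[OF S, of W "m W t" "restr S U W s"] W by blast
      then show "\<exists>p. fst p \<in> sections T W \<and> snd p \<in> sections F' W \<and>
        restr S U W s = act S W (snd p) (m W (fst p))"
        using t by (intro exI[of _ "(t, g)"]) simp
    qed
    from bchoice[OF this] obtain p where p: "\<forall>W\<in>?C. fst (p W) \<in> sections T W \<and>
        snd (p W) \<in> sections F' W \<and> restr S U W s = act S W (snd (p W)) (m W (fst (p W)))" ..
    define t where "t W = fst (p W)" for W
    define g where "g W = snd (p W)" for W
    have tg: "\<And>W. W \<in> ?C \<Longrightarrow> t W \<in> sections T W"
        "\<And>W. W \<in> ?C \<Longrightarrow> g W \<in> sections F' W"
        "\<And>W. W \<in> ?C \<Longrightarrow> restr S U W s = act S W (g W) (m W (t W))"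
      using p by (simp_all add: t_def g_def)
    have "\<exists>!r. r \<in> sections S' (\<Union>?C) \<and> (\<forall>W\<in>?C. restr S' (\<Union>?C) W r = act S' W (g W) (m' W (t W)))"
    proof (rule sheaf_glue[OF torsor_sheaf[OF S']])
      fix W assume W: "W \<in> ?C"
      then show "act S' W (g W) (m' W (t W)) \<in> sections S' W"
        using torsor_act_in[OF S' _ tg(2)[OF W] equivariant_in[OF m' _ tg(1)[OF W]]] by blast
    next
      fix V W assume V: "V \<in> ?C" and W: "W \<in> ?C"
      have *: "restr S U (V \<inter> W) s = act S (V \<inter> W) (restr F' W' (V \<inter> W) (g W'))
                  (m (V \<inter> W) (restr T W' (V \<inter> W) (t W')))"
        "restr S' W' (V \<inter> W) (act S' W' (g W') (m' W' (t W'))) =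
           act S' (V \<inter> W) (restr F' W' (V \<inter> W) (g W')) (m' (V \<inter> W) (restr T W' (V \<inter> W) (t W')))"
        "restr T W' (V \<inter> W) (t W') \<in> sections T (V \<inter> W)"
        "restr F' W' (V \<inter> W) (g W') \<in> sections F' (V \<inter> W)"
        if "W' = V \<or> W' = W" for W'
      proof -
        have W': "W' \<in> ?C" "openin X W'" "W' \<subseteq> U" "openin X (V \<inter> W)" "V \<inter> W \<subseteq> W'"
          using that V W by auto
        note i = equivariant_in[OF m W'(2) tg(1)[OF W'(1)]] equivariant_in[OF m' W'(2) tg(1)[OF W'(1)]]
        have "restr S U (V \<inter> W) s = restr S W' (V \<inter> W) (restr S U W' s)"
          using torsor_restr_restr[OF S U W'(2,4,5,3) s] by simp
        then show "restr S U (V \<inter> W) s = act S (V \<inter> W) (restr F' W' (V \<inter> W) (g W'))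
                  (m (V \<inter> W) (restr T W' (V \<inter> W) (t W')))"
          using tg(3)[OF W'(1)] torsor_restr_act[OF S W'(2,4,5) tg(2)[OF W'(1)] i(1)]
            equivariant_restr[OF m W'(2,4,5) tg(1)[OF W'(1)]] by simp
        show "restr S' W' (V \<inter> W) (act S' W' (g W') (m' W' (t W'))) =
           act S' (V \<inter> W) (restr F' W' (V \<inter> W) (g W')) (m' (V \<inter> W) (restr T W' (V \<inter> W) (t W')))"
          using torsor_restr_act[OF S' W'(2,4,5) tg(2)[OF W'(1)] i(2)]
            equivariant_restr[OF m' W'(2,4,5) tg(1)[OF W'(1)]] by simp
        show "restr T W' (V \<inter> W) (t W') \<in> sections T (V \<inter> W)"
          using res[OF W'(2,4,5) tg(1)[OF W'(1)]] .
        show "restr F' W' (V \<inter> W) (g W') \<in> sections F' (V \<inter> W)"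
          using group_presheaf_restr[OF F' W'(2,4,5) tg(2)[OF W'(1)]] .
      qed
      have "openin X (V \<inter> W)" using V W by auto
      then show "restr S' V (V \<inter> W) (act S' V (g V) (m' V (t V))) =
          restr S' W (V \<inter> W) (act S' W (g W) (m' W (t W)))"
        using indep[OF _ *(3)[of V] *(3)[of W] *(4)[of V] *(4)[of W]] *(1)[of V] *(1)[of W] *(2)[of V] *(2)[of W]
        by simp
    qed auto
    from ex1_implies_ex[OF this[unfolded cover[OF U]]] obtain r where
      "r \<in> sections S' U \<and> (\<forall>W\<in>?C. restr S' U W r = act S' W (g W) (m' W (t W)))" ..
    then have r: "r \<in> sections S' U"
        "\<And>W. W \<in> ?C \<Longrightarrow> restr S' U W r = act S' W (g W) (m' W (t W))"
      by simp_all
    have "R U s r" unfolding R_def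
    proof (intro conjI allI impI, rule r(1), elim conjE)
      fix W u h assume W: "openin X W" "W \<subseteq> U" "u \<in> sections T W" "h \<in> sections F' W"
          "restr S U W s = act S W h (m W u)"
      then have C: "W \<in> ?C" by blast
      show "restr S' U W r = act S' W h (m' W u)"
        using indep[OF W(1) tg(1)[OF C] W(3) tg(2)[OF C] W(4)] tg(3)[OF C] W(5) r(2)[OF C] by simp
    qed
    then show ?thesis by blast
  qed
  have un: "s' = s''" if U: "openin X U" and s: "s \<in> sections S U" and R: "R U s s'" "R U s s''" for U s s' s''
  proof (rule sheaf_separated[OF torsor_sheaf[OF S'], of "{W. openin X W \<and> W \<subseteq> U \<and> sections T W \<noteq> {}}"];
      (unfold cover[OF U])?)
    fix W assume W: "W \<in> {W. openin X W \<and> W \<subseteq> U \<and> sections T W \<noteq> {}}"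
    then obtain t where t: "t \<in> sections T W" by blast
    have "m W t \<in> sections S W" "restr S U W s \<in> sections S W"
      using equivariant_in[OF m _ t] torsor_restr_in[OF S U _ _ s] W by auto
    then obtain g where "g \<in> sections F' W" "restr S U W s = act S W g (m W t)"
      using torsor_transitive[OF S] W t by blast
    then show "restr S' U W s' = restr S' U W s''" using R W t unfolding R_def by auto
  qed (use R in \<open>auto simp: R_def\<close>)
  define k where "k U s = (THE s'. R U s s')" for U s
  have R: "R U s (k U s)" if "openin X U" "s \<in> sections S U" for U s
    unfolding k_def by (rule theI') (use ex un that in blast)
  have kI: "k U s = s'" if "openin X U" "s \<in> sections S U" "R U s s'" for U s s'
    using un R that by blast
  have "morphism X F' S S' k"
    unfolding equivariant_def
  proof (intro allI impI conjI ballI)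
    fix U assume U: "openin X U"
    show "k U \<in> sections S U \<rightarrow> sections S' U" using R[OF U] by (auto simp: R_def)
    fix s assume s: "s \<in> sections S U"
    note Rs = R[OF U s, unfolded R_def]
    have ks: "k U s \<in> sections S' U" using Rs by blast
    { fix V assume V: "openin X V \<and> V \<subseteq> U"
      have "R V (restr S U V s) (restr S' U V (k U s))" unfolding R_def
      proof (intro conjI allI impI)
        show "restr S' U V (k U s) \<in> sections S' V" using torsor_restr_in[OF S' U _ _ ks] V by blast
        fix W t g assume a: "openin X W \<and> W \<subseteq> V \<and> t \<in> sections T W \<and> g \<in> sections F' W \<and>
            restr S V W (restr S U V s) = act S W g (m W t)"
        then show "restr S' V W (restr S' U V (k U s)) = act S' W g (m' W t)"
          using torsor_restr_restr[OF S U _ _ _ _ s, of V W] torsor_restr_restr[OF S' U _ _ _ _ ks, of V W]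
            Rs V by auto
      qed
      then show "k V (restr S U V s) = restr S' U V (k U s)"
        using V torsor_restr_in[OF S U _ _ s] by (intro kI) auto }
    fix g assume g: "g \<in> sections F' U"
    have "R U (act S U g s) (act S' U g (k U s))" unfolding R_def
    proof (intro conjI allI impI)
      show "act S' U g (k U s) \<in> sections S' U" using torsor_act_in[OF S' U g ks] .
      fix W t h assume a: "openin X W \<and> W \<subseteq> U \<and> t \<in> sections T W \<and> h \<in> sections F' W \<and>
            restr S U W (act S U g s) = act S W h (m W t)"
      then have W: "openin X W" "W \<subseteq> U" "t \<in> sections T W" "h \<in> sections F' W"
        "restr S U W (act S U g s) = act S W h (m W t)" by auto
      note gW = group_presheaf_restr[OF F' U W(1,2) g]
      note ngW = group_presheaf_uminus[OF F' W(1) gW]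
      note sW = torsor_restr_in[OF S U W(1,2) s]
      have "act S W (restr F' U W g) (restr S U W s) = act S W h (m W t)"
        using torsor_restr_act[OF S U W(1,2) g s] W(5) by simp
      then have "act S W (- restr F' U W g + restr F' U W g) (restr S U W s) =
          act S W (- restr F' U W g + h) (m W t)"
        using torsor_act_plus[OF S W(1) ngW gW sW]
          torsor_act_plus[OF S W(1) ngW W(4) equivariant_in[OF m W(1,3)]] by simp
      then have "restr S U W s = act S W (h - restr F' U W g) (m W t)"
        using torsor_act_zero[OF S W(1) sW] by simp
      then have k: "restr S' U W (k U s) = act S' W (h - restr F' U W g) (m' W t)"
        using Rs W group_presheaf_minus[OF F' W(1,4) gW] by blast
      show "restr S' U W (act S' U g (k U s)) = act S' W h (m' W t)"
        using torsor_restr_act[OF S' U W(1,2) g ks] k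
          torsor_act_plus[OF S' W(1) gW group_presheaf_minus[OF F' W(1,4) gW] equivariant_in[OF m' W(1,3)]]
        by simp
    qed
    then show "k U (act S U g s) = act S' U g (k U s)"
      using torsor_act_in[OF S U g s] by (intro kI[OF U])
  qed
  then show ?thesis by blast
qed

text \<open>The general form asks of \<open>T\<close> only restriction, transitivity and local
  sections, so that it can be applied to a product of two torsors. This is the case where
  \<open>T\<close> is itself a torsor.\<close>

lemma pushforward_unique_torsor:
  assumes "group_presheaf X F'" "is_torsor X F T" "is_torsor X F' S" "is_torsor X F' S'"
    and "equivariant X F \<phi> T S m" "equivariant X F \<phi> T S' m'"
    and "\<And>U g. openin X U \<Longrightarrow> g \<in> sections F U \<Longrightarrow> \<phi> U g \<in> sections F' U"
  shows "\<exists>k. morphism X F' S S' k"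
proof (rule pushforward_unique[OF assms(1,3-7)])
  show "\<exists>g\<in>sections F U. t' = act T U g t"
    if "openin X U" "t \<in> sections T U" "t' \<in> sections T U" for U t t'
    using torsor_transitive[OF assms(2) that] by blast
qed (use torsor_restr_in[OF assms(2)] torsor_locally_nonempty[OF assms(2)] in auto)

section \<open>Isomorphisms and isomorphism classes of torsors\<close>

lemma equivariant_id: "morphism X F T T (\<lambda>U t. t)"
  unfolding equivariant_def by auto

text \<open>Uniqueness of pushforwards along the identity gives a morphism \<open>k\<close> back. It
  shows that \<open>T\<close> has a section over \<open>U\<close> whenever \<open>T'\<close> has
  one; transitivity and freeness of the actions then make \<open>m U\<close> bijective.\<close>

lemma equivariant_imp_iso:
  assumes F: "group_presheaf X F" and T: "is_torsor X F T" and T': "is_torsor X F T'"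
    and m: "morphism X F T T' m"
  shows "torsor_iso X F T T'"
proof -
  obtain k where k: "morphism X F T' T k"
    using pushforward_unique_torsor[OF F T T' T m equivariant_id] by blast
  have "bij_betw (m U) (sections T U) (sections T' U)" if U: "openin X U" for U
    unfolding bij_betw_def
  proof
    show "inj_on (m U) (sections T U)"
    proof (rule inj_onI)
      fix s t assume st: "s \<in> sections T U" "t \<in> sections T U" "m U s = m U t"
      then obtain g where g: "g \<in> sections F U" "t = act T U g s"
        using torsor_transitive[OF T U] by blast
      have "act T' U g (m U s) = act T' U 0 (m U s)"
        using equivariant_act[OF m U g(1) st(1)] st g torsor_act_zero[OF T' U equivariant_in[OF m U st(1)]]
        by simp
      then have "g = 0"
        using torsor_free[OF T' U g(1) group_presheaf_zero[OF F U] equivariant_in[OF m U st(1)]] by simp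
      then show "s = t" using g torsor_act_zero[OF T U st(1)] by simp
    qed
    show "m U ` sections T U = sections T' U"
    proof
      show "sections T' U \<subseteq> m U ` sections T U"
      proof
        fix t assume t: "t \<in> sections T' U"
        note s = equivariant_in[OF k U t]
        obtain g where g: "g \<in> sections F U" "t = act T' U g (m U (k U t))"
          using torsor_transitive[OF T' U equivariant_in[OF m U s] t] by blast
        then have "t = m U (act T U g (k U t))" using equivariant_act[OF m U g(1) s] by simp
        then show "t \<in> m U ` sections T U" using torsor_act_in[OF T U g(1) s] by blast
      qed
    qed (use equivariant_in[OF m U] in blast)
  qed
  then show ?thesis using m unfolding torsor_iso_def by blast
qed

lemma torsor_iso_iff:
  assumes "group_presheaf X F" "is_torsor X F T" "is_torsor X F T'"
  shows "torsor_iso X F T T' \<longleftrightarrow> (\<exists>m. morphism X F T T' m)"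
  using equivariant_imp_iso[OF assms] unfolding torsor_iso_def by blast

lemma torsor_iso_sym:
  assumes "group_presheaf X F" "is_torsor X F T" "is_torsor X F T'" "torsor_iso X F T T'"
  shows "torsor_iso X F T' T"
  using assms pushforward_unique_torsor[OF assms(1,2,3,2) _ equivariant_id]
  by (auto simp: torsor_iso_iff)

lemma torsor_iso_trans:
  assumes "group_presheaf X F" "is_torsor X F T" "is_torsor X F T'" "is_torsor X F T''"
    "torsor_iso X F T T'" "torsor_iso X F T' T''"
  shows "torsor_iso X F T T''"
  using assms equivariant_comp[of X F "\<lambda>U g. g" T T' _ F "\<lambda>U g. g" T'']
  by (auto simp: torsor_iso_iff)

text \<open>Members of a class have sections in \<open>'p \<Rightarrow> 's\<close>, lift torsors and
  trivial torsors only in \<open>'s\<close>. Constant functions carry the latter into the larger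
  type; \<open>undefined\<close> is an arbitrary argument at which the value is read off.\<close>

definition torsor_copy :: "('p, 's, 't) torsor \<Rightarrow> ('p, 's, 'a \<Rightarrow> 't) torsor" where
  "torsor_copy T =
    \<lparr>sections = \<lambda>U. (\<lambda>t _. t) ` sections T U,
     restr = \<lambda>U V t _. restr T U V (t undefined),
     act = \<lambda>U g t _. act T U g (t undefined)\<rparr>"

lemma torsor_copy:
  assumes T: "is_torsor X F T"
  shows "is_torsor X F (torsor_copy T :: ('p, 's::ab_group_add, 'a \<Rightarrow> 't) torsor)"
    "morphism X F T (torsor_copy T :: ('p, 's, 'a \<Rightarrow> 't) torsor) (\<lambda>U t _. t)"
proof -
  let ?C = "torsor_copy T :: ('p, 's, 'a \<Rightarrow> 't) torsor"
  have sh: "sheaf X T" using torsor_sheaf[OF T] .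
  have cs: "sections ?C U = (\<lambda>t _. t) ` sections T U" for U by (simp add: torsor_copy_def)
  have cr: "restr ?C U V = (\<lambda>t _. restr T U V (t undefined))" for U V by (simp add: torsor_copy_def)
  have ca: "act ?C U = (\<lambda>g t _. act T U g (t undefined))" for U by (simp add: torsor_copy_def)
  have "sheaf X ?C"
    unfolding sheaf_def
  proof (intro conjI allI impI)
    fix \<U> and s :: "'p set \<Rightarrow> 'a \<Rightarrow> 't"
    assume a: "(\<forall>U\<in>\<U>. openin X U \<and> s U \<in> sections ?C U) \<and>
       (\<forall>U\<in>\<U>. \<forall>V\<in>\<U>. restr ?C U (U \<inter> V) (s U) = restr ?C V (U \<inter> V) (s V))"
    have s: "s U = (\<lambda>_. s U undefined)" if "U \<in> \<U>" for U using a that by (auto simp: cs)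
    have g: "\<exists>!r. r \<in> sections T (\<Union>\<U>) \<and> (\<forall>U\<in>\<U>. restr T (\<Union>\<U>) U r = s U undefined)"
    proof (rule sheaf_glue[OF sh])
      show "restr T U (U \<inter> V) (s U undefined) = restr T V (U \<inter> V) (s V undefined)"
        if "U \<in> \<U>" "V \<in> \<U>" for U V
        using a that by (auto simp: cr dest: fun_cong)
    qed (use a in \<open>auto simp: cs\<close>)
    then obtain r where r: "r \<in> sections T (\<Union>\<U>)" "\<And>U. U \<in> \<U> \<Longrightarrow> restr T (\<Union>\<U>) U r = s U undefined"
      by blast
    show "\<exists>!r. r \<in> sections ?C (\<Union>\<U>) \<and> (\<forall>U\<in>\<U>. restr ?C (\<Union>\<U>) U r = s U)"
    proof (rule ex1I[of _ "\<lambda>_. r"])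
      show "(\<lambda>_. r) \<in> sections ?C (\<Union>\<U>) \<and> (\<forall>U\<in>\<U>. restr ?C (\<Union>\<U>) U (\<lambda>_. r) = s U)"
        using r s by (auto simp: cs cr)
      fix q assume q: "q \<in> sections ?C (\<Union>\<U>) \<and> (\<forall>U\<in>\<U>. restr ?C (\<Union>\<U>) U q = s U)"
      then obtain q' where q': "q = (\<lambda>_. q')" "q' \<in> sections T (\<Union>\<U>)" by (auto simp: cs)
      have "\<forall>U\<in>\<U>. restr T (\<Union>\<U>) U q' = s U undefined" using q q' by (auto simp: cr dest: fun_cong)
      then have "q' = r" using g r q'(2) by blast
      then show "q = (\<lambda>_. r)" using q'(1) by simp
    qed
  qed (use sheaf_restr_in[OF sh] sheaf_restr_id[OF sh] sheaf_restr_restr[OF sh] in \<open>auto simp: cs cr\<close>)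
  then show "is_torsor X F ?C"
    unfolding is_torsor_def
    using torsor_act_in[OF T] torsor_act_zero[OF T] torsor_act_plus[OF T] torsor_restr_act[OF T]
      torsor_transitive[OF T] torsor_locally_nonempty[OF T]
    by (auto simp: cs cr ca fun_eq_iff)
  show "morphism X F T ?C (\<lambda>U t _. t)"
    unfolding equivariant_def by (auto simp: cs cr ca)
qed

lemma torsor_copy_in_class:
  assumes "group_presheaf X F" "is_torsor X F T"
  shows "torsor_copy T \<in> torsor_class X F T"
  using torsor_copy[OF assms(2)] torsor_iso_iff[OF assms] unfolding torsor_class_def by blast

lemma torsor_class_eqI:
  assumes F: "group_presheaf X F" and T: "is_torsor X F T" "is_torsor X F T'"
    and i: "torsor_iso X F T T'"
  shows "torsor_class X F T = torsor_class X F T'"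
  unfolding torsor_class_def
  using torsor_iso_trans[OF F T(1,2) _ i] torsor_iso_trans[OF F T(2,1) _ torsor_iso_sym[OF F T i]]
  by blast

text \<open>Equality of two sets says something only if they have a member: the copy of
  \<open>T\<close> is one, and it links both torsors.\<close>

lemma torsor_class_eqD:
  fixes T :: "('p, 's::ab_group_add, 's) torsor"
  assumes F: "group_presheaf X F" and T: "is_torsor X F T" "is_torsor X F T'"
    and eq: "torsor_class X F T = torsor_class X F T'"
  shows "torsor_iso X F T T'"
proof -
  let ?C = "torsor_copy T :: ('p, 's, 'p \<Rightarrow> 's) torsor"
  have "torsor_iso X F T ?C" "torsor_iso X F T' ?C"
    using torsor_copy_in_class[OF F T(1)] eq unfolding torsor_class_def by auto
  then show ?thesis
    using torsor_iso_sym[OF F T(2) torsor_copy(1)[OF T(1)]]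
      torsor_iso_trans[OF F T(1) torsor_copy(1)[OF T(1)] T(2)] by blast
qed

lemma torsor_class_in_H1:
  assumes F: "group_presheaf X F" and T: "is_torsor X F (T :: ('p, 's::ab_group_add, 's) torsor)"
  shows "torsor_class X F T \<in> carrier (H1 X F)"
proof -
  let ?C = "torsor_copy T :: ('p, 's, 'p \<Rightarrow> 's) torsor"
  have C: "is_torsor X F ?C" and i: "torsor_iso X F T ?C"
    using torsor_copy_in_class[OF F T] unfolding torsor_class_def by auto
  then show ?thesis using torsor_class_eqI[OF F T C i] unfolding H1_def by auto
qed

text \<open>\<open>ev s\<close> is the function underlying the section \<open>s\<close>, its argument \<open>i\<close> lying over the point
  \<open>loc i\<close>; \<open>P p\<close> is a condition on the germ at \<open>p\<close>.\<close>

lemma sheaf_of_functions: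
  fixes ev :: "'s \<Rightarrow> 'i \<Rightarrow> 'a::zero" and loc :: "'i \<Rightarrow> 'p"
  assumes ev: "bij ev"
    and sec: "\<And>U s. openin X U \<Longrightarrow> s \<in> sections F U \<longleftrightarrow>
      (\<forall>i. loc i \<notin> U \<longrightarrow> ev s i = 0) \<and> (\<forall>p\<in>U. P p s)"
    and res: "\<And>U V s i. ev (restr F U V s) i = (if loc i \<in> V then ev s i else 0)"
    and P: "\<And>p W s t. openin X W \<Longrightarrow> p \<in> W \<Longrightarrow> (\<And>i. loc i \<in> W \<Longrightarrow> ev s i = ev t i) \<Longrightarrow> P p s \<Longrightarrow> P p t"
  shows "sheaf X F"
  unfolding sheaf_def
proof (intro conjI allI impI)
  have eqI: "s = t" if "\<And>i. ev s i = ev t i" for s t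
    using that by (intro injD[OF bij_is_inj[OF ev]] ext)
  show "restr F U V \<in> sections F U \<rightarrow> sections F V" if "openin X U \<and> openin X V \<and> V \<subseteq> U" for U V
  proof
    fix s assume s: "s \<in> sections F U"
    have "P p (restr F U V s)" if "p \<in> V" for p
      using P[of V p s "restr F U V s"] \<open>openin X U \<and> openin X V \<and> V \<subseteq> U\<close> that s sec[of U s]
      by (auto simp: res)
    then show "restr F U V s \<in> sections F V" using that sec[of V] by (auto simp: res)
  qed
  show "restr F U U s = s" if "openin X U \<and> s \<in> sections F U" for U s
    using that sec[of U s] by (intro eqI) (auto simp: res)
  show "restr F V W (restr F U V s) = restr F U W s"
    if "openin X U \<and> openin X V \<and> openin X W \<and> W \<subseteq> V \<and> V \<subseteq> U \<and> s \<in> sections F U" for U V W s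
    using that by (intro eqI) (auto simp: res)
  fix \<U> s
  assume a: "(\<forall>U\<in>\<U>. openin X U \<and> s U \<in> sections F U) \<and>
       (\<forall>U\<in>\<U>. \<forall>V\<in>\<U>. restr F U (U \<inter> V) (s U) = restr F V (U \<inter> V) (s V))"
  have o: "openin X (\<Union>\<U>)" using a by blast
  define c where "c i = (SOME U. U \<in> \<U> \<and> loc i \<in> U)" for i
  have c: "c i \<in> \<U> \<and> loc i \<in> c i" if "loc i \<in> \<Union>\<U>" for i
    unfolding c_def by (rule someI_ex) (use that in blast)
  \<comment> \<open>The values of the glued section are taken index by index from some member of the
    cover; \<open>rU\<close> shows that the choice does not matter.\<close>
  define r where "r = inv_into UNIV ev (\<lambda>i. if loc i \<in> \<Union>\<U> then ev (s (c i)) i else 0)"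
  have ev_r: "ev r = (\<lambda>i. if loc i \<in> \<Union>\<U> then ev (s (c i)) i else 0)"
    unfolding r_def by (rule surj_f_inv_f[OF bij_is_surj[OF ev]])
  have rU: "ev r i = ev (s U) i" if "U \<in> \<U>" "loc i \<in> U" for U i
  proof -
    have ci: "c i \<in> \<U>" "loc i \<in> c i" using c[of i] that by auto
    have "ev (restr F U (U \<inter> c i) (s U)) i = ev (restr F (c i) (U \<inter> c i) (s (c i))) i"
      using a that(1) ci(1) by auto
    then show ?thesis using that ci by (auto simp: res ev_r)
  qed
  have "P p r" if p: "p \<in> \<Union>\<U>" for p
  proof -
    obtain U where U: "U \<in> \<U>" "p \<in> U" using p by blast
    then have "P p (s U)" using a sec[of U "s U"] by auto
    then show ?thesis using P[of U p "s U" r] U a rU by auto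
  qed
  then have r: "r \<in> sections F (\<Union>\<U>)" using sec[OF o, of r] by (auto simp: ev_r)
  have "restr F (\<Union>\<U>) U r = s U" if "U \<in> \<U>" for U
    using rU[OF that] a that sec[of U "s U"] by (intro eqI) (auto simp: res)
  then show "\<exists>!r. r \<in> sections F (\<Union>\<U>) \<and> (\<forall>U\<in>\<U>. restr F (\<Union>\<U>) U r = s U)"
  proof (intro ex1I[of _ r] conjI ballI r)
    fix q assume q: "q \<in> sections F (\<Union>\<U>) \<and> (\<forall>U\<in>\<U>. restr F (\<Union>\<U>) U q = s U)"
    show "q = r"
    proof (rule eqI)
      fix i
      show "ev q i = ev r i"
      proof (cases "loc i \<in> \<Union>\<U>")
        case True
        then have ci: "c i \<in> \<U>" "loc i \<in> c i" using c by auto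
        then have "ev (restr F (\<Union>\<U>) (c i) q) i = ev (s (c i)) i" using q by auto
        then show ?thesis using ci True by (simp add: res ev_r)
      next
        case False
        then show ?thesis using q r sec[OF o] by auto
      qed
    qed
  qed auto
qed

section \<open>The realization of a graph\<close>

text \<open>With openness expressed by neighbourhood filters of the real line, the ends of the unit
  interval need no separate treatment: the premise \<open>y \<in> S\<close> cuts off the missing
  side.\<close>

lemma openin_top_of_set_eventually:
  "openin (top_of_set S) A \<longleftrightarrow> A \<subseteq> S \<and> (\<forall>x\<in>A. \<forall>\<^sub>F y in nhds x. y \<in> S \<longrightarrow> y \<in> A)"
proof (intro iffI conjI ballI)
  assume A: "openin (top_of_set S) A"
  then obtain T where T: "open T" "A = S \<inter> T" by (auto simp: openin_open)
  then show "A \<subseteq> S" by blast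
  fix x assume "x \<in> A"
  then have "\<forall>\<^sub>F y in nhds x. y \<in> T" using T by (intro eventually_nhds_in_open) auto
  then show "\<forall>\<^sub>F y in nhds x. y \<in> S \<longrightarrow> y \<in> A" by eventually_elim (use T in auto)
next
  assume A: "A \<subseteq> S \<and> (\<forall>x\<in>A. \<forall>\<^sub>F y in nhds x. y \<in> S \<longrightarrow> y \<in> A)"
  show "openin (top_of_set S) A"
  proof (subst openin_subopen, intro ballI)
    fix x assume "x \<in> A"
    then obtain T where T: "open T" "x \<in> T" "\<forall>y\<in>T. y \<in> S \<longrightarrow> y \<in> A"
      using A by (auto simp: eventually_nhds)
    then show "\<exists>T. openin (top_of_set S) T \<and> x \<in> T \<and> T \<subseteq> A"
      using A \<open>x \<in> A\<close> by (intro exI[of _ "S \<inter> T"]) auto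
  qed
qed

text \<open>The passage from local to global along an edge. It is applied to the coefficients of an
  affine function and to the slope recovered from a trivialization over
  \<open>Omega G\<close>.\<close>

lemma eventually_constant_imp_constant:
  assumes "connected S" "\<And>x. x \<in> S \<Longrightarrow> \<forall>\<^sub>F y in nhds x. y \<in> S \<longrightarrow> f y = f x" "x \<in> S" "y \<in> S"
  shows "f x = f y"
proof -
  have "f constant_on S"
  proof (rule locally_constant_imp_constant[OF assms(1)])
    fix a assume a: "a \<in> S"
    obtain T where T: "open T" "a \<in> T" "\<And>y. y \<in> T \<Longrightarrow> y \<in> S \<Longrightarrow> f y = f a"
      using assms(2)[OF a] unfolding eventually_nhds by blast
    have "f y = f a" if "y \<in> S \<inter> T" for y using T(3) that by blast
    then show "\<exists>T. openin (top_of_set S) T \<and> a \<in> T \<and> (\<forall>x\<in>T. f x = f a)"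
      using a T(1,2) by (intro exI[of _ "S \<inter> T"]) (blast intro: openin_open_Int)
  qed
  then show ?thesis using assms(3,4) by (auto simp: constant_on_def)
qed

text \<open>The two conditions make \<open>diff\<close> surjective near each vertex: some incident
  edge can carry any prescribed value, and the finite sum picks it up.\<close>

locale lf_graph = wf_digraph G for G :: "('v, 'e) pre_digraph" +
  assumes finite_arcs_at: "v \<in> verts G \<Longrightarrow> finite (in_arcs G v) \<and> finite (out_arcs G v)"
    and not_isolated: "v \<in> verts G \<Longrightarrow> in_arcs G v \<union> out_arcs G v \<noteq> {}"
begin

abbreviation "X \<equiv> realization G"
abbreviation "em \<equiv> edge_map G"
abbreviation "eI e \<equiv> em e ` {0<..<1}"
abbreviation "eJ e \<equiv> em e ` {0<..<1/2}"
abbreviation "eK e \<equiv> em e ` {1/2<..<1}"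

lemma em_ends: "em e 0 = Inl (tail G e)" "em e 1 = Inl (head G e)"
  by (simp_all add: edge_map_def)

lemma em_interior: "0 < x \<Longrightarrow> x < 1 \<Longrightarrow> em e x = Inr (e, x)"
  by (simp add: edge_map_def)

text \<open>Vertices are the only points at which edge maps identify anything, and the open interval
  avoids them.\<close>

lemma em_in_image: "S \<subseteq> {0<..<1} \<Longrightarrow> em e x \<in> em d ` S \<longleftrightarrow> e = d \<and> x \<in> S"
  by (auto simp: edge_map_def image_iff)

lemma em_in_points: "e \<in> arcs G \<Longrightarrow> x \<in> {0..1} \<Longrightarrow> em e x \<in> points G"
  unfolding points_def by blast

lemma point_cases:
  assumes "p \<in> points G"
  obtains v where "v \<in> verts G" "p = Inl v"
  | e x where "e \<in> arcs G" "0 < x" "x < 1" "p = Inr (e, x)"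
  using assms unfolding points_def by (fastforce simp: edge_map_def split: if_splits)

lemma Inl_in_points: "Inl v \<in> points G \<longleftrightarrow> v \<in> verts G"
  by (auto simp: points_def edge_map_def split: if_splits)

lemma Inr_in_points: "Inr (e, x) \<in> points G \<longleftrightarrow> e \<in> arcs G \<and> 0 < x \<and> x < 1"
  by (auto simp: points_def edge_map_def image_iff split: if_splits intro: bexI[of _ x])

lemma openin_X: "openin X U \<longleftrightarrow> U \<subseteq> points G \<and>
   (\<forall>e\<in>arcs G. \<forall>x\<in>{0..1}. em e x \<in> U \<longrightarrow> (\<forall>\<^sub>F y in nhds x. y \<in> {0..1} \<longrightarrow> em e y \<in> U))"
  unfolding openin_realization openin_top_of_set_eventually by auto

lemma topspace_X: "topspace X = points G"
proof -
  have "openin X (points G)" using em_in_points by (auto simp: openin_X)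
  then show ?thesis using openin_subset openin_topspace openin_X by blast
qed

lemma open_sub: "openin X U \<Longrightarrow> U \<subseteq> points G"
  using openin_X by blast

lemma open_eventually:
  "openin X U \<Longrightarrow> e \<in> arcs G \<Longrightarrow> x \<in> {0..1} \<Longrightarrow> em e x \<in> U \<Longrightarrow>
    \<forall>\<^sub>F y in nhds x. y \<in> {0..1} \<longrightarrow> em e y \<in> U"
  using openin_X by blast

text \<open>The topology is final for the edge maps, so continuity is tested along each
  edge.\<close>

lemma continuous_map_X:
  assumes U: "openin X U"
  shows "continuous_map (subtopology X U) Y f \<longleftrightarrow> f \<in> U \<rightarrow> topspace Y \<and>
    (\<forall>V. openin Y V \<longrightarrow> (\<forall>e\<in>arcs G. \<forall>x\<in>{0..1}. em e x \<in> U \<and> f (em e x) \<in> V \<longrightarrow>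
      (\<forall>\<^sub>F y in nhds x. y \<in> {0..1} \<longrightarrow> f (em e y) \<in> V)))" (is "?L \<longleftrightarrow> ?R")
proof
  have ts: "topspace (subtopology X U) = U" using openin_subset[OF U] by (auto simp: topspace_subtopology)
  { assume ?L
    then have L: "f \<in> U \<rightarrow> topspace Y" "\<And>V. openin Y V \<Longrightarrow> openin X {p \<in> U. f p \<in> V}"
      using openin_open_subtopology[OF U] unfolding continuous_map_def ts by auto
    show ?R
    proof (intro conjI allI impI ballI L(1), elim conjE)
      fix V e x assume a: "openin Y V" "e \<in> arcs G" "x \<in> {0..1}" "em e x \<in> U" "f (em e x) \<in> V"
      show "\<forall>\<^sub>F y in nhds x. y \<in> {0..1} \<longrightarrow> f (em e y) \<in> V"
        using open_eventually[OF L(2)[OF a(1)] a(2,3)] a(4,5) by (auto elim: eventually_mono)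
    qed }
  assume R: ?R
  show ?L unfolding continuous_map_def ts openin_open_subtopology[OF U]
  proof (intro conjI allI impI)
    show "f \<in> U \<rightarrow> topspace Y" using R by blast
    fix V assume V: "openin Y V"
    show "openin X {x \<in> U. f x \<in> V}" unfolding openin_X
    proof (intro conjI ballI impI)
      show "{x \<in> U. f x \<in> V} \<subseteq> points G" using open_sub[OF U] by blast
      fix e x assume a: "e \<in> arcs G" "x \<in> {0..1}" "em e x \<in> {x \<in> U. f x \<in> V}"
      have "\<forall>\<^sub>F y in nhds x. y \<in> {0..1} \<longrightarrow> f (em e y) \<in> V" using R V a by blast
      moreover have "\<forall>\<^sub>F y in nhds x. y \<in> {0..1} \<longrightarrow> em e y \<in> U" using open_eventually[OF U] a by blast
      ultimately show "\<forall>\<^sub>F y in nhds x. y \<in> {0..1} \<longrightarrow> em e y \<in> {x \<in> U. f x \<in> V}"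
        by eventually_elim auto
    qed
  qed auto
qed

lemma open_interval_in_X:
  assumes "e \<in> arcs G" "open S" "S \<subseteq> {0<..<1}"
  shows "openin X (em e ` S)"
  unfolding openin_X
proof (intro conjI ballI impI)
  show "em e ` S \<subseteq> points G" using assms em_in_points[of e] by force
  fix d x assume "em d x \<in> em e ` S"
  then have x: "d = e" "x \<in> S" using em_in_image[OF assms(3)] by auto
  have "\<forall>\<^sub>F y in nhds x. y \<in> S" using assms(2) x by (intro eventually_nhds_in_open)
  then show "\<forall>\<^sub>F y in nhds x. y \<in> {0..1} \<longrightarrow> em d y \<in> em e ` S"
    by eventually_elim (use x in auto)
qed

text \<open>For a loop both alternatives concern the same vertex but disjoint parts of the edge. The
  midpoint lies in no half star.\<close>

lemma em_in_half_star:
  assumes "d \<in> arcs G" "x \<in> {0..1}"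
  shows "em d x \<in> half_star G v \<longleftrightarrow> x < 1/2 \<and> tail G d = v \<or> x > 1/2 \<and> head G d = v"
proof -
  consider "x = 0" | "x = 1" | "0 < x" "x < 1" using assms by fastforce
  then show ?thesis
  proof cases
    case 3
    have "em d x \<in> half_star G v \<longleftrightarrow>
        (\<exists>e\<in>out_arcs G v. em d x \<in> eJ e) \<or> (\<exists>e\<in>in_arcs G v. em d x \<in> eK e)"
      using 3 by (auto simp: half_star_def edge_map_def)
    also have "\<dots> \<longleftrightarrow> x < 1/2 \<and> tail G d = v \<or> x > 1/2 \<and> head G d = v"
    proof -
      have "{0<..<1/2} \<subseteq> {0<..<1::real}" "{1/2<..<1} \<subseteq> {0<..<1::real}" by auto
      note em_in_image[OF this(1)] em_in_image[OF this(2)]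
      then show ?thesis using 3 assms by (simp add: in_arcs_def out_arcs_def) auto
    qed
    finally show ?thesis .
  qed (auto simp: half_star_def edge_map_def split: if_splits)
qed

lemma open_half_star: assumes "v \<in> verts G" shows "openin X (half_star G v)"
  unfolding openin_X
proof (intro conjI ballI impI)
  show "half_star G v \<subseteq> points G"
    using assms by (auto simp: half_star_def Inl_in_points out_arcs_def in_arcs_def intro!: em_in_points)
  fix e x assume a: "e \<in> arcs G" "x \<in> {0..1}" "em e x \<in> half_star G v"
  then consider "x < 1/2" "tail G e = v" | "x > 1/2" "head G e = v" using em_in_half_star by blast
  then show "\<forall>\<^sub>F y in nhds x. y \<in> {0..1} \<longrightarrow> em e y \<in> half_star G v"
  proof cases
    case 1
    have "\<forall>\<^sub>F y in nhds x. y \<in> {..<1/2}" using 1 by (intro eventually_nhds_in_open) auto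
    then show ?thesis by eventually_elim (use em_in_half_star a 1 in auto)
  next
    case 2
    have "\<forall>\<^sub>F y in nhds x. y \<in> {1/2<..}" using 2 by (intro eventually_nhds_in_open) auto
    then show ?thesis by eventually_elim (use em_in_half_star a 2 in auto)
  qed
qed

lemma Inl_in_half_star: "Inl w \<in> half_star G v \<longleftrightarrow> w = v"
  by (auto simp: half_star_def edge_map_def split: if_splits)

section \<open>Slopes\<close>

lemma affine_nearD: "affine_near G h e x a b \<Longrightarrow> x \<in> {0..1} \<Longrightarrow> h (em e x) = of_int a + of_int b * x"
  unfolding affine_near_def using eventually_nhds_x_imp_x by blast

lemma affine_near_eventually:
  "affine_near G h e x a b \<Longrightarrow> \<forall>\<^sub>F y in nhds x. affine_near G h e y a b"
  unfolding affine_near_def by (simp add: eventually_eventually)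

text \<open>Supplies the second point that pins down an affine function, on whichever side of
  \<open>x\<close> the unit interval leaves room.\<close>

lemma eventually_nhds_unit_interval:
  assumes "\<forall>\<^sub>F y in nhds (x::real). P y" "x \<in> {0..1}"
  obtains y where "y \<in> {0..1}" "y \<noteq> x" "P y" "P x"
proof -
  obtain d where d: "d > 0" "\<And>y. dist y x < d \<Longrightarrow> P y"
    using assms(1) by (auto simp: eventually_nhds_metric)
  \<comment> \<open>A step of \<open>d/2\<close> at most stays in the neighbourhood, and a step of
    \<open>1/2\<close> at most towards the farther end stays in \<open>{0..1}\<close>.\<close>
  define c where "c = min (d/2) (1/2)"
  have c: "0 < c" "c < d" "c \<le> 1/2" using d(1) by (auto simp: c_def)
  show ?thesis
  proof (cases "x \<le> 1/2")
    case True
    have "P (x + c)" by (rule d(2)) (use c in \<open>simp add: dist_real_def\<close>)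
    then show ?thesis using that[of "x + c"] c assms(2) True d by auto
  next
    case False
    have "P (x - c)" by (rule d(2)) (use c in \<open>simp add: dist_real_def\<close>)
    then show ?thesis using that[of "x - c"] c assms(2) False d by auto
  qed
qed

lemma affine_near_unique:
  assumes "affine_near G h e x a b" "affine_near G h e x a' b'" "x \<in> {0..1}"
  shows "a = a' \<and> b = b'"
proof -
  have "\<forall>\<^sub>F y in nhds x. y \<in> {0..1} \<longrightarrow> real_of_int a + of_int b * y = of_int a' + of_int b' * y"
    using assms(1,2) unfolding affine_near_def by eventually_elim auto
  from eventually_nhds_unit_interval[OF this assms(3)] obtain y where y: "y \<noteq> x"
    "real_of_int a + of_int b * y = of_int a' + of_int b' * y"
    "real_of_int a + of_int b * x = of_int a' + of_int b' * x" using assms(3) by metis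
  then have "(real_of_int b - of_int b') * (y - x) = 0" by (simp add: algebra_simps)
  then have "b = b'" using y(1) by simp
  then show ?thesis using y by simp
qed

lemma slope_eq: "affine_near G h e x a b \<Longrightarrow> x \<in> {0..1} \<Longrightarrow> slope G h e x = b"
  unfolding slope_def by (rule the_equality) (use affine_near_unique in blast)+

lemma affine_near_add:
  "affine_near G h e x a b \<Longrightarrow> affine_near G k e x c d \<Longrightarrow> affine_near G (h + k) e x (a + c) (b + d)"
  unfolding affine_near_def by (erule (1) eventually_elim2) (auto simp: algebra_simps)

lemma affine_near_diff:
  "affine_near G h e x a b \<Longrightarrow> affine_near G k e x c d \<Longrightarrow> affine_near G (h - k) e x (a - c) (b - d)"
  unfolding affine_near_def by (erule (1) eventually_elim2) (auto simp: algebra_simps)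

lemma affine_near_cong:
  assumes "openin X U" "e \<in> arcs G" "x \<in> {0..1}" "em e x \<in> U" "\<And>p. p \<in> U \<Longrightarrow> h p = k p"
    "affine_near G h e x a b"
  shows "affine_near G k e x a b"
  using open_eventually[OF assms(1-4)] assms(6) unfolding affine_near_def
  by eventually_elim (use assms(5) in auto)

lemma slope_cong:
  assumes "openin X U" "e \<in> arcs G" "x \<in> {0..1}" "em e x \<in> U" "\<And>p. p \<in> U \<Longrightarrow> h p = k p"
  shows "slope G h e x = slope G k e x"
proof -
  have "affine_near G h e x = affine_near G k e x"
    using affine_near_cong[OF assms(1-4), of h k] affine_near_cong[OF assms(1-4), of k h] assms(5)
    by (intro ext iffI) auto
  then show ?thesis unfolding slope_def by simp
qed

text \<open>The pair of coefficients at a point is unique, hence a function of the point, and this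
  function is locally constant.\<close>

lemma affine_on_connected:
  assumes "connected S" "S \<subseteq> {0..1}" "S \<noteq> {}" "\<And>x. x \<in> S \<Longrightarrow> \<exists>a b. affine_near G h e x a b"
  obtains a b where "\<And>x. x \<in> S \<Longrightarrow> affine_near G h e x a b"
proof -
  define f where "f x = (THE ab. affine_near G h e x (fst ab) (snd ab))" for x
  have f: "f x = (a, b)" if "affine_near G h e x a b" "x \<in> S" for x a b
    unfolding f_def by (rule the_equality) (use that affine_near_unique assms(2) in \<open>auto simp: prod_eq_iff\<close>)
  have fa: "affine_near G h e x (fst (f x)) (snd (f x))" if "x \<in> S" for x
    using assms(4)[OF that] f that by auto
  obtain z where z: "z \<in> S" using assms(3) by blast
  have "f x = f z" if "x \<in> S" for x
  proof (rule eventually_constant_imp_constant[OF assms(1) _ that z])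
    fix x assume x: "x \<in> S"
    show "\<forall>\<^sub>F y in nhds x. y \<in> S \<longrightarrow> f y = f x"
      using affine_near_eventually[OF fa[OF x]] by eventually_elim (use f in auto)
  qed
  then show ?thesis using that[of "fst (f z)" "snd (f z)"] fa by metis
qed

section \<open>Sections\<close>

text \<open>The value of \<open>diff\<close> freed from the open set, so that functions given on
  different open sets can be compared at a vertex.\<close>

definition vdiff :: "(('v, 'e) point \<Rightarrow> real) \<Rightarrow> 'v \<Rightarrow> int" where
  "vdiff h v = (\<Sum>e\<in>in_arcs G v. slope G h e 1) - (\<Sum>e\<in>out_arcs G v. slope G h e 0)"

lemma diff_eq: "diff G U h = (\<lambda>v. if v \<in> verts G \<and> Inl v \<in> U then vdiff h v else 0)"
  by (rule ext) (simp add: diff_def vdiff_def sum_negf)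

lemma vdiff_cong:
  assumes "openin X U" "Inl v \<in> U" "\<And>p. p \<in> U \<Longrightarrow> h p = k p"
  shows "vdiff h v = vdiff k v"
  unfolding vdiff_def using assms
  by (intro arg_cong2[of _ _ _ _ minus] sum.cong refl slope_cong[of U])
    (auto simp: in_arcs_def out_arcs_def em_ends)

text \<open>Continuity is automatic: it is tested along the edges, where a locally affine function
  is continuous, and the edges at a vertex share its value there through
  \<open>edge_map\<close>.\<close>

lemma PL_iff:
  assumes U: "openin X U"
  shows "h \<in> sections (PL G) U \<longleftrightarrow> (\<forall>p. p \<notin> U \<longrightarrow> h p = 0) \<and>
    (\<forall>e\<in>arcs G. \<forall>x\<in>{0..1}. em e x \<in> U \<longrightarrow> (\<exists>a b. affine_near G h e x a b))"
proof -
  have "continuous_map (subtopology X U) euclideanreal h"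
    if h: "\<forall>e\<in>arcs G. \<forall>x\<in>{0..1}. em e x \<in> U \<longrightarrow> (\<exists>a b. affine_near G h e x a b)"
    unfolding continuous_map_X[OF U]
  proof (intro conjI allI impI ballI, simp, elim conjE)
    fix V e x assume a: "openin euclideanreal V" "e \<in> arcs G" "x \<in> {0..1}" "em e x \<in> U" "h (em e x) \<in> V"
    then obtain c b where cb: "affine_near G h e x c b" using h by blast
    have "((\<lambda>y. real_of_int c + of_int b * y) \<longlongrightarrow> of_int c + of_int b * x) (nhds x)"
      by (intro tendsto_intros filterlim_ident)
    moreover have "of_int c + of_int b * x \<in> V" using affine_nearD[OF cb a(3)] a(5) by simp
    ultimately have "\<forall>\<^sub>F y in nhds x. of_int c + of_int b * y \<in> V"
      using a(1) by (intro topological_tendstoD) auto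
    then show "\<forall>\<^sub>F y in nhds x. y \<in> {0..1} \<longrightarrow> h (em e y) \<in> V"
      using cb unfolding affine_near_def by eventually_elim auto
  qed
  then show ?thesis unfolding PL_def by auto
qed

lemma PL_zero: "h \<in> sections (PL G) U \<Longrightarrow> p \<notin> U \<Longrightarrow> h p = 0"
  by (simp add: PL_def)

lemma PL_affine:
  "h \<in> sections (PL G) U \<Longrightarrow> e \<in> arcs G \<Longrightarrow> x \<in> {0..1} \<Longrightarrow> em e x \<in> U \<Longrightarrow>
    \<exists>a b. affine_near G h e x a b"
  by (simp add: PL_def)

lemma PL_affine_slope:
  assumes "h \<in> sections (PL G) U" "e \<in> arcs G" "x \<in> {0..1}" "em e x \<in> U"
  obtains a where "affine_near G h e x a (slope G h e x)"
  using PL_affine[OF assms] slope_eq assms(3) by blast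

lemma slope_add:
  assumes "h \<in> sections (PL G) U" "k \<in> sections (PL G) V" "e \<in> arcs G" "x \<in> {0..1}"
    "em e x \<in> U" "em e x \<in> V"
  shows "slope G (h + k) e x = slope G h e x + slope G k e x"
proof -
  obtain a where a: "affine_near G h e x a (slope G h e x)" using PL_affine_slope[OF assms(1,3-5)] .
  obtain b where b: "affine_near G k e x b (slope G k e x)" using PL_affine_slope[OF assms(2-4,6)] .
  show ?thesis using slope_eq[OF affine_near_add[OF a b] assms(4)] .
qed

lemma slope_diff:
  assumes "h \<in> sections (PL G) U" "k \<in> sections (PL G) V" "e \<in> arcs G" "x \<in> {0..1}"
    "em e x \<in> U" "em e x \<in> V"
  shows "slope G (h - k) e x = slope G h e x - slope G k e x"
proof -
  obtain a where a: "affine_near G h e x a (slope G h e x)" using PL_affine_slope[OF assms(1,3-5)] .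
  obtain b where b: "affine_near G k e x b (slope G k e x)" using PL_affine_slope[OF assms(2-4,6)] .
  show ?thesis using slope_eq[OF affine_near_diff[OF a b] assms(4)] .
qed

lemma vdiff_add:
  assumes "h \<in> sections (PL G) U" "k \<in> sections (PL G) V" "Inl v \<in> U" "Inl v \<in> V"
  shows "vdiff (h + k) v = vdiff h v + vdiff k v"
proof -
  have "slope G (h + k) e 1 = slope G h e 1 + slope G k e 1" if "e \<in> in_arcs G v" for e
    using slope_add[OF assms(1,2), of e 1] assms(3,4) that by (auto simp: em_ends in_arcs_def)
  moreover have "slope G (h + k) e 0 = slope G h e 0 + slope G k e 0" if "e \<in> out_arcs G v" for e
    using slope_add[OF assms(1,2), of e 0] assms(3,4) that by (auto simp: em_ends out_arcs_def)
  ultimately show ?thesis by (simp add: vdiff_def sum.distrib)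
qed

lemma vdiff_diff:
  assumes "h \<in> sections (PL G) U" "k \<in> sections (PL G) V" "Inl v \<in> U" "Inl v \<in> V"
  shows "vdiff (h - k) v = vdiff h v - vdiff k v"
proof -
  have "slope G (h - k) e 1 = slope G h e 1 - slope G k e 1" if "e \<in> in_arcs G v" for e
    using slope_diff[OF assms(1,2), of e 1] assms(3,4) that by (auto simp: em_ends in_arcs_def)
  moreover have "slope G (h - k) e 0 = slope G h e 0 - slope G k e 0" if "e \<in> out_arcs G v" for e
    using slope_diff[OF assms(1,2), of e 0] assms(3,4) that by (auto simp: em_ends out_arcs_def)
  ultimately show ?thesis by (simp add: vdiff_def sum_subtractf)
qed

lemma PL_group:
  assumes U: "openin X U"
  shows "0 \<in> sections (PL G) U"
    "h \<in> sections (PL G) U \<Longrightarrow> k \<in> sections (PL G) U \<Longrightarrow> h + k \<in> sections (PL G) U"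
    "h \<in> sections (PL G) U \<Longrightarrow> k \<in> sections (PL G) U \<Longrightarrow> h - k \<in> sections (PL G) U"
proof -
  have "affine_near G 0 e x 0 0" for e x by (simp add: affine_near_def)
  then show "0 \<in> sections (PL G) U" unfolding PL_iff[OF U] by auto
  show "h + k \<in> sections (PL G) U" if "h \<in> sections (PL G) U" "k \<in> sections (PL G) U"
    using that affine_near_add unfolding PL_iff[OF U] by fastforce
  show "h - k \<in> sections (PL G) U" if "h \<in> sections (PL G) U" "k \<in> sections (PL G) U"
    using that affine_near_diff unfolding PL_iff[OF U] by fastforce
qed

lemma PL_restr:
  assumes "h \<in> sections (PL G) U" "openin X V" "V \<subseteq> U"
  shows "(\<lambda>p. if p \<in> V then h p else 0) \<in> sections (PL G) V"
  unfolding PL_iff[OF assms(2)]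
proof (intro conjI ballI impI)
  fix e x assume a: "e \<in> arcs G" "x \<in> {0..1}" "em e x \<in> V"
  then obtain c b where "affine_near G h e x c b" using PL_affine[OF assms(1)] assms(3) by blast
  then have "affine_near G (\<lambda>p. if p \<in> V then h p else 0) e x c b"
    by (rule affine_near_cong[OF assms(2) a, rotated]) simp
  then show "\<exists>c b. affine_near G (\<lambda>p. if p \<in> V then h p else 0) e x c b" by blast
qed simp

section \<open>Torsors of local lifts\<close>

abbreviation "lift \<equiv> lift_torsor X (PL G) (vertex_sheaf G) (diff G)"

lemma restr_lift: "restr (lift f) U V h = (\<lambda>p. if p \<in> V then h p else 0)"
  by (simp add: lift_torsor_def PL_def)

lemma act_lift: "act (lift f) U g h = g + h"
  by (simp add: lift_torsor_def)

lemma restr_Harm: "restr (Harm G) U V h = (\<lambda>p. if p \<in> V then h p else 0)"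
  by (simp add: Harm_def kernel_sheaf_def PL_def)

lemma lift_iff:
  assumes U: "openin X U"
  shows "b \<in> sections (lift f) U \<longleftrightarrow>
    b \<in> sections (PL G) U \<and> (\<forall>v. Inl v \<in> U \<longrightarrow> vdiff b v = f v)"
  using open_sub[OF U] Inl_in_points topspace_X
  by (auto simp: lift_torsor_def vertex_sheaf_def diff_eq fun_eq_iff)

lemma sections_lift_PL: "b \<in> sections (lift f) U \<Longrightarrow> b \<in> sections (PL G) U"
  by (simp add: lift_torsor_def)

lemma Harm_iff:
  assumes U: "openin X U"
  shows "b \<in> sections (Harm G) U \<longleftrightarrow>
    b \<in> sections (PL G) U \<and> (\<forall>v. Inl v \<in> U \<longrightarrow> vdiff b v = 0)"
  using open_sub[OF U] Inl_in_points
  by (auto simp: Harm_def kernel_sheaf_def diff_eq fun_eq_iff)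

text \<open>Harmonic functions are the lifts of the zero section, so the neutral element of
  \<open>Pic G\<close> is \<open>delta G 0\<close>.\<close>

lemma trivial_torsor_Harm: "trivial_torsor (Harm G) = lift 0"
  by (auto simp: trivial_torsor_def lift_torsor_def Harm_def kernel_sheaf_def vertex_sheaf_def
      zero_fun_def fun_eq_iff)

lemma vdiff_zero: "vdiff 0 v = 0"
proof -
  have "affine_near G 0 e x 0 0" for e x by (simp add: affine_near_def)
  then have "slope G 0 e x = 0" if "x \<in> {0..1}" for e x using slope_eq that by blast
  then show ?thesis by (simp add: vdiff_def)
qed

lemma group_presheaf_Harm: "group_presheaf X (Harm G)"
  unfolding group_presheaf_def
proof (intro allI impI conjI ballI)
  fix U assume U: "openin X U"
  show "0 \<in> sections (Harm G) U" using PL_group[OF U] vdiff_zero by (simp add: Harm_iff[OF U])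
  show "g - h \<in> sections (Harm G) U" if "g \<in> sections (Harm G) U" "h \<in> sections (Harm G) U" for g h
    using that PL_group[OF U] vdiff_diff[of g U h U] by (simp add: Harm_iff[OF U])
  fix V assume V: "openin X V \<and> V \<subseteq> U"
  show "restr (Harm G) U V (g - h) = restr (Harm G) U V g - restr (Harm G) U V h" for g h
    by (auto simp: restr_Harm)
  fix g assume "g \<in> sections (Harm G) U"
  then show "restr (Harm G) U V g \<in> sections (Harm G) V"
    using V PL_restr vdiff_cong[of V _ "\<lambda>p. if p \<in> V then g p else 0" g]
    by (auto simp: Harm_iff U restr_Harm)
qed

text \<open>Membership in \<open>lift f\<close> split into conditions on single germs, the form in
  which the sheaf property can be read off.\<close>

abbreviation "lift_at f p h \<equiv>
    (\<forall>e\<in>arcs G. \<forall>x\<in>{0..1}. em e x = p \<longrightarrow> (\<exists>a b. affine_near G h e x a b)) \<and>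
    (\<forall>v. p = Inl v \<longrightarrow> vdiff h v = f v)"

lemma sheaf_lift: "sheaf X (lift f)"
proof (rule sheaf_of_functions[where ev = "\<lambda>s. s" and loc = "\<lambda>p. p" and P = "lift_at f"])
  show "bij (\<lambda>s. s)" using bij_id by (simp add: id_def)
  show "s \<in> sections (lift f) U \<longleftrightarrow> (\<forall>i. i \<notin> U \<longrightarrow> s i = 0) \<and>
      (\<forall>p\<in>U. lift_at f p s)" if "openin X U" for U s
    unfolding lift_iff[OF that] PL_iff[OF that] by blast
  fix p W and s t :: "('v, 'e) point \<Rightarrow> real"
  assume W: "openin X W" "p \<in> W" and eq: "\<And>i. i \<in> W \<Longrightarrow> s i = t i" and
    s: "lift_at f p s"
  have "\<exists>a b. affine_near G t e x a b" if a: "e \<in> arcs G" "x \<in> {0..1}" "em e x = p" for e x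
    using affine_near_cong[OF W(1) a(1,2), of s t] eq s a W by blast
  moreover have "vdiff t v = f v" if "p = Inl v" for v
    using vdiff_cong[OF W(1), of v s t] eq s that W by auto
  ultimately show "lift_at f p t" by blast
qed (auto simp: restr_lift)

text \<open>On the half star of \<open>v\<close>, the incoming derivatives of \<open>ramp \<alpha> \<beta>\<close> at \<open>v\<close> are \<open>\<alpha> e\<close> and \<open>- \<beta> e\<close>.\<close>

definition ramp :: "('e \<Rightarrow> int) \<Rightarrow> ('e \<Rightarrow> int) \<Rightarrow> ('v, 'e) point \<Rightarrow> real" where
  "ramp \<alpha> \<beta> p = (case p of Inl v \<Rightarrow> 0 |
     Inr (e, x) \<Rightarrow> if x \<le> 1/2 then of_int (\<beta> e) * x else of_int (\<alpha> e) * (x - 1))"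

lemma ramp_em: "ramp \<alpha> \<beta> (em e x) =
    (if x \<le> 1/2 then of_int (\<beta> e) * x else of_int (\<alpha> e) * (x - 1))"
  by (auto simp: ramp_def edge_map_def)

lemma ramp_affine:
  "x < 1/2 \<Longrightarrow> affine_near G (ramp \<alpha> \<beta>) e x 0 (\<beta> e)"
  "x > 1/2 \<Longrightarrow> affine_near G (ramp \<alpha> \<beta>) e x (- \<alpha> e) (\<alpha> e)"
proof -
  assume "x < 1/2"
  then have "\<forall>\<^sub>F y in nhds x. y \<in> {..<1/2}" by (intro eventually_nhds_in_open) auto
  then show "affine_near G (ramp \<alpha> \<beta>) e x 0 (\<beta> e)" unfolding affine_near_def
    by eventually_elim (auto simp: ramp_em)
next
  assume "x > 1/2"
  then have "\<forall>\<^sub>F y in nhds x. y \<in> {1/2<..}" by (intro eventually_nhds_in_open) auto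
  then show "affine_near G (ramp \<alpha> \<beta>) e x (- \<alpha> e) (\<alpha> e)" unfolding affine_near_def
    by eventually_elim (auto simp: ramp_em algebra_simps)
qed

lemma vdiff_ramp: "vdiff (ramp \<alpha> \<beta>) v = (\<Sum>e\<in>in_arcs G v. \<alpha> e) - (\<Sum>e\<in>out_arcs G v. \<beta> e)"
  using slope_eq[OF ramp_affine(1), of 0] slope_eq[OF ramp_affine(2), of 1]
  unfolding vdiff_def by simp

lemma ramp_half_star:
  assumes v: "v \<in> verts G"
    and f: "f v = (\<Sum>e\<in>in_arcs G v. \<alpha> e) - (\<Sum>e\<in>out_arcs G v. \<beta> e)"
  shows "(\<lambda>p. if p \<in> half_star G v then ramp \<alpha> \<beta> p else 0) \<in> sections (lift f) (half_star G v)"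
  unfolding lift_iff[OF open_half_star[OF v]] PL_iff[OF open_half_star[OF v]]
proof (intro conjI allI impI ballI)
  let ?r = "\<lambda>p. if p \<in> half_star G v then ramp \<alpha> \<beta> p else 0"
  fix e x assume a: "e \<in> arcs G" "x \<in> {0..1}" "em e x \<in> half_star G v"
  \<comment> \<open>A ramp may be discontinuous at the midpoint of an edge, but no half star
    contains it.\<close>
  then have "x < 1/2 \<or> x > 1/2" using em_in_half_star by blast
  then obtain c b where "affine_near G (ramp \<alpha> \<beta>) e x c b" using ramp_affine by blast
  then have "affine_near G ?r e x c b"
    by (rule affine_near_cong[OF open_half_star[OF v] a, rotated]) simp
  then show "\<exists>c b. affine_near G ?r e x c b" by blast
next
  fix w assume w: "Inl w \<in> half_star G v"
  then have "w = v" by (simp add: Inl_in_half_star)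
  then show "vdiff (\<lambda>p. if p \<in> half_star G v then ramp \<alpha> \<beta> p else 0) w = f w"
    using vdiff_cong[OF open_half_star[OF v] w, of _ "ramp \<alpha> \<beta>"] f vdiff_ramp by auto
qed simp

lemma is_torsor_lift: "is_torsor X (Harm G) (lift f)"
  unfolding is_torsor_def
proof (intro conjI allI impI ballI)
  show "sheaf X (lift f)" by (rule sheaf_lift)
  fix U assume U: "openin X U"
  show add: "act (lift f) U g t \<in> sections (lift f) U"
    if "g \<in> sections (Harm G) U" "t \<in> sections (lift f) U" for g t
    using that PL_group(2)[OF U] vdiff_add[of g U t U] by (simp add: lift_iff[OF U] Harm_iff[OF U] act_lift)
  show "\<exists>!g. g \<in> sections (Harm G) U \<and> t = act (lift f) U g s"
    if "s \<in> sections (lift f) U" "t \<in> sections (lift f) U" for s t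
  proof (rule ex1I[of _ "t - s"])
    show "t - s \<in> sections (Harm G) U \<and> t = act (lift f) U (t - s) s"
      using that PL_group(3)[OF U] vdiff_diff[of t U s U]
      by (simp add: lift_iff[OF U] Harm_iff[OF U] act_lift)
  qed (auto simp: act_lift)
next
  fix p assume "p \<in> topspace X"
  then have "p \<in> points G" using topspace_X by simp
  then show "\<exists>U. openin X U \<and> p \<in> U \<and> sections (lift f) U \<noteq> {}"
  proof (cases rule: point_cases)
    case (1 v)
    \<comment> \<open>One edge carries the whole value: an incoming edge with slope
      \<open>f v\<close> at its head or, failing that, an outgoing one with slope
      \<open>- f v\<close> at its tail. A loop causes no conflict, since a ramp has independent
      slopes at the two ends.\<close>
    have "\<exists>\<alpha> \<beta>. f v = (\<Sum>e\<in>in_arcs G v. \<alpha> e) - (\<Sum>e\<in>out_arcs G v. \<beta> e)"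
    proof (cases "in_arcs G v = {}")
      case False
      then obtain e where "e \<in> in_arcs G v" by blast
      then show ?thesis using finite_arcs_at[OF 1(1)]
        by (intro exI[of _ "\<lambda>d. if d = e then f v else 0"] exI[of _ "\<lambda>_. 0"]) simp
    next
      case True
      then obtain e where "e \<in> out_arcs G v" using not_isolated[OF 1(1)] by blast
      then show ?thesis using finite_arcs_at[OF 1(1)]
        by (intro exI[of _ "\<lambda>d. if d = e then - f v else 0"] exI[of _ "\<lambda>_. 0"]) (simp add: True)
    qed
    then show ?thesis using ramp_half_star[OF 1(1)] open_half_star[OF 1(1)] 1 Inl_in_half_star by blast
  next
    case (2 e x)
    have U: "openin X (eI e)" using open_interval_in_X 2 by simp
    have "0 \<in> sections (lift f) (eI e)"
      unfolding lift_iff[OF U] using PL_group(1)[OF U] by (auto simp: edge_map_def split: if_splits)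
    moreover have "p \<in> eI e" using 2 em_interior[of x e] by force
    ultimately show ?thesis using U by blast
  qed
qed (auto simp: act_lift restr_lift restr_Harm algebra_simps)

end

text \<open>On a common domain two sections differ by the action, so an expression that is invariant
  under it and compatible with restriction depends on the index alone. Separating the index
  \<open>i\<close> from the point \<open>loc i\<close> allows for data attached to edge-ends,
  several of which lie over one vertex.\<close>

lemma glue_invariant:
  fixes D :: "'p set \<Rightarrow> 't \<Rightarrow> 'i \<Rightarrow> 'a" and loc :: "'i \<Rightarrow> 'p"
  assumes T: "is_torsor X F T"
    and res: "\<And>U V t i. openin X U \<Longrightarrow> openin X V \<Longrightarrow> V \<subseteq> U \<Longrightarrow> t \<in> sections T U \<Longrightarrow> loc i \<in> V \<Longrightarrow>
      D V (restr T U V t) i = D U t i"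
    and inv: "\<And>U g t i. openin X U \<Longrightarrow> g \<in> sections F U \<Longrightarrow> t \<in> sections T U \<Longrightarrow> loc i \<in> U \<Longrightarrow>
      D U (act T U g t) i = D U t i"
  obtains r where
    "\<And>U t i. openin X U \<Longrightarrow> t \<in> sections T U \<Longrightarrow> loc i \<in> U \<Longrightarrow> D U t i = r i"
proof
  define c where "c i = (SOME p. openin X (fst p) \<and> loc i \<in> fst p \<and> snd p \<in> sections T (fst p))" for i
  fix U t i assume U: "openin X U" and t: "t \<in> sections T U" and i: "loc i \<in> U"
  define W w where "W = fst (c i)" and "w = snd (c i)"
  have "loc i \<in> topspace X" using openin_subset[OF U] i by blast
  then obtain V where "openin X V" "loc i \<in> V" "sections T V \<noteq> {}"
    using torsor_locally_nonempty[OF T] by blast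
  then have "\<exists>p. openin X (fst p) \<and> loc i \<in> fst p \<and> snd p \<in> sections T (fst p)" by force
  from someI_ex[OF this] have W: "openin X W" "loc i \<in> W" "w \<in> sections T W"
    unfolding W_def w_def c_def by auto
  have o: "openin X (U \<inter> W)" using U W by blast
  note tU = torsor_restr_in[OF T U o Int_lower1 t] and wW = torsor_restr_in[OF T W(1) o Int_lower2 W(3)]
  obtain g where g: "g \<in> sections F (U \<inter> W)"
    "restr T U (U \<inter> W) t = act T (U \<inter> W) g (restr T W (U \<inter> W) w)"
    using torsor_transitive[OF T o wW tU] by blast
  have "D U t i = D (U \<inter> W) (restr T U (U \<inter> W) t) i" using res[OF U o _ t] i W by simp
  also have "\<dots> = D (U \<inter> W) (restr T W (U \<inter> W) w) i" using g(2) inv[OF o g(1) wW] i W by simp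
  also have "\<dots> = D W w i" using res[OF W(1) o _ W(3)] i W by simp
  finally show "D U t i = D (fst (c i)) (snd (c i)) i" by (simp add: W_def w_def)
qed

context lf_graph
begin

section \<open>Classes of lift torsors\<close>

lemma delta_eq: "delta G f = torsor_class X (Harm G) (lift f)"
  by (simp add: delta_def connecting_map_def Harm_def)

lemma Pic_one: "\<one>\<^bsub>Pic G\<^esub> = delta G 0"
  by (simp add: Pic_def H1_def trivial_torsor_Harm delta_eq)

lemma delta_in_Pic: "delta G f \<in> carrier (Pic G)"
  unfolding Pic_def delta_eq by (rule torsor_class_in_H1[OF group_presheaf_Harm is_torsor_lift])

lemma delta_eq_iff:
  "delta G f = delta G g \<longleftrightarrow> (\<exists>m. morphism X (Harm G) (lift f) (lift g) m)"
  unfolding delta_eq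
  using torsor_class_eqI[OF group_presheaf_Harm is_torsor_lift is_torsor_lift]
    torsor_class_eqD[OF group_presheaf_Harm is_torsor_lift is_torsor_lift]
    torsor_iso_iff[OF group_presheaf_Harm is_torsor_lift is_torsor_lift] by metis

section \<open>Global piecewise linear functions\<close>

lemma Z_powD: "f \<in> carrier (Z_pow A) \<Longrightarrow> a \<notin> A \<Longrightarrow> f a = 0"
  by (simp add: Z_pow_def)

lemma box0_eq:
  "v \<in> verts G \<Longrightarrow> box0 G \<phi> v = (\<Sum>e\<in>in_arcs G v. \<phi> (head G e) - \<phi> (tail G e))
     - (\<Sum>e\<in>out_arcs G v. \<phi> (head G e) - \<phi> (tail G e))"
  unfolding box0_def codifferential_def
  by (auto intro!: arg_cong2[of _ _ _ _ minus] sum.cong simp: coboundary_def in_arcs_def out_arcs_def)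

lemma vdiff_global_PL:
  assumes r: "\<And>e x. e \<in> arcs G \<Longrightarrow> x \<in> {0..1} \<Longrightarrow> \<exists>a b. affine_near G r e x a b"
  obtains \<phi> where "\<phi> \<in> carrier (Z_pow (verts G))" "\<And>v. v \<in> verts G \<Longrightarrow> vdiff r v = box0 G \<phi> v"
proof
  \<comment> \<open>The floor only changes the type: at the ends of an edge the value is already an
    integer, by integrality of the coefficients.\<close>
  define \<phi> where "\<phi> v = (if v \<in> verts G then \<lfloor>r (Inl v)\<rfloor> else 0)" for v
  show "\<phi> \<in> carrier (Z_pow (verts G))" by (simp add: Z_pow_def \<phi>_def)
  have sl: "slope G r e x = \<phi> (head G e) - \<phi> (tail G e)" if e: "e \<in> arcs G" and x: "x \<in> {0..1}" for e x
  proof -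
    obtain a b where ab: "\<And>x. x \<in> {0..1} \<Longrightarrow> affine_near G r e x a b"
      by (rule affine_on_connected[of "{0..1}" r e]) (use r[OF e] in auto)
    have "r (Inl (tail G e)) = of_int a" using affine_nearD[OF ab, of 0] by (simp add: em_ends)
    moreover have "r (Inl (head G e)) = of_int (a + b)"
      using affine_nearD[OF ab, of 1] by (simp add: em_ends)
    ultimately have "\<phi> (tail G e) = a" "\<phi> (head G e) = a + b" using e by (simp_all add: \<phi>_def)
    then show ?thesis using slope_eq[OF ab[OF x] x] by simp
  qed
  show "vdiff r v = box0 G \<phi> v" if v: "v \<in> verts G" for v
    unfolding vdiff_def box0_eq[OF v]
    by (intro arg_cong2[of _ _ _ _ minus] sum.cong refl sl) (auto simp: in_arcs_def out_arcs_def)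
qed

text \<open>Linear extension of a vertex function along the edges. Its slope on \<open>e\<close> is
  \<open>coboundary G \<phi> e\<close>, so that its \<open>diff\<close> is
  \<open>box0 G \<phi>\<close>.\<close>

definition interp :: "('v \<Rightarrow> int) \<Rightarrow> ('v, 'e) point \<Rightarrow> real" where
  "interp \<phi> p = (case p of Inl v \<Rightarrow> of_int (\<phi> v) |
     Inr (e, x) \<Rightarrow> of_int (\<phi> (tail G e)) + of_int (\<phi> (head G e) - \<phi> (tail G e)) * x)"

lemma interp_affine: "affine_near G (interp \<phi>) e x (\<phi> (tail G e)) (\<phi> (head G e) - \<phi> (tail G e))"
  unfolding affine_near_def by (simp add: interp_def edge_map_def)

lemma vdiff_interp: "v \<in> verts G \<Longrightarrow> vdiff (interp \<phi>) v = box0 G \<phi> v"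
  unfolding vdiff_def using slope_eq[OF interp_affine] by (simp add: box0_eq)

lemma PL_of_global:
  assumes U: "openin X U" and h: "\<And>e x. e \<in> arcs G \<Longrightarrow> x \<in> {0..1} \<Longrightarrow> \<exists>a b. affine_near G h e x a b"
  shows "(\<lambda>p. if p \<in> U then h p else 0) \<in> sections (PL G) U"
  unfolding PL_iff[OF U]
proof (intro conjI ballI impI)
  fix e x assume a: "e \<in> arcs G" "x \<in> {0..1}" "em e x \<in> U"
  obtain c b where "affine_near G h e x c b" using h[OF a(1,2)] by blast
  then have "affine_near G (\<lambda>p. if p \<in> U then h p else 0) e x c b"
    by (rule affine_near_cong[OF U a, rotated]) simp
  then show "\<exists>c b. affine_near G (\<lambda>p. if p \<in> U then h p else 0) e x c b" by blast
qed simp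

lemma Inl_in_verts: "openin X U \<Longrightarrow> Inl v \<in> U \<Longrightarrow> v \<in> verts G"
  using open_sub Inl_in_points by blast

text \<open>Adding \<open>interp \<phi>\<close>, restricted to each open set, is a morphism from the
  lifts of \<open>f\<close> to the lifts of \<open>g\<close>.\<close>

lemma delta_add_box0:
  assumes g: "\<And>v. v \<in> verts G \<Longrightarrow> g v = f v + box0 G \<phi> v"
  shows "delta G f = delta G g"
  unfolding delta_eq_iff
proof
  let ?h = "\<lambda>U p. if p \<in> U then interp \<phi> p else 0"
  have h: "?h U \<in> sections (PL G) U" if "openin X U" for U
    using PL_of_global[OF that] interp_affine by blast
  have vd: "vdiff (?h U) v = box0 G \<phi> v" if "openin X U" "Inl v \<in> U" for U v
    using vdiff_cong[OF that, of "?h U" "interp \<phi>"] vdiff_interp[of v \<phi>] Inl_in_points open_sub[OF that(1)] that(2)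
    by auto
  have "(\<lambda>U b. b + ?h U) U \<in> sections (lift f) U \<rightarrow> sections (lift g) U" if U: "openin X U" for U
    using PL_group(2)[OF U _ h[OF U]] vdiff_add[OF _ h[OF U]] vd[OF U]
      g[OF Inl_in_verts[OF U]] by (auto simp: lift_iff[OF U])
  then show "morphism X (Harm G) (lift f) (lift g) (\<lambda>U b. b + ?h U)"
    unfolding equivariant_def by (auto simp: restr_lift act_lift fun_eq_iff)
qed

lemma delta_eq_imp_box0:
  assumes eq: "delta G f = delta G g"
  obtains \<phi> where "\<phi> \<in> carrier (Z_pow (verts G))" "\<And>v. v \<in> verts G \<Longrightarrow> g v - f v = box0 G \<phi> v"
proof -
  obtain m where m: "morphism X (Harm G) (lift f) (lift g) m"
    using eq delta_eq_iff by blast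
  \<comment> \<open>By equivariance, \<open>m U b - b\<close> does not change when a harmonic
    function is added to \<open>b\<close>; these differences therefore fit together to one function
    \<open>r\<close>.\<close>
  obtain r where r: "\<And>U b p. openin X U \<Longrightarrow> b \<in> sections (lift f) U \<Longrightarrow> p \<in> U \<Longrightarrow> m U b p - b p = r p"
  proof (rule glue_invariant[OF is_torsor_lift, where loc = "\<lambda>p. p" and D = "\<lambda>U b p. m U b p - b p"])
    show "m V (restr (lift f) U V t) i - restr (lift f) U V t i = m U t i - t i"
      if "openin X U" "openin X V" "V \<subseteq> U" "t \<in> sections (lift f) U" "i \<in> V" for U V t i
      using equivariant_restr[OF m that(1-4)] that(5) by (simp add: restr_lift)
    show "m U (act (lift f) U h t) i - act (lift f) U h t i = m U t i - t i"
      if "openin X U" "h \<in> sections (Harm G) U" "t \<in> sections (lift f) U" "i \<in> U" for U h t i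
      using equivariant_act[OF m that(1-3)] by (simp add: act_lift)
  qed blast
  have loc: "\<exists>U b. openin X U \<and> p \<in> U \<and> b \<in> sections (lift f) U \<and> m U b \<in> sections (lift g) U"
    if "p \<in> points G" for p
    using torsor_locally_nonempty[OF is_torsor_lift, of p] that equivariant_in[OF m]
    unfolding topspace_X by blast
  obtain \<phi> where \<phi>: "\<phi> \<in> carrier (Z_pow (verts G))" "\<And>v. v \<in> verts G \<Longrightarrow> vdiff r v = box0 G \<phi> v"
  proof (rule vdiff_global_PL[of r])
    fix e and x :: real assume e: "e \<in> arcs G" "x \<in> {0..1}"
    then obtain U b where U: "openin X U" "em e x \<in> U" "b \<in> sections (lift f) U"
      "m U b \<in> sections (lift g) U" using loc[OF em_in_points] by blast
    obtain c d where cd: "affine_near G (m U b - b) e x c d"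
      using PL_affine[OF PL_group(3)[OF U(1) sections_lift_PL[OF U(4)] sections_lift_PL[OF U(3)]] e U(2)]
      by blast
    show "\<exists>a b. affine_near G r e x a b"
      using affine_near_cong[OF U(1) e U(2) _ cd] r[OF U(1,3)] by (metis minus_apply)
  qed blast
  have "g v - f v = box0 G \<phi> v" if v: "v \<in> verts G" for v
  proof -
    obtain U b where U: "openin X U" "Inl v \<in> U" "b \<in> sections (lift f) U"
      "m U b \<in> sections (lift g) U" using loc[of "Inl v"] v Inl_in_points by blast
    have "vdiff r v = vdiff (m U b - b) v"
      using vdiff_cong[OF U(1,2), of r "m U b - b"] r[OF U(1,3)] by simp
    also have "\<dots> = g v - f v"
      using vdiff_diff[OF sections_lift_PL[OF U(4)] sections_lift_PL[OF U(3)] U(2,2)] U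
      by (simp add: lift_iff)
    finally show ?thesis using \<phi>(2)[OF v] by simp
  qed
  then show ?thesis using that \<phi>(1) by blast
qed

section \<open>Addition of classes\<close>

text \<open>Addition of functions exhibits \<open>lift (f + g)\<close> as the pushforward of the
  product. Uniqueness of the pushforward gives one inclusion of the two sets of torsors; copies of
  \<open>lift f\<close> and \<open>lift g\<close> serve as the summands for the other.\<close>

lemma delta_mult: "delta G f \<otimes>\<^bsub>Pic G\<^esub> delta G g = delta G (f + g)"
proof -
  let ?H = "Harm G" and ?\<phi> = "\<lambda>(U::('v, 'e) point set) (h, k). h + (k :: ('v, 'e) point \<Rightarrow> real)"
  note gp = group_presheaf_Harm
  have "S \<in> delta G (f + g)"
    if S: "is_torsor X ?H S" and T: "T \<in> delta G f" "T' \<in> delta G g"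
      and m: "equivariant X (prod_presheaf ?H ?H) ?\<phi> (prod_torsor T T') S m"
    for S T T' and m :: "('v, 'e) point set \<Rightarrow> _ \<Rightarrow> ('v, 'e) point \<Rightarrow> ('v, 'e) point \<Rightarrow> real"
  proof -
    have T1: "is_torsor X ?H T" "torsor_iso X ?H (lift f) T"
      and T2: "is_torsor X ?H T'" "torsor_iso X ?H (lift g) T'"
      using T by (auto simp: delta_eq torsor_class_def)
    obtain i where i: "morphism X ?H T (lift f) i"
      using torsor_iso_sym[OF gp is_torsor_lift T1] torsor_iso_iff[OF gp T1(1) is_torsor_lift] by blast
    obtain j where j: "morphism X ?H T' (lift g) j"
      using torsor_iso_sym[OF gp is_torsor_lift T2] torsor_iso_iff[OF gp T2(1) is_torsor_lift] by blast
    have ij: "i U t + j U t' \<in> sections (lift (f + g)) U"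
      if "openin X U" "t \<in> sections T U" "t' \<in> sections T' U" for U t t'
      using equivariant_in[OF i that(1,2)] equivariant_in[OF j that(1,3)] vdiff_add[of "i U t" U "j U t'" U]
        PL_group(2) that(1) by (simp add: lift_iff)
    have "equivariant X (prod_presheaf ?H ?H) ?\<phi> (prod_torsor T T') (lift (f + g))
        (\<lambda>U (t, t'). i U t + j U t')"
      unfolding equivariant_def
      using ij equivariant_restr[OF i] equivariant_restr[OF j] equivariant_act[OF i] equivariant_act[OF j]
      by (auto simp: prod_torsor_def prod_presheaf_def restr_lift act_lift fun_eq_iff)
    note p = this m
    have "\<exists>k. morphism X ?H (lift (f + g)) S k"
    proof (rule pushforward_unique[OF gp is_torsor_lift S p])
      show "?\<phi> U h \<in> sections ?H U" if "openin X U" "h \<in> sections (prod_presheaf ?H ?H) U" for U h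
        using that group_presheaf_plus[OF gp] by (auto simp: prod_presheaf_def)
      show "restr (prod_torsor T T') U V t \<in> sections (prod_torsor T T') V"
        if "openin X U" "openin X V" "V \<subseteq> U" "t \<in> sections (prod_torsor T T') U" for U V t
        using that torsor_restr_in[OF T1(1)] torsor_restr_in[OF T2(1)] by (auto simp: prod_torsor_def)
      show "\<exists>h\<in>sections (prod_presheaf ?H ?H) U. t' = act (prod_torsor T T') U h t"
        if U: "openin X U" and t: "t \<in> sections (prod_torsor T T') U" "t' \<in> sections (prod_torsor T T') U"
        for U t t'
      proof -
        have a: "fst t \<in> sections T U" "fst t' \<in> sections T U" "snd t \<in> sections T' U" "snd t' \<in> sections T' U"
          using t by (auto simp: prod_torsor_def)
        obtain h where "h \<in> sections ?H U" "fst t' = act T U h (fst t)"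
          using torsor_transitive[OF T1(1) U a(1,2)] by blast
        moreover obtain k where "k \<in> sections ?H U" "snd t' = act T' U k (snd t)"
          using torsor_transitive[OF T2(1) U a(3,4)] by blast
        ultimately show ?thesis
          by (intro bexI[of _ "(h, k)"]) (auto simp: prod_torsor_def prod_presheaf_def map_prod_def prod_eq_iff split_beta)
      qed
      show "\<exists>U. openin X U \<and> x \<in> U \<and> sections (prod_torsor T T') U \<noteq> {}" if x: "x \<in> topspace X" for x
      proof -
        obtain U where U: "openin X U" "x \<in> U" "sections T U \<noteq> {}"
          using torsor_locally_nonempty[OF T1(1) x] by blast
        obtain V where V: "openin X V" "x \<in> V" "sections T' V \<noteq> {}"
          using torsor_locally_nonempty[OF T2(1) x] by blast
        have o: "openin X (U \<inter> V)" using U V by blast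
        have "sections T (U \<inter> V) \<noteq> {}" "sections T' (U \<inter> V) \<noteq> {}"
          using U V torsor_restr_in[OF T1(1) U(1) o] torsor_restr_in[OF T2(1) V(1) o] by blast+
        then show ?thesis using o U V by (auto simp: prod_torsor_def)
      qed
    qed
    then show ?thesis
      using S torsor_iso_iff[OF gp is_torsor_lift S] by (simp add: delta_eq torsor_class_def)
  qed
  moreover have "\<exists>T\<in>delta G f. \<exists>T'\<in>delta G g. \<exists>m. equivariant X (prod_presheaf ?H ?H) ?\<phi> (prod_torsor T T') S m"
    if S: "S \<in> delta G (f + g)" for S
  proof -
    obtain k where k: "morphism X ?H (lift (f + g)) S k"
      using S by (auto simp: delta_eq torsor_class_def torsor_iso_def)
    let ?T = "torsor_copy (lift f) :: (_, _, ('v, 'e) point \<Rightarrow> _) torsor"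
      and ?T' = "torsor_copy (lift g) :: (_, _, ('v, 'e) point \<Rightarrow> _) torsor"
    have "?T \<in> delta G f" "?T' \<in> delta G g"
      unfolding delta_eq by (rule torsor_copy_in_class[OF gp is_torsor_lift])+
    moreover have add: "t + t' \<in> sections (lift (f + g)) U"
      if "openin X U" "t \<in> sections (lift f) U" "t' \<in> sections (lift g) U" for U t t'
      using that vdiff_add[of t U t' U] PL_group(2) by (simp add: lift_iff)
    have "equivariant X (prod_presheaf ?H ?H) ?\<phi> (prod_torsor ?T ?T') S
        (\<lambda>U (t, t'). k U (t undefined + t' undefined))"
      unfolding equivariant_def
    proof (intro allI impI conjI ballI)
      fix U assume U: "openin X U"
      show "(\<lambda>(t, t'). k U (t undefined + t' undefined)) \<in> sections (prod_torsor ?T ?T') U \<rightarrow> sections S U"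
        using add[OF U] equivariant_in[OF k U] by (auto simp: prod_torsor_def torsor_copy_def)
      fix t assume "t \<in> sections (prod_torsor ?T ?T') U"
      then obtain b b' where t: "t = (\<lambda>_. b, \<lambda>_. b')" "b \<in> sections (lift f) U" "b' \<in> sections (lift g) U"
        by (auto simp: prod_torsor_def torsor_copy_def)
      { fix V assume V: "openin X V \<and> V \<subseteq> U"
        have "restr (lift f) U V b + restr (lift g) U V b' = restr (lift (f + g)) U V (b + b')"
          by (auto simp: restr_lift)
        then show "(case restr (prod_torsor ?T ?T') U V t of (t, t') \<Rightarrow> k V (t undefined + t' undefined)) =
            restr S U V (case t of (t, t') \<Rightarrow> k U (t undefined + t' undefined))"
          using equivariant_restr[OF k U _ _ add[OF U t(2,3)]] V
          by (simp add: t(1) prod_torsor_def torsor_copy_def) }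
      fix h assume "h \<in> sections (prod_presheaf ?H ?H) U"
      then obtain h1 h2 where h: "h = (h1, h2)" "h1 \<in> sections ?H U" "h2 \<in> sections ?H U"
        by (auto simp: prod_presheaf_def)
      have "k U ((h1 + b) + (h2 + b')) = act S U (h1 + h2) (k U (b + b'))"
        using equivariant_act[OF k U group_presheaf_plus[OF gp U h(2,3)] add[OF U t(2,3)]]
        by (simp add: act_lift ac_simps)
      then show "(case act (prod_torsor ?T ?T') U h t of (t, t') \<Rightarrow> k U (t undefined + t' undefined)) =
          act S U (case h of (h, k) \<Rightarrow> h + k) (case t of (t, t') \<Rightarrow> k U (t undefined + t' undefined))"
        by (simp add: t(1) h(1) prod_torsor_def torsor_copy_def act_lift)
    qed
    ultimately show ?thesis by blast
  qed
  ultimately show ?thesis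
    unfolding Pic_def H1_def by (auto simp: delta_eq torsor_class_def)
qed

section \<open>The sheaf \<open>\<Omega>\<close>\<close>

lemma restr_Omega: "restr (Omega G) U V c = (\<lambda>e x. if em e x \<in> V then c e x else 0)"
  by (simp add: Omega_def kernel_sheaf_def edge_sheaf_def)

text \<open>Continuity into a discrete space is local constancy. As the preimage of \<open>U\<close>
  is open in the unit interval, it can be tested on neighbourhoods in all of
  \<open>{0..1}\<close>.\<close>

lemma continuous_map_edge:
  assumes U: "openin X U" and e: "e \<in> arcs G"
  shows "continuous_map (top_of_set {x \<in> {0..1}. em e x \<in> U}) (discrete_topology UNIV) c \<longleftrightarrow>
    (\<forall>x\<in>{0..1}. em e x \<in> U \<longrightarrow> (\<forall>\<^sub>F y in nhds x. y \<in> {0..1} \<longrightarrow> c y = c x))" (is "?L \<longleftrightarrow> ?R")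
proof -
  let ?S = "{x \<in> {0..1}. em e x \<in> U}"
  have "?L \<longleftrightarrow> (\<forall>A. \<forall>x\<in>?S. c x \<in> A \<longrightarrow> (\<forall>\<^sub>F y in nhds x. y \<in> ?S \<longrightarrow> c y \<in> A))"
    unfolding continuous_map_def openin_top_of_set_eventually by auto
  also have "\<dots> \<longleftrightarrow> (\<forall>x\<in>?S. \<forall>\<^sub>F y in nhds x. y \<in> ?S \<longrightarrow> c y = c x)"
  proof (intro iffI allI ballI impI)
    fix x assume "\<forall>A. \<forall>x\<in>?S. c x \<in> A \<longrightarrow> (\<forall>\<^sub>F y in nhds x. y \<in> ?S \<longrightarrow> c y \<in> A)" "x \<in> ?S"
    from this(1)[rule_format, of x "{c x}"] this(2)
    show "\<forall>\<^sub>F y in nhds x. y \<in> ?S \<longrightarrow> c y = c x" by simp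
  next
    fix A x assume "\<forall>x\<in>?S. \<forall>\<^sub>F y in nhds x. y \<in> ?S \<longrightarrow> c y = c x" "x \<in> ?S" and A: "c x \<in> A"
    then have "\<forall>\<^sub>F y in nhds x. y \<in> ?S \<longrightarrow> c y = c x" by blast
    then show "\<forall>\<^sub>F y in nhds x. y \<in> ?S \<longrightarrow> c y \<in> A" by eventually_elim (use A in auto)
  qed
  also have "\<dots> \<longleftrightarrow> ?R"
  proof -
    have "(\<forall>\<^sub>F y in nhds x. y \<in> ?S \<longrightarrow> c y = c x) \<longleftrightarrow> (\<forall>\<^sub>F y in nhds x. y \<in> {0..1} \<longrightarrow> c y = c x)"
      if "x \<in> ?S" for x
    proof -
      have *: "\<forall>\<^sub>F y in nhds x. y \<in> {0..1} \<longrightarrow> em e y \<in> U" using open_eventually[OF U e] that by blast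
      show ?thesis by (rule eventually_subst, use * in eventually_elim) auto
    qed
    then show ?thesis by blast
  qed
  finally show ?thesis .
qed

lemma Omega_iff:
  assumes U: "openin X U"
  shows "c \<in> sections (Omega G) U \<longleftrightarrow>
    (\<forall>e x. \<not> (e \<in> arcs G \<and> x \<in> {0..1} \<and> em e x \<in> U) \<longrightarrow> c e x = 0) \<and>
    (\<forall>e\<in>arcs G. \<forall>x\<in>{0..1}. em e x \<in> U \<longrightarrow> (\<forall>\<^sub>F y in nhds x. y \<in> {0..1} \<longrightarrow> c e y = c e x)) \<and>
    (\<forall>v. Inl v \<in> U \<longrightarrow> (\<Sum>e\<in>in_arcs G v. c e 1) = (\<Sum>e\<in>out_arcs G v. c e 0))"
  using Inl_in_verts[OF U] continuous_map_edge[OF U]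
  by (auto simp: Omega_def kernel_sheaf_def edge_sheaf_def edge_to_vertex_def fun_eq_iff)

lemma group_presheaf_Omega: "group_presheaf X (Omega G)"
  unfolding group_presheaf_def
proof (intro allI impI conjI ballI)
  fix U assume U: "openin X U"
  show "0 \<in> sections (Omega G) U" by (simp add: Omega_iff[OF U])
  show "g - h \<in> sections (Omega G) U" if g: "g \<in> sections (Omega G) U" and h: "h \<in> sections (Omega G) U" for g h
    unfolding Omega_iff[OF U]
  proof (intro conjI ballI impI allI)
    fix e x assume "e \<in> arcs G" "x \<in> {0..1}" "em e x \<in> U"
    then have "\<forall>\<^sub>F y in nhds x. y \<in> {0..1} \<longrightarrow> g e y = g e x" "\<forall>\<^sub>F y in nhds x. y \<in> {0..1} \<longrightarrow> h e y = h e x"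
      using g h unfolding Omega_iff[OF U] by blast+
    then show "\<forall>\<^sub>F y in nhds x. y \<in> {0..1} \<longrightarrow> (g - h) e y = (g - h) e x"
      by eventually_elim auto
  qed (use g h in \<open>auto simp: Omega_iff[OF U] sum_subtractf\<close>)
  fix V assume V: "openin X V \<and> V \<subseteq> U"
  show "restr (Omega G) U V (g - h) = restr (Omega G) U V g - restr (Omega G) U V h" for g h
    by (auto simp: restr_Omega fun_eq_iff)
  fix g assume g: "g \<in> sections (Omega G) U"
  have oV: "openin X V" using V by blast
  show "restr (Omega G) U V g \<in> sections (Omega G) V"
    unfolding Omega_iff[OF oV] restr_Omega
  proof (intro conjI ballI impI allI)
    fix e x assume a: "e \<in> arcs G" "x \<in> {0..1}" "em e x \<in> V"
    then have "\<forall>\<^sub>F y in nhds x. y \<in> {0..1} \<longrightarrow> g e y = g e x"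
      using g V unfolding Omega_iff[OF U] by blast
    with open_eventually[OF oV a] show "\<forall>\<^sub>F y in nhds x. y \<in> {0..1} \<longrightarrow>
        (if em e y \<in> V then g e y else 0) = (if em e x \<in> V then g e x else 0)"
      by eventually_elim (use a in auto)
  next
    fix v assume v: "Inl v \<in> V"
    have "(\<Sum>e\<in>in_arcs G v. if em e 1 \<in> V then g e 1 else 0) = (\<Sum>e\<in>in_arcs G v. g e 1)"
      "(\<Sum>e\<in>out_arcs G v. if em e 0 \<in> V then g e 0 else 0) = (\<Sum>e\<in>out_arcs G v. g e 0)"
      using v by (auto intro!: sum.cong simp: in_arcs_def out_arcs_def em_ends)
    then show "(\<Sum>e\<in>in_arcs G v. if em e 1 \<in> V then g e 1 else 0) =
        (\<Sum>e\<in>out_arcs G v. if em e 0 \<in> V then g e 0 else 0)"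
      using g v V by (auto simp: Omega_iff[OF U])
  qed (use g V in \<open>auto simp: Omega_iff[OF U]\<close>)
qed

text \<open>The first clause takes care of pairs that lie on no edge although
  \<open>edge_map\<close> sends them to a point of the realization, such as \<open>(e, 0)\<close>
  with \<open>e\<close> outside \<open>arcs G\<close>.\<close>

abbreviation "Omega_at p c \<equiv>
    (\<forall>e x. em e x = p \<longrightarrow> \<not> (e \<in> arcs G \<and> x \<in> {0..1}) \<longrightarrow> c e x = 0) \<and>
    (\<forall>e\<in>arcs G. \<forall>x\<in>{0..1}. em e x = p \<longrightarrow> (\<forall>\<^sub>F y in nhds x. y \<in> {0..1} \<longrightarrow> c e y = c e x)) \<and>
    (\<forall>v. p = Inl v \<longrightarrow> (\<Sum>e\<in>in_arcs G v. c e 1) = (\<Sum>e\<in>out_arcs G v. c e 0))"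

lemma sheaf_trivial_Omega: "sheaf X (trivial_torsor (Omega G))"
\<comment> \<open>Indexing by pairs \<open>(e, x)\<close> rather than by points keeps apart the
  edge-ends that meet at a vertex.\<close>
proof (rule sheaf_of_functions[where ev = case_prod and loc = "\<lambda>(e, x). em e x" and P = "Omega_at"])
  show "bij (case_prod :: ('e \<Rightarrow> real \<Rightarrow> int) \<Rightarrow> _)"
    by (rule o_bij[of curry]) (auto simp: fun_eq_iff)
  show "s \<in> sections (trivial_torsor (Omega G)) U \<longleftrightarrow>
      (\<forall>i. (case i of (e, x) \<Rightarrow> em e x) \<notin> U \<longrightarrow> case_prod s i = 0) \<and>
      (\<forall>p\<in>U. Omega_at p s)" if "openin X U" for U s
    unfolding trivial_torsor_def torsor.simps presheaf.simps Omega_iff[OF that] split_paired_All prod.case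
    by blast
  fix p W and s t :: "'e \<Rightarrow> real \<Rightarrow> int"
  assume W: "openin X W" "p \<in> W" and
    "\<And>i. (case i of (e, x) \<Rightarrow> em e x) \<in> W \<Longrightarrow> (case i of (e, x) \<Rightarrow> s e x) = (case i of (e, x) \<Rightarrow> t e x)" and
    s: "Omega_at p s"
  then have eq: "\<And>e x. em e x \<in> W \<Longrightarrow> s e x = t e x" by fastforce
  show "Omega_at p t"
  proof (intro conjI allI ballI impI)
    show "t e x = 0" if "em e x = p" "\<not> (e \<in> arcs G \<and> x \<in> {0..1})" for e x
      using s eq[of e x] that W by auto
    fix e x assume a: "e \<in> arcs G" "x \<in> {0..1}" "em e x = p"
    then have x: "em e x \<in> W" and "\<forall>\<^sub>F y in nhds x. y \<in> {0..1} \<longrightarrow> s e y = s e x" using s W by blast+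
    from open_eventually[OF W(1) a(1,2) x] this(2) show "\<forall>\<^sub>F y in nhds x. y \<in> {0..1} \<longrightarrow> t e y = t e x"
      by eventually_elim (use eq x in metis)
  next
    fix v assume v: "p = Inl v"
    have "(\<Sum>e\<in>in_arcs G v. t e 1) = (\<Sum>e\<in>in_arcs G v. s e 1)"
      "(\<Sum>e\<in>out_arcs G v. t e 0) = (\<Sum>e\<in>out_arcs G v. s e 0)"
      using v W eq by (auto intro!: sum.cong simp: in_arcs_def out_arcs_def em_ends)
    then show "(\<Sum>e\<in>in_arcs G v. t e 1) = (\<Sum>e\<in>out_arcs G v. t e 0)" using s v by auto
  qed
qed (auto simp: trivial_torsor_def restr_Omega)

lemma is_torsor_trivial_Omega: "is_torsor X (Omega G) (trivial_torsor (Omega G))"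
  unfolding is_torsor_def
proof (intro conjI allI impI ballI)
  fix U assume U: "openin X U"
  show "act (trivial_torsor (Omega G)) U g t \<in> sections (trivial_torsor (Omega G)) U"
    if "g \<in> sections (Omega G) U" "t \<in> sections (trivial_torsor (Omega G)) U" for g t
    using that group_presheaf_plus[OF group_presheaf_Omega U] by (simp add: trivial_torsor_def)
  show "\<exists>!g. g \<in> sections (Omega G) U \<and> t = act (trivial_torsor (Omega G)) U g s"
    if "s \<in> sections (trivial_torsor (Omega G)) U" "t \<in> sections (trivial_torsor (Omega G)) U" for s t
    using that group_presheaf_minus[OF group_presheaf_Omega U, of t s]
    by (intro ex1I[of _ "t - s"]) (auto simp: trivial_torsor_def)
next
  fix x assume "x \<in> topspace X"
  then show "\<exists>U. openin X U \<and> x \<in> U \<and> sections (trivial_torsor (Omega G)) U \<noteq> {}"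
    using group_presheaf_zero[OF group_presheaf_Omega, of "topspace X"]
    by (intro exI[of _ "topspace X"]) (auto simp: trivial_torsor_def)
qed (rule sheaf_trivial_Omega, auto simp: trivial_torsor_def restr_Omega fun_eq_iff add.assoc)

text \<open>The second part says that \<open>diff\<close> factors through the edge derivative, as
  its composition with the alternating sum that defines \<open>Omega G\<close>. This is why harmonic
  functions have their derivative in \<open>Omega G\<close>.\<close>

lemma edge_derivative_in:
  assumes U: "openin X U" and h: "h \<in> sections (PL G) U"
  shows "e \<in> arcs G \<Longrightarrow> x \<in> {0..1} \<Longrightarrow> em e x \<in> U \<Longrightarrow>
      \<forall>\<^sub>F y in nhds x. y \<in> {0..1} \<longrightarrow> edge_derivative G U h e y = edge_derivative G U h e x"
    "Inl v \<in> U \<Longrightarrow> (\<Sum>e\<in>in_arcs G v. edge_derivative G U h e 1)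
      - (\<Sum>e\<in>out_arcs G v. edge_derivative G U h e 0) = vdiff h v"
proof -
  assume a: "e \<in> arcs G" "x \<in> {0..1}" "em e x \<in> U"
  obtain b where "affine_near G h e x b (slope G h e x)" using PL_affine_slope[OF h a] .
  from affine_near_eventually[OF this] open_eventually[OF U a]
  show "\<forall>\<^sub>F y in nhds x. y \<in> {0..1} \<longrightarrow> edge_derivative G U h e y = edge_derivative G U h e x"
    by eventually_elim (use a slope_eq in \<open>auto simp: edge_derivative_def\<close>)
next
  assume "Inl v \<in> U"
  then show "(\<Sum>e\<in>in_arcs G v. edge_derivative G U h e 1)
      - (\<Sum>e\<in>out_arcs G v. edge_derivative G U h e 0) = vdiff h v"
    unfolding vdiff_def
    by (intro arg_cong2[of _ _ _ _ minus] sum.cong refl)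
      (auto simp: edge_derivative_def in_arcs_def out_arcs_def em_ends)
qed

lemma edge_derivative_Harm:
  assumes U: "openin X U" and h: "h \<in> sections (Harm G) U"
  shows "edge_derivative G U h \<in> sections (Omega G) U"
proof -
  have PL: "h \<in> sections (PL G) U" using h by (simp add: Harm_iff[OF U])
  show ?thesis unfolding Omega_iff[OF U]
  proof (intro conjI allI ballI impI)
    fix v assume "Inl v \<in> U"
    then show "(\<Sum>e\<in>in_arcs G v. edge_derivative G U h e 1) = (\<Sum>e\<in>out_arcs G v. edge_derivative G U h e 0)"
      using edge_derivative_in(2)[OF U PL, of v] h by (simp add: Harm_iff[OF U])
  qed (use edge_derivative_in(1)[OF U PL] in \<open>auto simp: edge_derivative_def\<close>)
qed

lemma edge_derivative_add:
  assumes "h \<in> sections (PL G) U" "k \<in> sections (PL G) U"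
  shows "edge_derivative G U (h + k) = edge_derivative G U h + edge_derivative G U k"
  using slope_add[OF assms] by (auto simp: edge_derivative_def fun_eq_iff)

lemma edge_derivative_restr:
  assumes "openin X V" "V \<subseteq> U"
  shows "edge_derivative G V (\<lambda>p. if p \<in> V then h p else 0) =
    (\<lambda>e x. if em e x \<in> V then edge_derivative G U h e x else 0)"
  using assms(2) slope_cong[OF assms(1), of _ _ "\<lambda>p. if p \<in> V then h p else 0" h]
  by (auto simp: edge_derivative_def fun_eq_iff)

text \<open>\<open>b \<mapsto> b' - \<omega>\<close> trivializes the pushforward to \<open>\<Omega>\<close>; conversely, \<open>\<omega>\<close> is recovered from a
  trivialization \<open>m\<close> as the global section \<open>b' - m b\<close>, which does not depend on \<open>b\<close>.\<close>

lemma lift_to_Omega_iff: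
  assumes f: "f \<in> carrier (Z_pow (verts G))"
  shows "(\<exists>m. equivariant X (Harm G) (edge_derivative G) (lift f) (trivial_torsor (Omega G)) m) \<longleftrightarrow>
    f \<in> codifferential G ` carrier (Z_pow (arcs G))" (is "?L \<longleftrightarrow> ?R")
proof
  assume ?R
  then obtain \<omega> where \<omega>: "f = codifferential G \<omega>" by blast
  define m where "m U b = edge_derivative G U b -
      (\<lambda>e x. if e \<in> arcs G \<and> x \<in> {0..1} \<and> em e x \<in> U then \<omega> e else 0)" for U b
  have "m U b \<in> sections (Omega G) U" if U: "openin X U" and b: "b \<in> sections (lift f) U" for U b
    unfolding Omega_iff[OF U]
  proof (intro conjI allI ballI impI)
    note PL = sections_lift_PL[OF b]
    fix e x assume a: "e \<in> arcs G" "x \<in> {0..1}" "em e x \<in> U"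
    from edge_derivative_in(1)[OF U PL a] open_eventually[OF U a]
    show "\<forall>\<^sub>F y in nhds x. y \<in> {0..1} \<longrightarrow> m U b e y = m U b e x"
      by eventually_elim (use a in \<open>auto simp: m_def\<close>)
  next
    fix v assume v: "Inl v \<in> U"
    have "(\<Sum>e\<in>in_arcs G v. m U b e 1) =
        (\<Sum>e\<in>in_arcs G v. edge_derivative G U b e 1) - (\<Sum>e\<in>in_arcs G v. \<omega> e)"
      "(\<Sum>e\<in>out_arcs G v. m U b e 0) =
        (\<Sum>e\<in>out_arcs G v. edge_derivative G U b e 0) - (\<Sum>e\<in>out_arcs G v. \<omega> e)"
      unfolding sum_subtractf[symmetric] using v
      by (auto intro!: sum.cong simp: m_def in_arcs_def out_arcs_def em_ends)
    moreover have "vdiff b v = f v" using b v by (simp add: lift_iff[OF U])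
    ultimately show "(\<Sum>e\<in>in_arcs G v. m U b e 1) = (\<Sum>e\<in>out_arcs G v. m U b e 0)"
      using edge_derivative_in(2)[OF U sections_lift_PL[OF b] v] Inl_in_verts[OF U v]
      by (simp add: \<omega> codifferential_def)
  qed (auto simp: m_def edge_derivative_def)
  moreover have "m V (restr (lift f) U V b) = restr (Omega G) U V (m U b)"
    if "openin X V" "V \<subseteq> U" for U V b
    using edge_derivative_restr[OF that] that by (auto simp: m_def restr_lift restr_Omega fun_eq_iff)
  moreover have "m U (g + b) = edge_derivative G U g + m U b"
    if "openin X U" "g \<in> sections (Harm G) U" "b \<in> sections (lift f) U" for U g b
    using edge_derivative_add[of g U b] that sections_lift_PL by (simp add: m_def Harm_iff)
  ultimately have "equivariant X (Harm G) (edge_derivative G) (lift f) (trivial_torsor (Omega G)) m"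
    unfolding equivariant_def by (auto simp: trivial_torsor_def act_lift)
  then show ?L by blast
next
  assume ?L
  then obtain m where m: "equivariant X (Harm G) (edge_derivative G) (lift f) (trivial_torsor (Omega G)) m" ..
  have mO: "m U b \<in> sections (Omega G) U" if "openin X U" "b \<in> sections (lift f) U" for U b
    using equivariant_in[OF m that] by (simp add: trivial_torsor_def)
  obtain r where r: "\<And>U b i. openin X U \<Longrightarrow> b \<in> sections (lift f) U \<Longrightarrow> case_prod em i \<in> U \<Longrightarrow>
      edge_derivative G U b (fst i) (snd i) - m U b (fst i) (snd i) = r i"
  proof (rule glue_invariant[OF is_torsor_lift, where loc = "case_prod em" and
        D = "\<lambda>U b i. edge_derivative G U b (fst i) (snd i) - m U b (fst i) (snd i)"])
    show "edge_derivative G V (restr (lift f) U V b) (fst i) (snd i) - m V (restr (lift f) U V b) (fst i) (snd i)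
        = edge_derivative G U b (fst i) (snd i) - m U b (fst i) (snd i)"
      if "openin X U" "openin X V" "V \<subseteq> U" "b \<in> sections (lift f) U" "case_prod em i \<in> V" for U V b i
      using equivariant_restr[OF m that(1-4)] edge_derivative_restr[OF that(2,3)] that(5)
      by (auto simp: restr_lift trivial_torsor_def restr_Omega split_beta)
    show "edge_derivative G U (act (lift f) U g b) (fst i) (snd i) - m U (act (lift f) U g b) (fst i) (snd i)
        = edge_derivative G U b (fst i) (snd i) - m U b (fst i) (snd i)"
      if "openin X U" "g \<in> sections (Harm G) U" "b \<in> sections (lift f) U" "case_prod em i \<in> U" for U g b i
      using equivariant_act[OF m that(1-3)] edge_derivative_add[of g U b] that sections_lift_PL
      by (simp add: act_lift trivial_torsor_def Harm_iff)
  qed blast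
  have loc: "\<exists>U b. openin X U \<and> p \<in> U \<and> b \<in> sections (lift f) U" if "p \<in> points G" for p
    using torsor_locally_nonempty[OF is_torsor_lift, of p] that unfolding topspace_X by blast
  define \<omega> where "\<omega> e = (if e \<in> arcs G then r (e, 0) else 0)" for e
  have r\<omega>: "r (e, x) = \<omega> e" if e: "e \<in> arcs G" and x: "x \<in> {0..1}" for e x
  proof -
    \<comment> \<open>The edge derivative and \<open>m U b\<close> are both locally constant along
      the edge, hence so is their difference.\<close>
    have "r (e, x) = r (e, 0)"
    proof (rule eventually_constant_imp_constant[of "{0..1}" "\<lambda>x. r (e, x)"])
      fix x :: real assume x: "x \<in> {0..1}"
      obtain U b where U: "openin X U" "em e x \<in> U" "b \<in> sections (lift f) U"
        using loc[OF em_in_points[OF e x]] by blast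
      have "\<forall>\<^sub>F y in nhds x. y \<in> {0..1} \<longrightarrow> m U b e y = m U b e x"
        using mO[OF U(1,3)] e x U(2) by (auto simp: Omega_iff[OF U(1)])
      with edge_derivative_in(1)[OF U(1) sections_lift_PL[OF U(3)] e x U(2)] open_eventually[OF U(1) e x U(2)]
      show "\<forall>\<^sub>F y in nhds x. y \<in> {0..1} \<longrightarrow> r (e, y) = r (e, x)"
      proof eventually_elim
        case (elim y)
        then show ?case using r[OF U(1,3), of "(e, x)"] r[OF U(1,3), of "(e, y)"] U(2) by auto
      qed
    qed (use x in auto)
    then show ?thesis using e by (simp add: \<omega>_def)
  qed
  have "f v = codifferential G \<omega> v" for v
  proof (cases "v \<in> verts G")
    case True
    then obtain U b where U: "openin X U" "Inl v \<in> U" "b \<in> sections (lift f) U"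
      using loc Inl_in_points by blast
    have "(\<Sum>e\<in>in_arcs G v. \<omega> e) = (\<Sum>e\<in>in_arcs G v. edge_derivative G U b e 1 - m U b e 1)"
      "(\<Sum>e\<in>out_arcs G v. \<omega> e) = (\<Sum>e\<in>out_arcs G v. edge_derivative G U b e 0 - m U b e 0)"
      using r[OF U(1,3), of "(_, 1)"] r[OF U(1,3), of "(_, 0)"] U(2) r\<omega>
      by (auto intro!: sum.cong simp: in_arcs_def out_arcs_def em_ends)
    \<comment> \<open>Since \<open>m U b\<close> is a section of \<open>Omega G\<close>, it
      contributes nothing to \<open>codifferential G \<omega> v\<close>; what remains is
      \<open>vdiff b v\<close>.\<close>
    moreover have "(\<Sum>e\<in>in_arcs G v. m U b e 1) = (\<Sum>e\<in>out_arcs G v. m U b e 0)"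
      using mO[OF U(1,3)] U(2) by (simp add: Omega_iff[OF U(1)])
    moreover have "vdiff b v = f v" using U by (simp add: lift_iff)
    ultimately show ?thesis
      using edge_derivative_in(2)[OF U(1) sections_lift_PL[OF U(3)] U(2)] True
      by (simp add: codifferential_def sum_subtractf)
  qed (simp add: codifferential_def Z_powD[OF f])
  moreover have "\<omega> \<in> carrier (Z_pow (arcs G))" by (simp add: Z_pow_def \<omega>_def)
  ultimately show ?R by blast
qed

text \<open>Isomorphisms between \<open>lift f\<close> and the members of its class, together with
  uniqueness of pushforwards, turn triviality of the image class into the existence of one
  equivariant map from \<open>lift f\<close> itself to the trivial torsor.\<close>

lemma delta_in_Pic0_iff:
  assumes f: "f \<in> carrier (Z_pow (verts G))"
  shows "delta G f \<in> carrier (Pic0 G) \<longleftrightarrow> f \<in> codifferential G ` carrier (Z_pow (arcs G))"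
proof -
  let ?H = "Harm G" and ?O = "Omega G" and ?d = "edge_derivative G"
  let ?tr = "trivial_torsor (Omega G)"
  note tO = is_torsor_trivial_Omega
  have L: "is_torsor X ?H T \<and> (\<exists>i. morphism X ?H (lift f) T i) \<and>
      (\<exists>i. morphism X ?H T (lift f) i)"
    if "T \<in> delta G f" for T
    using that torsor_iso_sym[OF group_presheaf_Harm is_torsor_lift, of T f]
    by (auto simp: delta_eq torsor_class_def torsor_iso_def)
  have "H1_map X ?H ?O ?d (delta G f) = torsor_class X ?O ?tr \<longleftrightarrow>
      (\<exists>m. equivariant X ?H ?d (lift f) ?tr m)" (is "?eq \<longleftrightarrow> ?ex")
  proof
    let ?C = "torsor_copy ?tr :: (_, _, ('v, 'e) point \<Rightarrow> _) torsor"
    assume ?eq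
    then have "?C \<in> H1_map X ?H ?O ?d (delta G f)"
      using torsor_copy_in_class[OF group_presheaf_Omega tO] by simp
    then obtain T m where T: "T \<in> delta G f" and m: "equivariant X ?H ?d T ?C m"
      and C: "is_torsor X ?O ?C"
      by (auto simp: H1_map_def)
    obtain i where i: "morphism X ?H (lift f) T i" using L[OF T] by blast
    obtain k where k: "morphism X ?O ?C ?tr k"
      using torsor_iso_sym[OF group_presheaf_Omega tO C]
        torsor_copy_in_class[OF group_presheaf_Omega tO]
      by (auto simp: torsor_class_def torsor_iso_def)
    have "equivariant X ?H ?d (lift f) ?C (\<lambda>U t. m U (i U t))"
      using equivariant_comp[OF i m] by simp
    from equivariant_comp[OF this k] edge_derivative_Harm show ?ex by blast
  next
    assume ?ex
    then obtain m where m: "equivariant X ?H ?d (lift f) ?tr m" ..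
    show ?eq
    proof (intro equalityI subsetI)
      fix S assume "S \<in> H1_map X ?H ?O ?d (delta G f)"
      then obtain T n where S: "is_torsor X ?O S" and T: "T \<in> delta G f" and n: "equivariant X ?H ?d T S n"
        by (auto simp: H1_map_def)
      obtain i where i: "morphism X ?H T (lift f) i" using L[OF T] by blast
      have "equivariant X ?H ?d T ?tr (\<lambda>U t. m U (i U t))" using equivariant_comp[OF i m] by simp
      then have "\<exists>k. morphism X ?O ?tr S k"
        using pushforward_unique_torsor[OF group_presheaf_Omega _ tO S _ n] L[OF T] edge_derivative_Harm by blast
      then show "S \<in> torsor_class X ?O ?tr"
        using S torsor_iso_iff[OF group_presheaf_Omega tO S] by (simp add: torsor_class_def)
    next
      fix S assume "S \<in> torsor_class X ?O ?tr"
      then obtain k where S: "is_torsor X ?O S" and k: "morphism X ?O ?tr S k"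
        by (auto simp: torsor_class_def torsor_iso_def)
      have T: "torsor_copy (lift f) \<in> delta G f"
        unfolding delta_eq by (rule torsor_copy_in_class[OF group_presheaf_Harm is_torsor_lift])
      then obtain i where i: "morphism X ?H (torsor_copy (lift f) :: (_, _, ('v, 'e) point \<Rightarrow> _) torsor) (lift f) i"
        using L by blast
      have "equivariant X ?H ?d (torsor_copy (lift f) :: (_, _, ('v, 'e) point \<Rightarrow> _) torsor) ?tr (\<lambda>U t. m U (i U t))"
        using equivariant_comp[OF i m] by simp
      from equivariant_comp[OF this k] edge_derivative_Harm
      show "S \<in> H1_map X ?H ?O ?d (delta G f)" using S T by (auto simp: H1_map_def)
    qed
  qed
  then show ?thesis
    using lift_to_Omega_iff[OF f] delta_in_Pic[of f]
    by (simp add: Pic0_def kernel_def H1_def[of X "Omega G"])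
qed

section \<open>Local sections of torsors under harmonic functions\<close>

text \<open>Extended by \<open>0\<close> off the part \<open>S\<close> of the edge \<open>e\<close>.
  For an open connected \<open>S\<close> inside the open edge these are exactly the harmonic
  functions there, since no vertex imposes a condition.\<close>

definition line :: "'e \<Rightarrow> real set \<Rightarrow> int \<Rightarrow> int \<Rightarrow> ('v, 'e) point \<Rightarrow> real" where
  "line e S a b p = (case p of Inl v \<Rightarrow> 0 |
     Inr (d, x) \<Rightarrow> if d = e \<and> x \<in> S then of_int a + of_int b * x else 0)"

lemma line_em: "S \<subseteq> {0<..<1} \<Longrightarrow> line e S a b (em d x) = (if d = e \<and> x \<in> S then of_int a + of_int b * x else 0)"
  by (auto simp: line_def edge_map_def)

lemma Inl_notin_image: "S \<subseteq> {0<..<1} \<Longrightarrow> Inl v \<notin> em e ` S"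
  by (auto simp: edge_map_def)

lemma line_off:
  assumes "S \<subseteq> {0<..<1}" "p \<notin> em e ` S"
  shows "line e S a b p = 0"
proof (cases p)
  case (Inr q)
  have False if "q = (e, x)" "x \<in> S" for x
    using assms that Inr em_interior[of x e] by force
  then show ?thesis using Inr by (cases q) (auto simp: line_def)
qed (simp add: line_def)

lemma line_Harm:
  assumes e: "e \<in> arcs G" and S: "open S" "S \<subseteq> {0<..<1}"
  shows "line e S a b \<in> sections (Harm G) (em e ` S)"
proof -
  note U = open_interval_in_X[OF e S]
  have "\<exists>a' b'. affine_near G (line e S a b) d x a' b'" if "em d x \<in> em e ` S" for d x
  proof -
    have d: "d = e" "x \<in> S" using em_in_image[OF S(2)] that by auto
    have "\<forall>\<^sub>F y in nhds x. y \<in> S" using S d by (intro eventually_nhds_in_open)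
    then have "affine_near G (line e S a b) d x a b" unfolding affine_near_def
      by eventually_elim (simp add: line_em[OF S(2)] d)
    then show ?thesis by blast
  qed
  then show ?thesis
    using line_off[OF S(2)] Inl_notin_image[OF S(2)] by (auto simp: Harm_iff[OF U] PL_iff[OF U])
qed

lemma Harm_line:
  assumes e: "e \<in> arcs G" and S: "open S" "S \<subseteq> {0<..<1}" "connected S"
    and h: "h \<in> sections (Harm G) (em e ` S)"
  obtains a b where "h = line e S a b"
proof (cases "S = {}")
  case True
  then have "h = line e S 0 0"
    using h PL_zero[of h "em e ` S"] open_interval_in_X[OF e S(1,2)]
    by (auto simp: line_def fun_eq_iff Harm_iff split: sum.splits)
  then show ?thesis using that by blast
next
  case False
  have PL: "h \<in> sections (PL G) (em e ` S)" using h Harm_iff[OF open_interval_in_X[OF e S(1,2)]] by blast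
  have S01: "S \<subseteq> {0..1}" using S(2) by force
  obtain a b where ab: "\<And>x. x \<in> S \<Longrightarrow> affine_near G h e x a b"
    by (rule affine_on_connected[OF S(3) S01 False, of h e]) (use PL_affine[OF PL e] S01 in blast)+
  have "h p = line e S a b p" for p
  proof (cases "p \<in> em e ` S")
    case True
    then obtain x where "x \<in> S" "p = em e x" by blast
    then show ?thesis using affine_nearD[OF ab] S01 line_em[OF S(2)] by auto
  qed (use line_off[OF S(2)] PL_zero[OF PL] in auto)
  then show ?thesis using that by blast
qed

lemma restr_line:
  assumes "S' \<subseteq> S" "S \<subseteq> {0<..<1}"
  shows "restr (Harm G) U (em e ` S') (line e S a b) = line e S' a b"
proof
  fix p
  have S': "S' \<subseteq> {0<..<1}" using assms by blast
  show "restr (Harm G) U (em e ` S') (line e S a b) p = line e S' a b p"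
  proof (cases "p \<in> em e ` S'")
    case True
    then obtain x where "x \<in> S'" "p = em e x" by blast
    then show ?thesis using assms line_em[OF S'] line_em[OF assms(2)] by (auto simp: restr_Harm)
  qed (use line_off[OF S'] in \<open>auto simp: restr_Harm\<close>)
qed

lemma em_image_Int:
  assumes "S \<subseteq> {0<..<1}" "S' \<subseteq> {0<..<1}"
  shows "em e ` S \<inter> em e ` S' = em e ` (S \<inter> S')"
proof (intro equalityI subsetI)
  fix p assume p: "p \<in> em e ` S \<inter> em e ` S'"
  then obtain x where "p = em e x" "x \<in> S" by blast
  then show "p \<in> em e ` (S \<inter> S')" using em_in_image[OF assms(2)] p by blast
qed blast

text \<open>Harmonic functions on an interval in an edge are affine and hence extend, so that two sections
  over overlapping intervals can be glued after changing one of them.\<close>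

lemma extend_section:
  assumes T: "is_torsor X (Harm G) T" and e: "e \<in> arcs G"
    and S: "open S" "S \<subseteq> {0<..<1}" and S': "open S'" "S' \<subseteq> {0<..<1}" and c: "connected (S \<inter> S')"
    and s: "s \<in> sections T (em e ` S)" and t: "t \<in> sections T (em e ` S')"
  obtains a b where "restr T (em e ` S) (em e ` (S \<inter> S')) s =
    restr T (em e ` S') (em e ` (S \<inter> S')) (act T (em e ` S') (line e S' a b) t)"
proof -
  let ?I = "em e ` (S \<inter> S')"
  have oS: "open (S \<inter> S')" "S \<inter> S' \<subseteq> {0<..<1}" using S S' by auto
  note o = open_interval_in_X[OF e S] open_interval_in_X[OF e S'] open_interval_in_X[OF e oS]
  have sub: "?I \<subseteq> em e ` S" "?I \<subseteq> em e ` S'" by blast+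
  obtain h where h: "h \<in> sections (Harm G) ?I"
    "restr T (em e ` S) ?I s = act T ?I h (restr T (em e ` S') ?I t)"
    using torsor_transitive[OF T o(3) torsor_restr_in[OF T o(2,3) sub(2) t] torsor_restr_in[OF T o(1,3) sub(1) s]]
    by blast
  obtain a b where ab: "h = line e (S \<inter> S') a b" using Harm_line[OF e oS c h(1)] .
  have "restr T (em e ` S') ?I (act T (em e ` S') (line e S' a b) t) =
      act T ?I h (restr T (em e ` S') ?I t)"
    using torsor_restr_act[OF T o(2,3) sub(2) line_Harm[OF e S'] t] restr_line[of "S \<inter> S'" S'] S'(2) ab
    by simp
  then show ?thesis using h(2) by (intro that[of a b]) simp
qed

text \<open>Compactness of the closed edge: sections exist near every point of it, the ends
  included, and those over adjacent intervals can be glued by \<open>extend_section\<close>, so that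
  bisection reaches the whole edge.\<close>

lemma section_on_edge:
  assumes T: "is_torsor X (Harm G) T" and e: "e \<in> arcs G"
  shows "sections T (eI e) \<noteq> {}"
proof -
  define J where "J a b = {a<..<b} \<inter> {0<..<1::real}" for a b
  have J: "open (J a b)" "J a b \<subseteq> {0<..<1}" for a b by (auto simp: J_def)
  note oJ = open_interval_in_X[OF e J]
  \<comment> \<open>The section lives on an interval strictly larger than \<open>[a, b]\<close> on
    both sides, cut down to the open edge. Thus the intervals for \<open>P a b\<close> and
    \<open>P b c\<close> together cover the one needed for \<open>P a c\<close>.\<close>
  define P where "P a b \<longleftrightarrow> (\<exists>a'<a. \<exists>b'>b. sections T (em e ` J a' b') \<noteq> {})" for a b
  have "P 0 1"
  proof (rule Bolzano[of 0 1 P])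
    show "(0::real) \<le> 1" by simp
    fix a b c :: real assume ab: "P a b" and bc: "P b c" and le: "a \<le> b" "b \<le> c"
    obtain a1 b1 s where 1: "a1 < a" "b < b1" "s \<in> sections T (em e ` J a1 b1)"
      using ab unfolding P_def by blast
    obtain b2 c2 t where 2: "b2 < b" "c < c2" "t \<in> sections T (em e ` J b2 c2)"
      using bc unfolding P_def by blast
    have I: "J a1 b1 \<inter> J b2 c2 = J (max a1 b2) (min b1 c2)" by (auto simp: J_def)
    have "J (max a1 b2) (min b1 c2) = {max (max a1 b2) 0<..<min (min b1 c2) 1}" by (auto simp: J_def)
    then have "connected (J a1 b1 \<inter> J b2 c2)" using I by simp
    then obtain k l where kl: "restr T (em e ` J a1 b1) (em e ` (J a1 b1 \<inter> J b2 c2)) s =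
        restr T (em e ` J b2 c2) (em e ` (J a1 b1 \<inter> J b2 c2)) (act T (em e ` J b2 c2) (line e (J b2 c2) k l) t)"
      using extend_section[OF T e J J _ 1(3) 2(3)] by blast
    note t' = torsor_act_in[OF T oJ line_Harm[OF e J] 2(3)]
    obtain u where u: "u \<in> sections T (em e ` J a1 b1 \<union> em e ` J b2 c2)"
      using sheaf_glue2[OF torsor_sheaf[OF T] oJ oJ 1(3) t'[of k l]] kl
      unfolding em_image_Int[OF J(2) J(2)] by blast
    have "J a1 c2 \<subseteq> J a1 b1 \<union> J b2 c2"
      using 1(2) 2(1) by (auto simp: J_def)
    then have "em e ` J a1 c2 \<subseteq> em e ` J a1 b1 \<union> em e ` J b2 c2"
      by (metis image_mono image_Un)
    from torsor_restr_in[OF T openin_Un[OF oJ oJ] oJ this u] have "sections T (em e ` J a1 c2) \<noteq> {}"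
      by (metis empty_iff)
    then show "P a c" unfolding P_def using 1 2 by blast
  next
    fix x :: real assume x: "0 \<le> x" "x \<le> 1"
    have "em e x \<in> topspace X" using em_in_points[OF e] x topspace_X by auto
    then obtain U where U: "openin X U" "em e x \<in> U" "sections T U \<noteq> {}"
      using torsor_locally_nonempty[OF T] by blast
    have "\<forall>\<^sub>F y in nhds x. y \<in> {0..1} \<longrightarrow> em e y \<in> U" using open_eventually[OF U(1) e _ U(2)] x by auto
    then obtain d where d: "d > 0" "\<And>y. dist y x < d \<Longrightarrow> y \<in> {0..1} \<Longrightarrow> em e y \<in> U"
      by (auto simp: eventually_nhds_metric)
    show "\<exists>d>0. \<forall>a b. a \<le> x \<and> x \<le> b \<and> b - a < d \<longrightarrow> P a b"
    \<comment> \<open>An interval around \<open>x\<close> shorter than \<open>d/2\<close>, enlarged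
      by \<open>d/2\<close> on either side, stays within distance \<open>d\<close> of
      \<open>x\<close>.\<close>
    proof (intro exI[of _ "d/2"] conjI allI impI)
      fix a b assume ab: "a \<le> x \<and> x \<le> b \<and> b - a < d / 2"
      have "em e ` J (a - d/2) (b + d/2) \<subseteq> U"
      proof (intro image_subsetI)
        fix y assume "y \<in> J (a - d/2) (b + d/2)"
        then have "\<bar>y - x\<bar> < d" "y \<in> {0..1}" using ab by (auto simp: J_def)
        then show "em e y \<in> U" using d(2)[of y] by (simp add: dist_real_def)
      qed
      then have "sections T (em e ` J (a - d/2) (b + d/2)) \<noteq> {}"
        using torsor_restr_in[OF T U(1) oJ] U(3) by blast
      then show "P a b" unfolding P_def using d(1) by (intro exI[of _ "a - d/2"] exI[of _ "b + d/2"]) auto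
    qed (use d(1) in simp)
  qed
  then obtain a b where "a < 0" "1 < b" "sections T (em e ` J a b) \<noteq> {}" unfolding P_def by blast
  moreover have "J a b = {0<..<1}" if "a < 0" "1 < b" for a b using that by (auto simp: J_def)
  ultimately show ?thesis by metis
qed

text \<open>Subtracting \<open>t v\<close> near \<open>v\<close> and \<open>s e\<close> on \<open>e\<close>, and correcting the discrepancy \<open>a e + b e x\<close>
  between them by a ramp, turns the sections of \<open>T\<close> into piecewise linear functions with a
  prescribed \<open>diff\<close>.\<close>

lemma torsor_iso_lift:
  assumes T: "is_torsor X (Harm G) T"
    and N: "\<And>v. v \<in> verts G \<Longrightarrow> openin X (N v) \<and> Inl v \<in> N v \<and> t v \<in> sections T (N v)"
    and s: "\<And>e. e \<in> arcs G \<Longrightarrow> s e \<in> sections T (eI e)"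
    and r: "\<And>e. e \<in> arcs G \<Longrightarrow> 0 < r e \<and> r e \<le> 1/2"
    and sub: "\<And>e. e \<in> arcs G \<Longrightarrow> em e ` {0<..<r e} \<subseteq> N (tail G e)"
      "\<And>e. e \<in> arcs G \<Longrightarrow> em e ` {1 - r e<..<1} \<subseteq> N (head G e)"
    and tail: "\<And>e. e \<in> arcs G \<Longrightarrow> restr T (eI e) (em e ` {0<..<r e}) (s e) =
      restr T (N (tail G e)) (em e ` {0<..<r e}) (t (tail G e))"
    and head: "\<And>e. e \<in> arcs G \<Longrightarrow> restr T (N (head G e)) (em e ` {1 - r e<..<1}) (t (head G e)) =
      act T (em e ` {1 - r e<..<1}) (line e {1 - r e<..<1} (a e) (b e))
        (restr T (eI e) (em e ` {1 - r e<..<1}) (s e))"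
    and f: "\<And>v. v \<in> verts G \<Longrightarrow> f v = (\<Sum>e\<in>out_arcs G v. a e + b e) - (\<Sum>e\<in>in_arcs G v. a e)"
  shows "torsor_iso X (Harm G) T (lift f)"
proof -
  let ?H = "Harm G" and ?I = "\<lambda>e. em e ` {0<..<1::real}"
  note gp = group_presheaf_Harm
  define dv where "dv U u v = torsor_diff ?H T (U \<inter> N v) (restr T U (U \<inter> N v) u) (restr T (N v) (U \<inter> N v) (t v))" for U u v
  define de where "de U u e = torsor_diff ?H T (U \<inter> ?I e) (restr T U (U \<inter> ?I e) u) (restr T (?I e) (U \<inter> ?I e) (s e))" for U u e
  \<comment> \<open>The subtracted function is linear on \<open>e\<close>, is \<open>0\<close> at
    the tail and \<open>a e + b e\<close> at the head. The discrepancy \<open>a e + b e * x\<close>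
    has the same value at \<open>x = 1\<close>, so \<open>j U u\<close> along the edge fits with
    \<open>dv U u v\<close> at both ends.\<close>
  define j where "j U u p = (if p \<in> U then (case p of Inl v \<Rightarrow> dv U u v p |
      Inr (e, x) \<Rightarrow> de U u e p - of_int (a e + b e) * x) else 0)" for U u p
  have oI: "openin X (?I e)" if "e \<in> arcs G" for e using open_interval_in_X[OF that] by simp
  have dvH: "dv U u v \<in> sections ?H (U \<inter> N v)"
    if "openin X U" "u \<in> sections T U" "v \<in> verts G" for U u v
    unfolding dv_def using N[OF that(3)] that
    by (intro torsor_diff_in(1)[OF T] torsor_restr_in[OF T]) auto
  have deH: "de U u e \<in> sections ?H (U \<inter> ?I e)"
    if "openin X U" "u \<in> sections T U" "e \<in> arcs G" for U u e
    unfolding de_def using oI[OF that(3)] s[OF that(3)] that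
    by (intro torsor_diff_in(1)[OF T] torsor_restr_in[OF T]) auto
  \<comment> \<open>The value of a difference at \<open>p\<close> can be computed on any open set
    around \<open>p\<close> inside both domains. This lets differences from \<open>t v\<close> and
    from \<open>s e\<close> be compared on small intervals.\<close>
  have diff_at: "torsor_diff ?H T (U \<inter> N) (restr T U (U \<inter> N) u) (restr T N (U \<inter> N) w) p =
      torsor_diff ?H T W (restr T U W u) (restr T N W w) p"
    if "openin X U" "openin X N" "openin X W" "W \<subseteq> U" "W \<subseteq> N" "u \<in> sections T U" "w \<in> sections T N" "p \<in> W"
    for U N W u w p
  proof -
    have o: "openin X (U \<inter> N)" using that by blast
    have WUN: "W \<subseteq> U \<inter> N" using that by blast
    note i = torsor_restr_in[OF T that(1) o Int_lower1 that(6)] torsor_restr_in[OF T that(2) o Int_lower2 that(7)]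
    show ?thesis
      using torsor_diff_restr[OF gp T o that(3) WUN i(2,1)] that(8)
        torsor_restr_restr[OF T that(1) o that(3) WUN Int_lower1 that(6)]
        torsor_restr_restr[OF T that(2) o that(3) WUN Int_lower2 that(7)]
      by (simp add: restr_Harm)
  qed
  have near0: "j U u (em e y) = dv U u (tail G e) (em e y) - of_int (a e + b e) * y"
    if U: "openin X U" and u: "u \<in> sections T U" and e: "e \<in> arcs G" and y: "0 \<le> y" "y < r e" "em e y \<in> U"
    for U u e y
  proof (cases "y = 0")
    case True
    then show ?thesis using y by (simp add: j_def em_ends)
  next
    case False
    have v: "tail G e \<in> verts G" using e by simp
    have y01: "0 < y" "y < 1" using False y r[OF e] by auto
    let ?S = "em e ` {0<..<r e}" let ?W = "U \<inter> ?S"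
    have oS: "openin X ?S" using r[OF e] by (intro open_interval_in_X[OF e]) auto
    have o: "openin X ?W" using U oS by blast
    have SI: "?S \<subseteq> ?I e" using r[OF e] by auto
    have p: "em e y \<in> ?W" using y y01 by auto
    have oN: "openin X (N (tail G e))" and tN: "t (tail G e) \<in> sections T (N (tail G e))" using N[OF v] by auto
    have WN: "?W \<subseteq> N (tail G e)" "?W \<subseteq> ?I e" using sub(1)[OF e] SI by blast+
    have "restr T (?I e) ?W (s e) = restr T ?S ?W (restr T (?I e) ?S (s e))"
      using torsor_restr_restr[OF T oI[OF e] oS o Int_lower2 SI s[OF e]] by simp
    also have "\<dots> = restr T (N (tail G e)) ?W (t (tail G e))"
      unfolding tail[OF e] by (rule torsor_restr_restr[OF T oN oS o Int_lower2 sub(1)[OF e] tN])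
    finally have "de U u e (em e y) = dv U u (tail G e) (em e y)"
      unfolding de_def dv_def
      using diff_at[OF U oI[OF e] o Int_lower1 WN(2) u s[OF e] p] diff_at[OF U oN o Int_lower1 WN(1) u tN p]
      by simp
    then show ?thesis using y y01 by (simp add: j_def em_interior)
  qed
  \<comment> \<open>Near the head, passing from the difference with \<open>t (head G e)\<close> to
    that with \<open>s e\<close> adds \<open>a e + b e * y\<close>. After the linear correction
    \<open>a e - a e * y\<close> is left, which is \<open>0\<close> at \<open>y = 1\<close>.\<close>
  have near1: "j U u (em e y) = dv U u (head G e) (em e y) + of_int (a e) - of_int (a e) * y"
    if U: "openin X U" and u: "u \<in> sections T U" and e: "e \<in> arcs G" and y: "1 - r e < y" "y \<le> 1" "em e y \<in> U"
    for U u e y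
  proof (cases "y = 1")
    case True
    then show ?thesis using y by (simp add: j_def em_ends)
  next
    case False
    have v: "head G e \<in> verts G" using e by simp
    have y01: "0 < y" "y < 1" using False y r[OF e] by auto
    let ?S = "em e ` {1 - r e<..<1}" let ?W = "U \<inter> ?S"
    have S01: "{1 - r e<..<1} \<subseteq> {0<..<1}" using r[OF e] by auto
    have oS: "openin X ?S" using S01 by (intro open_interval_in_X[OF e]) auto
    have o: "openin X ?W" using U oS by blast
    have SI: "?S \<subseteq> ?I e" using S01 by blast
    have p: "em e y \<in> ?W" using y y01 by auto
    have oN: "openin X (N (head G e))" and tN: "t (head G e) \<in> sections T (N (head G e))" using N[OF v] by auto
    have WN: "?W \<subseteq> N (head G e)" "?W \<subseteq> ?I e" using sub(2)[OF e] SI by blast+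
    let ?l = "line e {1 - r e<..<1} (a e) (b e)" and ?l' = "restr ?H ?S ?W (line e {1 - r e<..<1} (a e) (b e))"
    have lS: "?l \<in> sections ?H ?S" using S01 by (intro line_Harm[OF e]) auto
    have lW: "?l' \<in> sections ?H ?W" by (rule group_presheaf_restr[OF gp oS o Int_lower2 lS])
    note sS = torsor_restr_in[OF T oI[OF e] oS SI s[OF e]]
    have sW: "restr T (?I e) ?W (s e) \<in> sections T ?W" by (rule torsor_restr_in[OF T oI[OF e] o WN(2) s[OF e]])
    have "restr T (N (head G e)) ?W (t (head G e)) = restr T ?S ?W (restr T (N (head G e)) ?S (t (head G e)))"
      using torsor_restr_restr[OF T oN oS o Int_lower2 sub(2)[OF e] tN] by simp
    also have "\<dots> = act T ?W ?l' (restr T (?I e) ?W (s e))"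
      unfolding head[OF e]
      using torsor_restr_act[OF T oS o Int_lower2 lS sS]
        torsor_restr_restr[OF T oI[OF e] oS o Int_lower2 SI s[OF e]] by simp
    finally have tW: "restr T (N (head G e)) ?W (t (head G e)) = act T ?W ?l' (restr T (?I e) ?W (s e))" .
    note uW = torsor_restr_in[OF T U o Int_lower1 u]
    note tW' = torsor_restr_in[OF T oN o WN(1) tN]
    define g where "g = torsor_diff ?H T ?W (restr T U ?W u) (restr T (N (head G e)) ?W (t (head G e)))"
    have g: "g \<in> sections ?H ?W" "act T ?W g (restr T (N (head G e)) ?W (t (head G e))) = restr T U ?W u"
      unfolding g_def by (rule torsor_diff_in[OF T o tW' uW])+
    then have "restr T U ?W u = act T ?W (g + ?l') (restr T (?I e) ?W (s e))"
      using torsor_act_plus[OF T o g(1) lW sW] tW by simp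
    then have "torsor_diff ?H T ?W (restr T U ?W u) (restr T (?I e) ?W (s e)) = g + ?l'"
      using torsor_diff_act[OF T o sW group_presheaf_plus[OF gp o g(1) lW]] by simp
    moreover have "?l' (em e y) = of_int (a e) + of_int (b e) * y"
      using p y y01 by (simp add: restr_Harm line_em[OF S01])
    ultimately have "de U u e (em e y) = dv U u (head G e) (em e y) + of_int (a e) + of_int (b e) * y"
      unfolding de_def dv_def
      using diff_at[OF U oI[OF e] o Int_lower1 WN(2) u s[OF e] p] diff_at[OF U oN o Int_lower1 WN(1) u tN p] g_def
      by simp
    then show ?thesis using y y01 by (simp add: j_def em_interior algebra_simps)
  qed
  have aff0: "\<exists>k. affine_near G (j U u) e 0 k (slope G (dv U u (tail G e)) e 0 - (a e + b e))"
    if U: "openin X U" and u: "u \<in> sections T U" and e: "e \<in> arcs G" and p: "Inl (tail G e) \<in> U" for U u e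
  proof -
    have v: "tail G e \<in> verts G" using e by simp
    have oW: "openin X (U \<inter> N (tail G e))" "em e 0 \<in> U \<inter> N (tail G e)" using N[OF v] U p by (auto simp: em_ends)
    have "dv U u (tail G e) \<in> sections (PL G) (U \<inter> N (tail G e))"
      using dvH[OF U u v] Harm_iff[OF oW(1)] by blast
    then obtain k where k: "affine_near G (dv U u (tail G e)) e 0 k (slope G (dv U u (tail G e)) e 0)"
      using PL_affine_slope[OF _ e _ oW(2)] by auto
    have "\<forall>\<^sub>F y in nhds (0::real). y \<in> {..<r e}" using r[OF e] by (intro eventually_nhds_in_open) auto
    with k[unfolded affine_near_def] open_eventually[OF U e, of 0]
    have "affine_near G (j U u) e 0 k (slope G (dv U u (tail G e)) e 0 - (a e + b e))"
      unfolding affine_near_def using p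
      by (simp add: em_ends) (elim eventually_rev_mp, auto simp: near0[OF U u e] algebra_simps)
    then show ?thesis by blast
  qed
  have aff1: "\<exists>k. affine_near G (j U u) e 1 k (slope G (dv U u (head G e)) e 1 - a e)"
    if U: "openin X U" and u: "u \<in> sections T U" and e: "e \<in> arcs G" and p: "Inl (head G e) \<in> U" for U u e
  proof -
    have v: "head G e \<in> verts G" using e by simp
    have oW: "openin X (U \<inter> N (head G e))" "em e 1 \<in> U \<inter> N (head G e)" using N[OF v] U p by (auto simp: em_ends)
    have "dv U u (head G e) \<in> sections (PL G) (U \<inter> N (head G e))"
      using dvH[OF U u v] Harm_iff[OF oW(1)] by blast
    then obtain k where k: "affine_near G (dv U u (head G e)) e 1 k (slope G (dv U u (head G e)) e 1)"
      using PL_affine_slope[OF _ e _ oW(2)] by auto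
    have "\<forall>\<^sub>F y in nhds (1::real). y \<in> {1 - r e<..}" using r[OF e] by (intro eventually_nhds_in_open) auto
    with k[unfolded affine_near_def] open_eventually[OF U e, of 1]
    have "affine_near G (j U u) e 1 (k + a e) (slope G (dv U u (head G e)) e 1 - a e)"
      unfolding affine_near_def using p
      by (simp add: em_ends) (elim eventually_rev_mp, auto simp: near1[OF U u e] algebra_simps)
    then show ?thesis by blast
  qed
  have affi: "\<exists>k l. affine_near G (j U u) e x k l"
    if U: "openin X U" and u: "u \<in> sections T U" and e: "e \<in> arcs G" and x: "0 < x" "x < 1" "em e x \<in> U" for U u e x
  proof -
    have oW: "openin X (U \<inter> ?I e)" "em e x \<in> U \<inter> ?I e" using oI[OF e] U x by auto
    have PL: "de U u e \<in> sections (PL G) (U \<inter> ?I e)" using deH[OF U u e] Harm_iff[OF oW(1)] by blast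
    have x01: "x \<in> {0..1}" using x by simp
    obtain k l where kl: "affine_near G (de U u e) e x k l"
      using PL_affine[OF PL e x01 oW(2)] by blast
    have "\<forall>\<^sub>F y in nhds x. y \<in> {0<..<1}" using x by (intro eventually_nhds_in_open) auto
    with kl[unfolded affine_near_def] open_eventually[OF U e _ x(3)]
    have "affine_near G (j U u) e x k (l - (a e + b e))"
      unfolding affine_near_def using x
      by simp (elim eventually_rev_mp, auto simp: j_def em_interior algebra_simps)
    then show ?thesis by blast
  qed
  have jL: "j U u \<in> sections (lift f) U" if U: "openin X U" and u: "u \<in> sections T U" for U u
    unfolding lift_iff[OF U] PL_iff[OF U]
  proof (intro conjI allI ballI impI)
    fix e x assume e: "e \<in> arcs G" and x: "x \<in> {0..1}" "em e x \<in> U"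
    then consider "x = 0" | "x = 1" | "0 < x" "x < 1" by fastforce
    then show "\<exists>k l. affine_near G (j U u) e x k l"
      using aff0[OF U u e] aff1[OF U u e] affi[OF U u e] x by cases (auto simp: em_ends)
  next
    fix v assume v: "Inl v \<in> U"
    note vG = Inl_in_verts[OF U v]
    have oW: "openin X (U \<inter> N v)" "Inl v \<in> U \<inter> N v" using N[OF vG] U v by auto
    have "slope G (j U u) e 1 = slope G (dv U u v) e 1 - a e" if "e \<in> in_arcs G v" for e
      using aff1[OF U u, of e] v that slope_eq[of "j U u" e 1] by (auto simp: in_arcs_def)
    moreover have "slope G (j U u) e 0 = slope G (dv U u v) e 0 - (a e + b e)" if "e \<in> out_arcs G v" for e
      using aff0[OF U u, of e] v that slope_eq[of "j U u" e 0] by (auto simp: out_arcs_def)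
    \<comment> \<open>Since \<open>dv U u v\<close> is harmonic, only the changes of slope count:
      \<open>- a e\<close> at a head and \<open>- (a e + b e)\<close> at a tail, the latter entering
      with a minus sign. Their sum is the prescribed \<open>f v\<close>.\<close>
    ultimately have "vdiff (j U u) v = vdiff (dv U u v) v + f v"
      using f[OF vG] by (simp add: vdiff_def sum_subtractf)
    moreover have "vdiff (dv U u v) v = 0" using dvH[OF U u vG] oW by (simp add: Harm_iff)
    ultimately show "vdiff (j U u) v = f v" by simp
  qed (simp add: j_def)
  have jr: "j V (restr T U V u) = restr (lift f) U V (j U u)"
    if U: "openin X U" and V: "openin X V" "V \<subseteq> U" and u: "u \<in> sections T U" for U V u
  proof
    fix p
    show "j V (restr T U V u) p = restr (lift f) U V (j U u) p"
    proof (cases "p \<in> V")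
      case True
      have *: "torsor_diff ?H T (V \<inter> M) (restr T V (V \<inter> M) (restr T U V u)) (restr T M (V \<inter> M) w) p =
          torsor_diff ?H T (U \<inter> M) (restr T U (U \<inter> M) u) (restr T M (U \<inter> M) w) p"
        if M: "openin X M" "w \<in> sections T M" "p \<in> M" for M w
      proof -
        have o: "openin X (V \<inter> M)" using V M by blast
        have VMU: "V \<inter> M \<subseteq> U" using V by blast
        show ?thesis
          using diff_at[OF U M(1) o VMU Int_lower2 u M(2)] True M(3)
            torsor_restr_restr[OF T U V(1) o Int_lower1 V(2) u] by simp
      qed
      show ?thesis
      proof (cases p)
        case (Inl v)
        then have "v \<in> verts G" using Inl_in_verts[OF V(1)] True by blast
        then show ?thesis using Inl *[of "N v" "t v"] N True V(2)
          by (auto simp: j_def dv_def restr_lift)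
      next
        case (Inr q)
        then obtain e x where q: "p = Inr (e, x)" by (cases q) auto
        then have e: "e \<in> arcs G" "0 < x" "x < 1" using Inr_in_points open_sub[OF V(1)] True by auto
        then have "p \<in> ?I e" using q em_interior[of x e] by force
        then show ?thesis using q *[OF oI[OF e(1)] s[OF e(1)]] True V(2)
          by (auto simp: j_def de_def restr_lift)
      qed
    qed (simp add: j_def restr_lift)
  qed
  have ja: "j U (act T U g u) = g + j U u"
    if U: "openin X U" and g: "g \<in> sections ?H U" and u: "u \<in> sections T U" for U g u
  proof
    fix p
    show "j U (act T U g u) p = (g + j U u) p"
    proof (cases "p \<in> U")
      case True
      have *: "torsor_diff ?H T (U \<inter> M) (restr T U (U \<inter> M) (act T U g u)) (restr T M (U \<inter> M) w) p =
          g p + torsor_diff ?H T (U \<inter> M) (restr T U (U \<inter> M) u) (restr T M (U \<inter> M) w) p"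
        if M: "openin X M" "w \<in> sections T M" "p \<in> M" for M w
      proof -
        have o: "openin X (U \<inter> M)" using U M by blast
        note i = torsor_restr_in[OF T U o Int_lower1 u] torsor_restr_in[OF T M(1) o Int_lower2 M(2)]
        note d = torsor_diff_in[OF T o i(2,1)]
        note gr = group_presheaf_restr[OF gp U o Int_lower1 g]
        have "restr T U (U \<inter> M) (act T U g u) = act T (U \<inter> M)
            (restr ?H U (U \<inter> M) g + torsor_diff ?H T (U \<inter> M) (restr T U (U \<inter> M) u) (restr T M (U \<inter> M) w))
            (restr T M (U \<inter> M) w)"
          using torsor_restr_act[OF T U o Int_lower1 g u] torsor_act_plus[OF T o gr d(1) i(2)] d(2) by simp
        then show ?thesis
          using torsor_diff_act[OF T o i(2) group_presheaf_plus[OF gp o gr d(1)]] True M(3)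
          by (simp add: restr_Harm)
      qed
      show ?thesis
      proof (cases p)
        case (Inl v)
        then have "v \<in> verts G" using Inl_in_verts[OF U] True by blast
        then show ?thesis using Inl *[of "N v" "t v"] N True by (auto simp: j_def dv_def)
      next
        case (Inr q)
        then obtain e x where q: "p = Inr (e, x)" by (cases q) auto
        then have e: "e \<in> arcs G" "0 < x" "x < 1" using Inr_in_points open_sub[OF U] True by auto
        then have "p \<in> ?I e" using q em_interior[of x e] by force
        then show ?thesis using q *[OF oI[OF e(1)] s[OF e(1)]] True by (auto simp: j_def de_def)
      qed
    next
      case False
      have "g p = 0" using g False U PL_zero[of g U p] by (simp add: Harm_iff)
      then show ?thesis using False by (simp add: j_def)
    qed
  qed
  have "morphism X ?H T (lift f) j"
    unfolding equivariant_def using jL jr ja by (auto simp: act_lift)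
  then show ?thesis using torsor_iso_iff[OF gp T is_torsor_lift] by blast
qed

end

lemma torsor_copy_proj:
  "morphism X F (torsor_copy T) T (\<lambda>U t. t undefined)"
  unfolding equivariant_def by (auto simp: torsor_copy_def)

context lf_graph
begin

text \<open>All data that \<open>torsor_iso_lift\<close> requires on one edge, where
  \<open>M\<close>, \<open>t\<close> belong to the tail and \<open>N\<close>, \<open>u\<close> to
  the head. Bundling them allows a separate choice for each edge.\<close>

definition edge_sections ::
  "(('v, 'e) point, ('v, 'e) point \<Rightarrow> real, 't) torsor \<Rightarrow> ('v, 'e) point set \<Rightarrow> 't \<Rightarrow>
   ('v, 'e) point set \<Rightarrow> 't \<Rightarrow> 'e \<Rightarrow> 't \<Rightarrow> real \<Rightarrow> int \<Rightarrow> int \<Rightarrow> bool" where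
  "edge_sections T M t N u e s r a b \<longleftrightarrow> s \<in> sections T (eI e) \<and> 0 < r \<and> r \<le> 1/2 \<and>
    em e ` {0<..<r} \<subseteq> M \<and> em e ` {1 - r<..<1} \<subseteq> N \<and>
    restr T (eI e) (em e ` {0<..<r}) s = restr T M (em e ` {0<..<r}) t \<and>
    restr T N (em e ` {1 - r<..<1}) u = act T (em e ` {1 - r<..<1}) (line e {1 - r<..<1} a b)
        (restr T (eI e) (em e ` {1 - r<..<1}) s)"

lemma edge_sections_exist:
  assumes T: "is_torsor X (Harm G) T" and e: "e \<in> arcs G"
    and M: "openin X M" "Inl (tail G e) \<in> M" "t \<in> sections T M"
    and N: "openin X N" "Inl (head G e) \<in> N" "u \<in> sections T N"
  shows "\<exists>s r a b. edge_sections T M t N u e s r a b"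
proof -
  let ?I = "em e ` {0<..<1::real}"
  have "\<forall>\<^sub>F y in nhds 0. y \<in> {0..1} \<longrightarrow> em e y \<in> M" "\<forall>\<^sub>F y in nhds 1. y \<in> {0..1} \<longrightarrow> em e y \<in> N"
    using open_eventually[OF M(1) e, of 0] open_eventually[OF N(1) e, of 1] M(2) N(2) by (auto simp: em_ends)
  then obtain r1 r2 where r12: "r1 > 0" "\<And>y. dist y 0 < r1 \<Longrightarrow> y \<in> {0..1} \<Longrightarrow> em e y \<in> M"
    "r2 > 0" "\<And>y. dist y 1 < r2 \<Longrightarrow> y \<in> {0..1} \<Longrightarrow> em e y \<in> N"
    unfolding eventually_nhds_metric by blast
  \<comment> \<open>The bound \<open>1/2\<close> keeps the intervals at the two ends disjoint;
    \<open>r1\<close> and \<open>r2\<close> keep them inside \<open>M\<close> and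
    \<open>N\<close>.\<close>
  define r where "r = min (1/2) (min r1 r2)"
  have r: "0 < r" "r \<le> 1/2" "r \<le> r1" "r \<le> r2" using r12 by (auto simp: r_def)
  let ?A = "{0<..<r}" and ?B = "{1 - r<..<1}"
  have AB: "open ?A" "?A \<subseteq> {0<..<1}" "open ?B" "?B \<subseteq> {0<..<1}" using r by auto
  note oA = open_interval_in_X[OF e AB(1,2)] and oB = open_interval_in_X[OF e AB(3,4)]
  have oI: "openin X ?I" using open_interval_in_X[OF e, of "{0<..<1}"] by simp
  have AM: "em e ` ?A \<subseteq> M" and BN: "em e ` ?B \<subseteq> N"
    using r r12(2,4) by (auto simp: dist_real_def)
  have BI: "em e ` ?B \<subseteq> ?I" using AB(4) by blast
  obtain s0 where s0: "s0 \<in> sections T ?I" using section_on_edge[OF T e] by blast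
  have A: "?A \<inter> {0<..<1} = ?A" using AB(2) by blast
  have "connected (?A \<inter> {0<..<1})" unfolding A by simp
  from extend_section[OF T e AB(1,2) _ _ this torsor_restr_in[OF T M(1) oA AM M(3)] s0, unfolded A]
  obtain k l where kl: "restr T (em e ` ?A) (em e ` ?A) (restr T M (em e ` ?A) t) =
      restr T ?I (em e ` ?A) (act T ?I (line e {0<..<1} k l) s0)" by auto
  \<comment> \<open>An affine function on the initial interval extends to the whole edge, so the
    section can be corrected to agree with \<open>t\<close> near the tail. The discrepancy at the
    head is then whatever comes out.\<close>
  define s where "s = act T ?I (line e {0<..<1} k l) s0"
  have s: "s \<in> sections T ?I" unfolding s_def
    by (rule torsor_act_in[OF T oI line_Harm[OF e] s0]) auto
  have tail: "restr T ?I (em e ` ?A) s = restr T M (em e ` ?A) t"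
    using kl sheaf_restr_id[OF torsor_sheaf[OF T] oA torsor_restr_in[OF T M(1) oA AM M(3)]]
    by (simp add: s_def)
  obtain h where h: "h \<in> sections (Harm G) (em e ` ?B)"
      "restr T N (em e ` ?B) u = act T (em e ` ?B) h (restr T ?I (em e ` ?B) s)"
    using torsor_transitive[OF T oB torsor_restr_in[OF T oI oB BI s] torsor_restr_in[OF T N(1) oB BN N(3)]]
    by blast
  obtain a b where "h = line e ?B a b" using Harm_line[OF e AB(3,4) _ h(1)] by auto
  then show ?thesis unfolding edge_sections_def using s r tail h(2) AM BN by blast
qed

text \<open>Sections near the vertices are chosen before those on the edges, since the latter have
  to match them at the tails. The discrepancies at the heads then determine
  \<open>f\<close>.\<close>

lemma Pic_carrier: "carrier (Pic G) = delta G ` carrier (Z_pow (verts G))"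
proof (intro equalityI subsetI)
  fix c assume "c \<in> carrier (Pic G)"
  then obtain T :: "(('v, 'e) point, ('v, 'e) point \<Rightarrow> real, ('v, 'e) point \<Rightarrow> ('v, 'e) point \<Rightarrow> real) torsor"
    where T: "is_torsor X (Harm G) T" and c: "c = torsor_class X (Harm G) T"
    by (auto simp: Pic_def H1_def)
  have "\<forall>v\<in>verts G. \<exists>q. openin X (fst q) \<and> Inl v \<in> fst q \<and> snd q \<in> sections T (fst q)"
  proof
    fix v assume "v \<in> verts G"
    then have "Inl v \<in> topspace X" by (simp add: topspace_X Inl_in_points)
    from torsor_locally_nonempty[OF T this] obtain U u where
      "openin X U" "Inl v \<in> U" "u \<in> sections T U" by blast
    then show "\<exists>q. openin X (fst q) \<and> Inl v \<in> fst q \<and> snd q \<in> sections T (fst q)"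
      by (intro exI[of _ "(U, u)"]) simp
  qed
  from bchoice[OF this] obtain q where
    q: "\<forall>v\<in>verts G. openin X (fst (q v)) \<and> Inl v \<in> fst (q v) \<and> snd (q v) \<in> sections T (fst (q v))" ..
  define N t where "N v = fst (q v)" and "t v = snd (q v)" for v
  have N: "openin X (N v) \<and> Inl v \<in> N v \<and> t v \<in> sections T (N v)" if "v \<in> verts G" for v
    using q that by (simp add: N_def t_def)
  let ?Q = "\<lambda>e. edge_sections T (N (tail G e)) (t (tail G e)) (N (head G e)) (t (head G e)) e"
  have "\<forall>e\<in>arcs G. \<exists>s r a b. ?Q e s r a b"
    by (intro ballI edge_sections_exist[OF T]) (use N in auto)
  from bchoice[OF this] obtain s where "\<forall>e\<in>arcs G. \<exists>r a b. ?Q e (s e) r a b" ..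
  from bchoice[OF this] obtain r where "\<forall>e\<in>arcs G. \<exists>a b. ?Q e (s e) (r e) a b" ..
  from bchoice[OF this] obtain a where "\<forall>e\<in>arcs G. \<exists>b. ?Q e (s e) (r e) (a e) b" ..
  from bchoice[OF this] obtain b where Q: "\<forall>e\<in>arcs G. ?Q e (s e) (r e) (a e) (b e)" ..
  define f where "f v = (if v \<in> verts G then (\<Sum>e\<in>out_arcs G v. a e + b e) - (\<Sum>e\<in>in_arcs G v. a e) else 0)" for v
  have "torsor_iso X (Harm G) T (lift f)"
    by (rule torsor_iso_lift[OF T N, of s r a b f]) (use Q in \<open>simp_all add: edge_sections_def f_def\<close>)
  then have "c = delta G f"
    unfolding c delta_eq by (rule torsor_class_eqI[OF group_presheaf_Harm T is_torsor_lift])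
  moreover have "f \<in> carrier (Z_pow (verts G))" by (simp add: Z_pow_def f_def)
  ultimately show "c \<in> delta G ` carrier (Z_pow (verts G))" by blast
qed (use delta_in_Pic in blast)

section \<open>The torsor of a cochain\<close>

abbreviation "ZZ \<equiv> constant_sheaf_Z X"

lemma restr_ZZ: "restr ZZ U V f = (\<lambda>p. if p \<in> V then f p else 0)"
  by (simp add: constant_sheaf_Z_def)

lemma ZZ_iff:
  assumes U: "openin X U"
  shows "f \<in> sections ZZ U \<longleftrightarrow> (\<forall>p. p \<notin> U \<longrightarrow> f p = 0) \<and>
    (\<forall>e\<in>arcs G. \<forall>x\<in>{0..1}. em e x \<in> U \<longrightarrow> (\<forall>\<^sub>F y in nhds x. y \<in> {0..1} \<longrightarrow> f (em e y) = f (em e x)))"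
proof -
  have "continuous_map (subtopology X U) (discrete_topology UNIV) f \<longleftrightarrow>
    (\<forall>e\<in>arcs G. \<forall>x\<in>{0..1}. em e x \<in> U \<longrightarrow> (\<forall>\<^sub>F y in nhds x. y \<in> {0..1} \<longrightarrow> f (em e y) = f (em e x)))"
    (is "?L \<longleftrightarrow> ?R")
  proof
    assume L: ?L
    show ?R
    proof (intro ballI impI)
      fix e x assume "e \<in> arcs G" "x \<in> {0..1}" "em e x \<in> U"
      then have "\<forall>\<^sub>F y in nhds x. y \<in> {0..1} \<longrightarrow> f (em e y) \<in> {f (em e x)}"
        using L[unfolded continuous_map_X[OF U], THEN conjunct2, rule_format, of "{f (em e x)}" e x] by simp
      then show "\<forall>\<^sub>F y in nhds x. y \<in> {0..1} \<longrightarrow> f (em e y) = f (em e x)" by simp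
    qed
  next
    assume R: ?R
    show ?L unfolding continuous_map_X[OF U]
    proof (intro conjI allI impI ballI, simp, elim conjE)
      fix V e x assume a: "e \<in> arcs G" "x \<in> {0..1}" "em e x \<in> U" "f (em e x) \<in> V"
      then have "\<forall>\<^sub>F y in nhds x. y \<in> {0..1} \<longrightarrow> f (em e y) = f (em e x)" using R by blast
      then show "\<forall>\<^sub>F y in nhds x. y \<in> {0..1} \<longrightarrow> f (em e y) \<in> V" by eventually_elim (use a in auto)
    qed
  qed
  then show ?thesis by (auto simp: constant_sheaf_Z_def)
qed

definition const_on :: "('v, 'e) point set \<Rightarrow> int \<Rightarrow> ('v, 'e) point \<Rightarrow> int" where
  "const_on U n = (\<lambda>p. if p \<in> U then n else 0)"

lemma const_on_in: assumes U: "openin X U" shows "const_on U n \<in> sections ZZ U"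
  unfolding ZZ_iff[OF U]
proof (intro conjI ballI impI)
  fix e x assume "e \<in> arcs G" "x \<in> {0..1}" "em e x \<in> U"
  from open_eventually[OF U this] this(3)
  show "\<forall>\<^sub>F y in nhds x. y \<in> {0..1} \<longrightarrow> const_on U n (em e y) = const_on U n (em e x)"
    by (auto elim: eventually_mono simp: const_on_def)
qed (simp add: const_on_def)

lemma const_on_add: "const_on U m + const_on U n = const_on U (m + n)"
  by (auto simp: const_on_def)

lemma restr_const_on: "V \<subseteq> U \<Longrightarrow> restr ZZ U V (const_on U n) = const_on V n"
  by (auto simp: restr_ZZ const_on_def fun_eq_iff)

lemma half_sub:
  assumes "e \<in> arcs G"
  shows "eJ e \<subseteq> half_star G (tail G e)" "eK e \<subseteq> half_star G (head G e)"
    "eJ e \<subseteq> eI e" "eK e \<subseteq> eI e"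
    "openin X (eJ e)" "openin X (eK e)" "openin X (eI e)"
proof -
  show "eJ e \<subseteq> half_star G (tail G e)" "eK e \<subseteq> half_star G (head G e)"
    using assms by (auto simp: em_in_half_star)
qed (use assms in \<open>auto intro!: open_interval_in_X image_mono\<close>)

definition cochain_sections ::
  "(('v, 'e) point, ('v, 'e) point \<Rightarrow> int, 't) torsor \<Rightarrow> ('e \<Rightarrow> int) \<Rightarrow> ('v \<Rightarrow> 't) \<Rightarrow> ('e \<Rightarrow> 't) \<Rightarrow> bool" where
  "cochain_sections T \<omega> t s \<longleftrightarrow> (\<forall>v\<in>verts G. t v \<in> sections T (half_star G v)) \<and>
     (\<forall>e\<in>arcs G. s e \<in> sections T (eI e) \<and>
       restr T (eI e) (eJ e) (s e) = restr T (half_star G (tail G e)) (eJ e) (t (tail G e)) \<and>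
       restr T (half_star G (head G e)) (eK e) (t (head G e)) =
         act T (eK e) (const_on (eK e) (\<omega> e)) (restr T (eI e) (eK e) (s e)))"

lemma cochain_class_iff:
  "T \<in> cochain_class G \<omega> \<longleftrightarrow> is_torsor X ZZ T \<and> (\<exists>t s. cochain_sections T \<omega> t s)"
  unfolding cochain_class_def cochain_sections_def Let_def const_on_def by simp

lemma cochain_sectionsD:
  assumes "cochain_sections T \<omega> t s"
  shows "v \<in> verts G \<Longrightarrow> t v \<in> sections T (half_star G v)"
    "e \<in> arcs G \<Longrightarrow> s e \<in> sections T (eI e)"
    "e \<in> arcs G \<Longrightarrow> restr T (eI e) (eJ e) (s e) = restr T (half_star G (tail G e)) (eJ e) (t (tail G e))"
    "e \<in> arcs G \<Longrightarrow> restr T (half_star G (head G e)) (eK e) (t (head G e)) =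
       act T (eK e) (const_on (eK e) (\<omega> e)) (restr T (eI e) (eK e) (s e))"
  using assms unfolding cochain_sections_def by auto

text \<open>Moving \<open>t v\<close> by \<open>\<phi> v\<close>, and \<open>s e\<close> by the
  value of \<open>\<phi>\<close> at the tail of \<open>e\<close>, preserves the match near the tail
  and adds \<open>\<phi> (head G e) - \<phi> (tail G e)\<close> to the comparison near the
  head.\<close>

lemma cochain_class_coboundary_le:
  "cochain_class G \<omega> \<subseteq> cochain_class G (coboundary G \<phi> + \<omega>)"
proof
  fix T assume "T \<in> cochain_class G \<omega>"
  then obtain t s where T: "is_torsor X ZZ T" and ts: "cochain_sections T \<omega> t s"
    unfolding cochain_class_iff by blast
  note t = cochain_sectionsD(1)[OF ts] and s = cochain_sectionsD(2)[OF ts]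
    and J = cochain_sectionsD(3)[OF ts] and K = cochain_sectionsD(4)[OF ts]
  define t' where "t' v = act T (half_star G v) (const_on (half_star G v) (\<phi> v)) (t v)" for v
  define s' where "s' e = act T (eI e) (const_on (eI e) (\<phi> (tail G e))) (s e)" for e
  have "t' v \<in> sections T (half_star G v)" if "v \<in> verts G" for v
    unfolding t'_def using open_half_star[OF that] t[OF that]
    by (intro torsor_act_in[OF T] const_on_in)
  moreover have "s' e \<in> sections T (eI e) \<and>
          restr T (eI e) (eJ e) (s' e) =
            restr T (half_star G (tail G e)) (eJ e) (t' (tail G e)) \<and>
          restr T (half_star G (head G e)) (eK e) (t' (head G e)) =
            act T (eK e) (const_on (eK e) ((coboundary G \<phi> + \<omega>) e))
              (restr T (eI e) (eK e) (s' e))" if e: "e \<in> arcs G" for e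
  proof -
    let ?I = "em e ` {0<..<1::real}" and ?J = "em e ` {0<..<1/2::real}" and ?K = "em e ` {1/2<..<1::real}"
    let ?v = "tail G e" and ?w = "head G e"
    note h = half_sub[OF e]
    have v: "?v \<in> verts G" "?w \<in> verts G" using e by auto
    note ov = open_half_star[OF v(1)] and ow = open_half_star[OF v(2)]
    have "restr T ?I ?J (s' e) = act T ?J (const_on ?J (\<phi> ?v)) (restr T ?I ?J (s e))"
      unfolding s'_def using torsor_restr_act[OF T h(7,5,3) const_on_in[OF h(7)] s[OF e]] restr_const_on[OF h(3)] by simp
    moreover have "restr T (half_star G ?v) ?J (t' ?v) = act T ?J (const_on ?J (\<phi> ?v)) (restr T (half_star G ?v) ?J (t ?v))"
      unfolding t'_def using torsor_restr_act[OF T ov h(5,1) const_on_in[OF ov] t[OF v(1)]] restr_const_on[OF h(1)] by simp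
    moreover have "restr T ?I ?K (s' e) = act T ?K (const_on ?K (\<phi> ?v)) (restr T ?I ?K (s e))"
      unfolding s'_def using torsor_restr_act[OF T h(7,6,4) const_on_in[OF h(7)] s[OF e]] restr_const_on[OF h(4)] by simp
    moreover have "restr T (half_star G ?w) ?K (t' ?w) = act T ?K (const_on ?K (\<phi> ?w)) (restr T (half_star G ?w) ?K (t ?w))"
      unfolding t'_def using torsor_restr_act[OF T ow h(6,2) const_on_in[OF ow] t[OF v(2)]] restr_const_on[OF h(2)] by simp
    moreover have "act T ?K (const_on ?K m) (act T ?K (const_on ?K n) (restr T ?I ?K (s e))) =
        act T ?K (const_on ?K (m + n)) (restr T ?I ?K (s e))" for m n
      using torsor_act_plus[OF T h(6) const_on_in[OF h(6)] const_on_in[OF h(6)] torsor_restr_in[OF T h(7,6,4) s[OF e]]]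
      by (simp add: const_on_add)
    moreover have "s' e \<in> sections T ?I"
      unfolding s'_def by (rule torsor_act_in[OF T h(7) const_on_in[OF h(7)] s[OF e]])
    ultimately show ?thesis using J[OF e] K[OF e] e by (simp add: coboundary_def)
  qed
  ultimately have "cochain_sections T (coboundary G \<phi> + \<omega>) t' s'" unfolding cochain_sections_def by blast
  then show "T \<in> cochain_class G (coboundary G \<phi> + \<omega>)" unfolding cochain_class_iff using T by blast
qed

lemma cochain_class_coboundary: "cochain_class G (coboundary G \<phi> + \<omega>) = cochain_class G \<omega>"
proof -
  have "coboundary G (- \<phi>) + (coboundary G \<phi> + \<omega>) = \<omega>" by (auto simp: coboundary_def)
  from cochain_class_coboundary_le[of "coboundary G \<phi> + \<omega>" "- \<phi>", unfolded this]
  show ?thesis using cochain_class_coboundary_le[of \<omega> \<phi>] by (rule equalityI)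
qed

text \<open>The sections of \<open>jump_torsor \<omega>\<close> are the integer functions that are locally constant except for a jump by \<open>- \<omega> e\<close>
  just after the midpoint of \<open>e\<close>.\<close>

definition jump :: "('e \<Rightarrow> int) \<Rightarrow> 'e \<Rightarrow> real \<Rightarrow> int" where
  "jump \<omega> e y = (if y > 1/2 then \<omega> e else 0)"

abbreviation "jump_at \<omega> f e x \<equiv>
  \<forall>\<^sub>F y in nhds x. y \<in> {0..1} \<longrightarrow> f (em e y) + jump \<omega> e y = f (em e x) + jump \<omega> e x"

definition jump_torsor ::
  "('e \<Rightarrow> int) \<Rightarrow> (('v, 'e) point, ('v, 'e) point \<Rightarrow> int, ('v, 'e) point \<Rightarrow> int) torsor" where
  "jump_torsor \<omega> =
    \<lparr>sections = \<lambda>U. {f. (\<forall>p. p \<notin> U \<longrightarrow> f p = 0) \<and> (\<forall>e\<in>arcs G. \<forall>x\<in>{0..1}. em e x \<in> U \<longrightarrow>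
       jump_at \<omega> f e x)},
     restr = \<lambda>U V f p. if p \<in> V then f p else 0, act = \<lambda>U g t. g + t\<rparr>"

lemma jump_eventually: "x \<noteq> 1/2 \<Longrightarrow> \<forall>\<^sub>F y in nhds x. jump \<omega> e y = jump \<omega> e x"
proof -
  assume "x \<noteq> 1/2"
  then consider "x \<in> {..<1/2}" | "x \<in> {1/2<..}" by fastforce
  then show ?thesis
  proof cases
    case 1
    have "\<forall>\<^sub>F y in nhds x. y \<in> {..<1/2}" using 1 by (intro eventually_nhds_in_open) auto
    then show ?thesis by eventually_elim (use 1 in \<open>auto simp: jump_def\<close>)
  next
    case 2
    have "\<forall>\<^sub>F y in nhds x. y \<in> {1/2<..}" using 2 by (intro eventually_nhds_in_open) auto
    then show ?thesis by eventually_elim (use 2 in \<open>auto simp: jump_def\<close>)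
  qed
qed

lemma zero_jump_torsor:
  assumes v: "v \<in> verts G"
  shows "0 \<in> sections (jump_torsor \<omega>) (half_star G v)"
proof -
  have "\<forall>\<^sub>F y in nhds x. y \<in> {0..1} \<longrightarrow> jump \<omega> e y = jump \<omega> e x"
    if "e \<in> arcs G" "x \<in> {0..1}" "em e x \<in> half_star G v" for e x
  proof -
    have "x \<noteq> 1/2" using that em_in_half_star by auto
    from jump_eventually[OF this] show ?thesis by eventually_elim auto
  qed
  then show ?thesis by (simp add: jump_torsor_def)
qed

text \<open>The section over an open edge normalized to be \<open>0\<close> on the first half. It
  matches the zero section near the tail and falls short of it by \<open>\<omega> e\<close> near the
  head.\<close>

definition edge_jump :: "('e \<Rightarrow> int) \<Rightarrow> 'e \<Rightarrow> ('v, 'e) point \<Rightarrow> int" where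
  "edge_jump \<omega> e p = (if p \<in> eK e then - \<omega> e else 0)"

lemma edge_jump_in:
  assumes e: "e \<in> arcs G"
  shows "edge_jump \<omega> e \<in> sections (jump_torsor \<omega>) (eI e)"
proof -
  have K: "em d y \<in> eK e \<longleftrightarrow> d = e \<and> y \<in> {1/2<..<1}" for d y
    by (rule em_in_image) auto
  have "\<forall>\<^sub>F y in nhds x. y \<in> {0..1} \<longrightarrow>
      edge_jump \<omega> e (em d y) + jump \<omega> d y = edge_jump \<omega> e (em d x) + jump \<omega> d x"
    if "em d x \<in> eI e" for d x
  proof -
    have d: "d = e" "x \<in> {0<..<1}" using that em_in_image[of "{0<..<1}" d x e] by auto
    have "\<forall>\<^sub>F y in nhds x. y \<in> {0<..<1}" using d by (intro eventually_nhds_in_open) auto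
    \<comment> \<open>The jump and its compensation cancel on the whole open edge; at the midpoint
      both are \<open>0\<close>.\<close>
    then show ?thesis by eventually_elim (use d in \<open>auto simp: edge_jump_def jump_def K\<close>)
  qed
  then show ?thesis using half_sub(4)[OF e] by (auto simp: jump_torsor_def edge_jump_def)
qed

lemma is_torsor_jump_torsor: "is_torsor X ZZ (jump_torsor \<omega>)"
  unfolding is_torsor_def
proof (intro conjI allI impI ballI)
  have sec: "f \<in> sections (jump_torsor \<omega>) U \<longleftrightarrow> (\<forall>p. p \<notin> U \<longrightarrow> f p = 0) \<and>
      (\<forall>e\<in>arcs G. \<forall>x\<in>{0..1}. em e x \<in> U \<longrightarrow>
       jump_at \<omega> f e x)" for f U
    by (simp add: jump_torsor_def)
  show "sheaf X (jump_torsor \<omega>)"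
  proof (rule sheaf_of_functions[where ev = "\<lambda>s. s" and loc = "\<lambda>p. p" and P = "\<lambda>p f.
      \<forall>e\<in>arcs G. \<forall>x\<in>{0..1}. em e x = p \<longrightarrow>
       jump_at \<omega> f e x"])
    show "bij (\<lambda>s. s)" using bij_id by (simp add: id_def)
    show "s \<in> sections (jump_torsor \<omega>) U \<longleftrightarrow> (\<forall>i. i \<notin> U \<longrightarrow> s i = 0) \<and>
      (\<forall>p\<in>U. \<forall>e\<in>arcs G. \<forall>x\<in>{0..1}. em e x = p \<longrightarrow>
       jump_at \<omega> s e x)" for U s
      unfolding sec by blast
    fix p W and s t :: "('v, 'e) point \<Rightarrow> int"
    assume W: "openin X W" "p \<in> W" and eq: "\<And>i. i \<in> W \<Longrightarrow> s i = t i" and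
      s: "\<forall>e\<in>arcs G. \<forall>x\<in>{0..1}. em e x = p \<longrightarrow>
       jump_at \<omega> s e x"
    show "\<forall>e\<in>arcs G. \<forall>x\<in>{0..1}. em e x = p \<longrightarrow>
       jump_at \<omega> t e x"
    proof (intro ballI impI)
      fix e x assume a: "e \<in> arcs G" "x \<in> {0..1}" "em e x = p"
      then have ev: "jump_at \<omega> s e x"
        using s by blast
      have x: "em e x \<in> W" using a W by simp
      from ev open_eventually[OF W(1) a(1,2) x]
      show "jump_at \<omega> t e x"
        by eventually_elim (use eq[OF x] eq in auto)
    qed
  qed (simp add: jump_torsor_def)
  fix U assume U: "openin X U"
  show "act (jump_torsor \<omega>) U g t \<in> sections (jump_torsor \<omega>) U"
    if g: "g \<in> sections ZZ U" and t: "t \<in> sections (jump_torsor \<omega>) U" for g t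
  proof -
    have "\<forall>\<^sub>F y in nhds x. y \<in> {0..1} \<longrightarrow> (g + t) (em e y) + jump \<omega> e y = (g + t) (em e x) + jump \<omega> e x"
      if a: "e \<in> arcs G" "x \<in> {0..1}" "em e x \<in> U" for e x
    proof -
      have "\<forall>\<^sub>F y in nhds x. y \<in> {0..1} \<longrightarrow> g (em e y) = g (em e x)"
        using g a unfolding ZZ_iff[OF U] by blast
      moreover have "jump_at \<omega> t e x"
        using t a unfolding sec by blast
      ultimately show ?thesis by eventually_elim auto
    qed
    then show ?thesis using g t by (auto simp: sec ZZ_iff[OF U] jump_torsor_def)
  qed
  show "\<exists>!g. g \<in> sections ZZ U \<and> t = act (jump_torsor \<omega>) U g s"
    if s: "s \<in> sections (jump_torsor \<omega>) U" and t: "t \<in> sections (jump_torsor \<omega>) U" for s t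
  proof (rule ex1I[of _ "t - s"])
    have "\<forall>\<^sub>F y in nhds x. y \<in> {0..1} \<longrightarrow> (t - s) (em e y) = (t - s) (em e x)"
      if a: "e \<in> arcs G" "x \<in> {0..1}" "em e x \<in> U" for e x
    proof -
      have "jump_at \<omega> s e x"
        "jump_at \<omega> t e x"
        using s t a unfolding sec by blast+
      then show ?thesis by eventually_elim auto
    qed
    then show "t - s \<in> sections ZZ U \<and> t = act (jump_torsor \<omega>) U (t - s) s"
      using s t unfolding sec ZZ_iff[OF U] by (auto simp: jump_torsor_def)
  qed (auto simp: jump_torsor_def)
next
  fix p assume "p \<in> topspace X"
  then have "p \<in> points G" using topspace_X by simp
  then show "\<exists>U. openin X U \<and> p \<in> U \<and> sections (jump_torsor \<omega>) U \<noteq> {}"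
  proof (cases rule: point_cases)
    case (1 v)
    have "p \<in> half_star G v" using 1 by (simp add: Inl_in_half_star)
    then show ?thesis using zero_jump_torsor[OF 1(1)] open_half_star[OF 1(1)] by blast
  next
    case (2 e x)
    then have "p \<in> eI e" using em_interior[of x e] by force
    then show ?thesis using edge_jump_in[OF 2(1)] half_sub(7)[OF 2(1)] by blast
  qed
qed (auto simp: jump_torsor_def restr_ZZ add.assoc)

text \<open>A concrete member of the class, needed to realize a given torsor as one induced from the
  cochain. The witnesses are \<open>0\<close> on the half stars and
  \<open>edge_jump \<omega> e\<close> on the edges.\<close>

lemma jump_torsor_cochain_class: "torsor_copy (jump_torsor \<omega>) \<in> cochain_class G \<omega>"
  unfolding cochain_class_iff cochain_sections_def
proof (intro conjI exI ballI)
  show "is_torsor X ZZ (torsor_copy (jump_torsor \<omega>))" by (rule torsor_copy(1)[OF is_torsor_jump_torsor])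
  show "(\<lambda>_. 0) \<in> sections (torsor_copy (jump_torsor \<omega>)) (half_star G v)" if "v \<in> verts G" for v
    using zero_jump_torsor[OF that] by (auto simp: torsor_copy_def zero_fun_def)
  fix e assume e: "e \<in> arcs G"
  have JK: "p \<in> eJ e \<Longrightarrow> p \<notin> eK e" for p
  proof -
    assume "p \<in> eJ e"
    then obtain x where "p = em e x" "x \<in> {0<..<1/2}" by blast
    moreover have "{1/2<..<1} \<subseteq> {0<..<1::real}" by auto
    ultimately show "p \<notin> eK e" using em_in_image[of "{1/2<..<1}" e x e] by auto
  qed
  show "(\<lambda>_. edge_jump \<omega> e) \<in> sections (torsor_copy (jump_torsor \<omega>)) (eI e)"
    using edge_jump_in[OF e] by (auto simp: torsor_copy_def)
  show "restr (torsor_copy (jump_torsor \<omega>)) (eI e) (eJ e) (\<lambda>_. edge_jump \<omega> e) =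
      restr (torsor_copy (jump_torsor \<omega>)) (half_star G (tail G e)) (eJ e) (\<lambda>_. 0)"
    using JK by (auto simp: torsor_copy_def jump_torsor_def edge_jump_def fun_eq_iff)
  show "restr (torsor_copy (jump_torsor \<omega>)) (half_star G (head G e)) (eK e) (\<lambda>_. 0) =
      act (torsor_copy (jump_torsor \<omega>)) (eK e) (const_on (eK e) (\<omega> e))
        (restr (torsor_copy (jump_torsor \<omega>)) (eI e) (eK e) (\<lambda>_. edge_jump \<omega> e))"
    by (auto simp: torsor_copy_def jump_torsor_def edge_jump_def const_on_def fun_eq_iff)
qed

lemma const_inclusion_Harm:
  assumes U: "openin X U" and g: "g \<in> sections ZZ U"
  shows "const_inclusion U g \<in> sections (Harm G) U"
proof -
  have aff: "affine_near G (const_inclusion U g) e x (g (em e x)) 0"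
    if "e \<in> arcs G" "x \<in> {0..1}" "em e x \<in> U" for e x
  proof -
    have "\<forall>\<^sub>F y in nhds x. y \<in> {0..1} \<longrightarrow> g (em e y) = g (em e x)"
      using g that unfolding ZZ_iff[OF U] by blast
    then show ?thesis unfolding affine_near_def by eventually_elim (simp add: const_inclusion_def)
  qed
  have "vdiff (const_inclusion U g) v = 0" if "Inl v \<in> U" for v
  proof -
    have "slope G (const_inclusion U g) e 1 = 0" if "e \<in> in_arcs G v" for e
      using slope_eq[OF aff[of e 1]] that \<open>Inl v \<in> U\<close> by (auto simp: in_arcs_def em_ends)
    moreover have "slope G (const_inclusion U g) e 0 = 0" if "e \<in> out_arcs G v" for e
      using slope_eq[OF aff[of e 0]] that \<open>Inl v \<in> U\<close> by (auto simp: out_arcs_def em_ends)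
    ultimately show ?thesis by (simp add: vdiff_def)
  qed
  moreover have "\<exists>a b. affine_near G (const_inclusion U g) e x a b"
    if "e \<in> arcs G" "x \<in> {0..1}" "em e x \<in> U" for e x using aff[OF that] by blast
  moreover have "const_inclusion U g p = 0" if "p \<notin> U" for p
    using g that by (simp add: ZZ_iff[OF U] const_inclusion_def)
  ultimately show ?thesis unfolding Harm_iff[OF U] PL_iff[OF U] by simp
qed

text \<open>At the midpoint of \<open>e\<close> both the section and
  \<open>ramp \<omega> \<omega>\<close> jump by \<open>- \<omega> e\<close>. Their difference is
  thus affine across the midpoint, with slope \<open>- \<omega> e\<close> on the edge, and has
  \<open>diff\<close> equal to \<open>- codifferential G \<omega>\<close>.\<close>

lemma jump_torsor_to_lift:
  "equivariant X ZZ const_inclusion (jump_torsor \<omega>) (lift (- codifferential G \<omega>))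
    (\<lambda>U h p. if p \<in> U then of_int (h p) - ramp \<omega> \<omega> p else 0)" (is "equivariant _ _ _ _ _ ?k")
proof -
  have k: "?k U h \<in> sections (lift (- codifferential G \<omega>)) U"
    if U: "openin X U" and h: "h \<in> sections (jump_torsor \<omega>) U" for U h
  proof -
    have aff: "affine_near G (?k U h) e x (h (em e x) + jump \<omega> e x) (- \<omega> e)"
      if a: "e \<in> arcs G" "x \<in> {0..1}" "em e x \<in> U" for e x
    proof -
      have "\<forall>\<^sub>F y in nhds x. y \<in> {0..1} \<longrightarrow> h (em e y) + jump \<omega> e y = h (em e x) + jump \<omega> e x"
        using h a by (auto simp: jump_torsor_def)
      with open_eventually[OF U a] show ?thesis unfolding affine_near_def
      proof eventually_elim
        case (elim y)
        show ?case
        proof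
          assume y: "y \<in> {0..1}"
          then have "real_of_int (h (em e y) + jump \<omega> e y) = of_int (h (em e x) + jump \<omega> e x)"
            using elim by simp
          moreover have "ramp \<omega> \<omega> (em e y) = of_int (\<omega> e) * y - of_int (jump \<omega> e y)"
            by (auto simp: ramp_em jump_def algebra_simps)
          ultimately show "?k U h (em e y) = of_int (h (em e x) + jump \<omega> e x) + of_int (- \<omega> e) * y"
            using elim y by simp
        qed
      qed
    qed
    have "vdiff (?k U h) v = (- codifferential G \<omega>) v" if v: "Inl v \<in> U" for v
    proof -
      have "slope G (?k U h) e 1 = - \<omega> e" if "e \<in> in_arcs G v" for e
        using slope_eq[OF aff[of e 1]] that v by (auto simp: in_arcs_def em_ends)
      moreover have "slope G (?k U h) e 0 = - \<omega> e" if "e \<in> out_arcs G v" for e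
        using slope_eq[OF aff[of e 0]] that v by (auto simp: out_arcs_def em_ends)
      ultimately show ?thesis
        using Inl_in_verts[OF U v] by (simp add: vdiff_def codifferential_def sum_negf)
    qed
    moreover have "\<exists>a b. affine_near G (?k U h) e x a b"
      if "e \<in> arcs G" "x \<in> {0..1}" "em e x \<in> U" for e x using aff[OF that] by blast
    ultimately show ?thesis unfolding lift_iff[OF U] PL_iff[OF U] by simp
  qed
  have z: "g p = 0" if "openin X U" "g \<in> sections ZZ U" "p \<notin> U" for U g p
    using that by (simp add: ZZ_iff)
  show ?thesis
    unfolding equivariant_def using k z
    by (auto simp: jump_torsor_def restr_lift act_lift const_inclusion_def fun_eq_iff)
qed

text \<open>The map \<open>cochain_class G\<close> is constant on \<open>C\<close>, whose members
  differ from \<open>\<omega>\<close> by coboundaries. For an induced torsor \<open>S\<close>, the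
  images of the sections on half stars and edges are data for \<open>torsor_iso_lift\<close> with
  \<open>r = 1/2\<close>, \<open>a = \<omega>\<close>, \<open>b = 0\<close>, and its formula for
  \<open>f\<close> yields \<open>- codifferential G \<omega>\<close>. The converse inclusion goes
  through the jump torsor.\<close>

lemma q_star_eq:
  assumes \<omega>: "\<And>c. c \<in> C \<Longrightarrow> \<exists>\<phi>. c = coboundary G \<phi> + \<omega>" and C: "\<omega> \<in> C"
  shows "q_star G C = delta G (- codifferential G \<omega>)"
proof -
  let ?H = "Harm G" and ?f = "- codifferential G \<omega>"
  note gp = group_presheaf_Harm
  have "cochain_class G ` C = {cochain_class G \<omega>}"
    using \<omega> C cochain_class_coboundary by fastforce
  then have q: "q_star G C = H1_map X ZZ ?H const_inclusion (cochain_class G \<omega>)"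
    by (simp add: q_star_def induced_def)
  show ?thesis unfolding q
  proof (intro equalityI subsetI)
    fix S assume "S \<in> H1_map X ZZ ?H const_inclusion (cochain_class G \<omega>)"
    then obtain T m where S: "is_torsor X ?H S" and T: "T \<in> cochain_class G \<omega>"
      and m: "equivariant X ZZ const_inclusion T S m" by (auto simp: H1_map_def)
    from T obtain t s where T: "is_torsor X ZZ T" and ts: "cochain_sections T \<omega> t s"
    unfolding cochain_class_iff by blast
  note t = cochain_sectionsD(1)[OF ts] and s = cochain_sectionsD(2)[OF ts]
    and J = cochain_sectionsD(3)[OF ts] and K = cochain_sectionsD(4)[OF ts]
    have half: "1 - 1/2 = (1/2::real)" by simp
    have "torsor_iso X ?H S (lift ?f)"
    proof (rule torsor_iso_lift[OF S, where N = "half_star G" and t = "\<lambda>v. m (half_star G v) (t v)" and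
          s = "\<lambda>e. m (eI e) (s e)" and r = "\<lambda>_. 1/2" and a = \<omega> and b = "\<lambda>_. 0"], unfold half)
      fix v assume v: "v \<in> verts G"
      then show "openin X (half_star G v) \<and> Inl v \<in> half_star G v \<and>
          m (half_star G v) (t v) \<in> sections S (half_star G v)"
        using open_half_star equivariant_in[OF m _ t] by (simp add: Inl_in_half_star)
      show "?f v = (\<Sum>e\<in>out_arcs G v. \<omega> e + 0) - (\<Sum>e\<in>in_arcs G v. \<omega> e)"
        using v by (simp add: codifferential_def)
    next
      fix e assume e: "e \<in> arcs G"
      note h = half_sub[OF e]
      have v: "tail G e \<in> verts G" "head G e \<in> verts G" using e by auto
      note ov = open_half_star[OF v(1)] and ow = open_half_star[OF v(2)]
      show "m (eI e) (s e) \<in> sections S (eI e)"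
        using equivariant_in[OF m h(7) s[OF e]] .
      show "eJ e \<subseteq> half_star G (tail G e)" "eK e \<subseteq> half_star G (head G e)"
        by (rule h)+
      show "restr S (eI e) (eJ e) (m (eI e) (s e)) =
          restr S (half_star G (tail G e)) (eJ e) (m (half_star G (tail G e)) (t (tail G e)))"
        using equivariant_restr[OF m h(7,5,3) s[OF e]] equivariant_restr[OF m ov h(5,1) t[OF v(1)]] J[OF e] by simp
      have "const_inclusion (eK e) (const_on (eK e) (\<omega> e)) = line e {1/2<..<1} (\<omega> e) 0"
      proof
        fix p
        have K01: "{1/2<..<1::real} \<subseteq> {0<..<1}" by auto
        show "const_inclusion (eK e) (const_on (eK e) (\<omega> e)) p = line e {1/2<..<1} (\<omega> e) 0 p"
        proof (cases "p \<in> eK e")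
          case True
          then obtain x where "p = em e x" "x \<in> {1/2<..<1}" by blast
          then show ?thesis using True line_em[OF K01, of e "\<omega> e" 0 e x] by (simp add: const_inclusion_def const_on_def)
        next
          case False
          then show ?thesis using line_off[OF K01 False] by (simp add: const_inclusion_def const_on_def)
        qed
      qed
      then show "restr S (half_star G (head G e)) (eK e) (m (half_star G (head G e)) (t (head G e))) =
          act S (eK e) (line e {1/2<..<1} (\<omega> e) 0)
            (restr S (eI e) (eK e) (m (eI e) (s e)))"
        using equivariant_restr[OF m h(7,6,4) s[OF e]] equivariant_restr[OF m ow h(6,2) t[OF v(2)]] K[OF e]
          equivariant_act[OF m h(6) const_on_in[OF h(6)] torsor_restr_in[OF T h(7,6,4) s[OF e]]] by simp
    qed auto
    then show "S \<in> delta G ?f"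
      using S torsor_iso_sym[OF gp S is_torsor_lift] by (simp add: delta_eq torsor_class_def)
  next
    fix S assume "S \<in> delta G ?f"
    then obtain k where S: "is_torsor X ?H S" and k: "morphism X ?H (lift ?f) S k"
      by (auto simp: delta_eq torsor_class_def torsor_iso_def)
    have "equivariant X ZZ const_inclusion (torsor_copy (jump_torsor \<omega>)) (lift ?f)
      (\<lambda>U t p. if p \<in> U then of_int (t undefined p) - ramp \<omega> \<omega> p else 0)"
      by (rule equivariant_comp[OF torsor_copy_proj jump_torsor_to_lift])
    from equivariant_comp[OF this k const_inclusion_Harm] S jump_torsor_cochain_class
    show "S \<in> H1_map X ZZ ?H const_inclusion (cochain_class G \<omega>)" by (auto simp: H1_map_def)
  qed
qed

end

section \<open>Groups of cochains and their quotients\<close>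

lemma comm_group_Z_pow: "comm_group (Z_pow S)"
proof (rule comm_groupI)
  show "\<exists>y\<in>carrier (Z_pow S). y \<otimes>\<^bsub>Z_pow S\<^esub> x = \<one>\<^bsub>Z_pow S\<^esub>" if "x \<in> carrier (Z_pow S)" for x
    using that by (intro bexI[of _ "- x"]) (auto simp: Z_pow_def)
qed (auto simp: Z_pow_def ac_simps)

lemma Z_pow_simps: "f \<otimes>\<^bsub>Z_pow S\<^esub> g = f + g" "\<one>\<^bsub>Z_pow S\<^esub> = 0"
  by (simp_all add: Z_pow_def)

lemma Z_pow_closed:
  "0 \<in> carrier (Z_pow S)"
  "f \<in> carrier (Z_pow S) \<Longrightarrow> g \<in> carrier (Z_pow S) \<Longrightarrow> f + g \<in> carrier (Z_pow S)"
  "f \<in> carrier (Z_pow S) \<Longrightarrow> g \<in> carrier (Z_pow S) \<Longrightarrow> f - g \<in> carrier (Z_pow S)"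
  "f \<in> carrier (Z_pow S) \<Longrightarrow> - f \<in> carrier (Z_pow S)"
  by (auto simp: Z_pow_def)

lemma (in comm_group) quotient_carrier: "carrier (G Mod H) = (\<lambda>x. H #> x) ` carrier G"
  by (auto simp: FactGroup_def RCOSETS_def)

lemma (in comm_group) quotient_mult:
  assumes "subgroup H G" "x \<in> carrier G" "y \<in> carrier G"
  shows "(H #> x) \<otimes>\<^bsub>G Mod H\<^esub> (H #> y) = H #> (x \<otimes> y)"
  using normal.rcos_sum[OF subgroup_imp_normal[OF assms(1)] assms(2,3)] by (simp add: FactGroup_def)

lemma (in comm_group) quotient_eqI:
  assumes "subgroup H G" "h \<in> H" "x \<in> carrier G" "y \<in> carrier G" "x = h \<otimes> y"
  shows "H #> x = H #> y"
  using repr_independence[of x H y] assms by (auto simp: r_coset_def)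

lemma (in comm_group) quotient_eqD:
  assumes "subgroup H G" "x \<in> carrier G" "H #> x = H #> y"
  shows "\<exists>h\<in>H. x = h \<otimes> y"
  using rcos_self[OF assms(2,1)] assms(3) by (auto simp: r_coset_def)

lemma induced_eq: "x \<in> C \<Longrightarrow> (\<And>x. x \<in> C \<Longrightarrow> f x = y) \<Longrightarrow> induced f C = y"
proof -
  assume "x \<in> C" "\<And>x. x \<in> C \<Longrightarrow> f x = y"
  then have "f ` C = {y}" by force
  then show ?thesis by (simp add: induced_def)
qed

context lf_graph
begin

abbreviation "CE \<equiv> Z_pow (arcs G)"
abbreviation "CV \<equiv> Z_pow (verts G)"

lemma codifferential_in: "codifferential G \<omega> \<in> carrier CV"
  by (simp add: Z_pow_def codifferential_def)

lemma coboundary_in: "coboundary G f \<in> carrier CE"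
  by (simp add: Z_pow_def coboundary_def)

lemma codifferential_add: "codifferential G (f + g) = codifferential G f + codifferential G g"
  by (auto simp: codifferential_def sum.distrib)

lemma codifferential_uminus: "codifferential G (- f) = - codifferential G f"
  by (auto simp: codifferential_def sum_negf)

lemma codifferential_diff: "codifferential G (f - g) = codifferential G f - codifferential G g"
  by (auto simp: codifferential_def sum_subtractf)

lemma coboundary_add: "coboundary G (f + g) = coboundary G f + coboundary G g"
  by (auto simp: coboundary_def)

lemma hom_codifferential: "group_hom CE CV (codifferential G)"
  by (intro group_hom.intro group_hom_axioms.intro comm_group.axioms(2)[OF comm_group_Z_pow])
    (auto simp: hom_def codifferential_in codifferential_add Z_pow_simps)

lemma hom_coboundary: "group_hom CV CE (coboundary G)"
  by (intro group_hom.intro group_hom_axioms.intro comm_group.axioms(2)[OF comm_group_Z_pow])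
    (auto simp: hom_def coboundary_in coboundary_add Z_pow_simps)

lemma hom_box0: "group_hom CV CV (box0 G)"
  by (intro group_hom.intro group_hom_axioms.intro comm_group.axioms(2)[OF comm_group_Z_pow])
    (auto simp: hom_def box0_def codifferential_in codifferential_add coboundary_add Z_pow_simps)

lemma subgroup_coboundaries: "subgroup (coboundaries G) CE"
  unfolding coboundaries_def by (rule group_hom.img_is_subgroup[OF hom_coboundary])

lemma subgroup_box0_image: "subgroup (box0_image G) CV"
  unfolding box0_image_def by (rule group_hom.img_is_subgroup[OF hom_box0])

lemma subgroup_harmonic: "subgroup (harmonic_cochains G) CE"
  unfolding harmonic_cochains_def by (rule group_hom.subgroup_kernel[OF hom_codifferential])

lemma harmonic_iff: "h \<in> harmonic_cochains G \<longleftrightarrow> h \<in> carrier CE \<and> codifferential G h = 0"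
  by (simp add: harmonic_cochains_def kernel_def Z_pow_simps)

lemma comm_group_graph_H1: "comm_group (graph_H1 G)"
  unfolding graph_H1_def by (rule comm_group.abelian_FactGroup[OF comm_group_Z_pow subgroup_coboundaries])

lemma coset_CE: "coboundaries G #>\<^bsub>CE\<^esub> \<omega> = (\<lambda>\<phi>. coboundary G \<phi> + \<omega>) ` carrier CV"
  by (auto simp: r_coset_def Z_pow_simps coboundaries_def)

lemma coset_CV: "box0_image G #>\<^bsub>CV\<^esub> f = (\<lambda>\<phi>. box0 G \<phi> + f) ` carrier CV"
  by (auto simp: r_coset_def Z_pow_simps box0_image_def)

lemma subgroup_beta: "subgroup (beta G ` harmonic_cochains G) (graph_H1 G)"
proof -
  have n: "normal (coboundaries G) CE"
    by (rule comm_group.subgroup_imp_normal[OF comm_group_Z_pow subgroup_coboundaries])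
  have "group_hom CE (graph_H1 G) (beta G)"
    using normal.r_coset_hom_Mod[OF n] comm_group.axioms(2)[OF comm_group_Z_pow]
      comm_group.axioms(2)[OF comm_group_graph_H1]
    by (intro group_hom.intro group_hom_axioms.intro) (simp_all add: graph_H1_def beta_def[abs_def])
  then show ?thesis by (rule group_hom.subgroup_img_is_subgroup[OF _ subgroup_harmonic])
qed

lemma beta_mult:
  "\<omega> \<in> carrier CE \<Longrightarrow> \<eta> \<in> carrier CE \<Longrightarrow> beta G \<omega> \<otimes>\<^bsub>graph_H1 G\<^esub> beta G \<eta> = beta G (\<omega> + \<eta>)"
  using comm_group.quotient_mult[OF comm_group_Z_pow subgroup_coboundaries]
  by (simp add: graph_H1_def beta_def Z_pow_simps)

lemma beta_in: "\<omega> \<in> carrier CE \<Longrightarrow> beta G \<omega> \<in> carrier (graph_H1 G)"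
  by (auto simp: graph_H1_def beta_def comm_group.quotient_carrier[OF comm_group_Z_pow])

lemma graph_H1_carrier: "carrier (graph_H1 G) = beta G ` carrier CE"
  by (auto simp: graph_H1_def beta_def comm_group.quotient_carrier[OF comm_group_Z_pow])

text \<open>Elements of \<open>P_group G\<close> are cosets of cosets; naming them by a cochain lets
  every map be computed on representatives.\<close>

definition P_class :: "('e \<Rightarrow> int) \<Rightarrow> ('e \<Rightarrow> int) set set" where
  "P_class \<omega> = beta G ` harmonic_cochains G #>\<^bsub>graph_H1 G\<^esub> beta G \<omega>"

lemma P_class_eq:
  assumes "\<omega> \<in> carrier CE"
  shows "P_class \<omega> = (\<lambda>h. beta G (h + \<omega>)) ` harmonic_cochains G"
  unfolding P_class_def r_coset_def using beta_mult[OF _ assms] harmonic_iff by auto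

lemma P_carrier: "carrier (P_group G) = P_class ` carrier CE"
  unfolding P_group_def comm_group.quotient_carrier[OF comm_group_graph_H1] graph_H1_carrier P_class_def
  by (simp add: image_image)

lemma P_mult:
  assumes "\<omega> \<in> carrier CE" "\<eta> \<in> carrier CE"
  shows "P_class \<omega> \<otimes>\<^bsub>P_group G\<^esub> P_class \<eta> = P_class (\<omega> + \<eta>)"
  unfolding P_class_def P_group_def
  using comm_group.quotient_mult[OF comm_group_graph_H1 subgroup_beta beta_in beta_in] beta_mult assms by simp

text \<open>As \<open>box0 G \<phi>\<close> is the codifferential of
  \<open>coboundary G \<phi>\<close>, the cochain
  \<open>\<omega> - \<eta> - coboundary G \<phi>\<close> is harmonic. Injectivity of
  \<open>chi G\<close> and of \<open>q_bar G\<close> both reduce to this.\<close>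

lemma P_class_eqI:
  assumes \<omega>: "\<omega> \<in> carrier CE" "\<eta> \<in> carrier CE" and \<phi>: "\<phi> \<in> carrier CV"
    and eq: "codifferential G \<omega> - codifferential G \<eta> = box0 G \<phi>"
  shows "P_class \<omega> = P_class \<eta>"
proof -
  define h where "h = \<omega> - \<eta> - coboundary G \<phi>"
  have h: "h \<in> harmonic_cochains G"
    using \<omega> coboundary_in[of \<phi>] eq
    by (simp add: harmonic_iff h_def Z_pow_closed codifferential_diff box0_def)
  have "beta G \<omega> = beta G (h + \<eta>)" unfolding beta_def
  proof (rule comm_group.quotient_eqI[OF comm_group_Z_pow subgroup_coboundaries])
    show "coboundary G \<phi> \<in> coboundaries G" using \<phi> by (simp add: coboundaries_def)
    show "h + \<eta> \<in> carrier CE" using \<omega> h by (simp only: harmonic_iff Z_pow_closed)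
  qed (use \<omega> in \<open>auto simp: h_def Z_pow_simps\<close>)
  then have "beta G \<omega> = beta G h \<otimes>\<^bsub>graph_H1 G\<^esub> beta G \<eta>"
    using beta_mult[of h \<eta>] h \<omega> by (simp add: harmonic_iff)
  then show ?thesis unfolding P_class_def
    using comm_group.quotient_eqI[OF comm_group_graph_H1 subgroup_beta _ beta_in beta_in] h \<omega> by blast
qed

section \<open>The induced maps on representatives\<close>

lemma delta_bar_coset: "delta_bar G (box0_image G #>\<^bsub>CV\<^esub> f) = delta G f"
  unfolding delta_bar_def
proof (rule induced_eq)
  show "f \<in> box0_image G #>\<^bsub>CV\<^esub> f"
    using group_hom.hom_one[OF hom_box0] Z_pow_closed(1)
    by (auto simp: coset_CV Z_pow_simps intro!: image_eqI[of _ _ 0])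
  fix g assume "g \<in> box0_image G #>\<^bsub>CV\<^esub> f"
  then obtain \<phi> where "g = box0 G \<phi> + f" by (auto simp: coset_CV)
  then show "delta G g = delta G f" using delta_add_box0[of g f \<phi>] by simp
qed

text \<open>The two levels of \<open>induced\<close> are well defined for different reasons:
  coboundaries are sent into \<open>box0_image G\<close>, and harmonic cochains are sent to
  \<open>0\<close>.\<close>

lemma chi_P_class:
  assumes \<omega>: "\<omega> \<in> carrier CE"
  shows "chi G (P_class \<omega>) = box0_image G #>\<^bsub>CV\<^esub> codifferential G \<omega>"
proof -
  let ?F = "\<lambda>\<omega>. box0_image G #>\<^bsub>CV\<^esub> codifferential G \<omega>"
  have b: "induced ?F (beta G \<eta>) = ?F \<eta>" if \<eta>: "\<eta> \<in> carrier CE" for \<eta>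
  proof (rule induced_eq)
    show "\<eta> \<in> beta G \<eta>" unfolding beta_def
      by (rule group.rcos_self[OF comm_group.axioms(2)[OF comm_group_Z_pow] \<eta> subgroup_coboundaries])
    fix \<theta> assume "\<theta> \<in> beta G \<eta>"
    then obtain \<phi> where \<phi>: "\<phi> \<in> carrier CV" "\<theta> = coboundary G \<phi> + \<eta>" by (auto simp: beta_def coset_CE)
    show "?F \<theta> = ?F \<eta>"
    proof (rule comm_group.quotient_eqI[OF comm_group_Z_pow subgroup_box0_image])
      show "box0 G \<phi> \<in> box0_image G" using \<phi> by (simp add: box0_image_def)
    qed (auto simp: \<phi> codifferential_in codifferential_add box0_def Z_pow_simps Z_pow_closed)
  qed
  show ?thesis unfolding chi_def
  proof (rule induced_eq)
    show "beta G (0 + \<omega>) \<in> P_class \<omega>"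
      unfolding P_class_eq[OF \<omega>] using subgroup.one_closed[OF subgroup_harmonic]
      by (intro image_eqI[of _ _ 0]) (simp_all only: Z_pow_simps)
    fix c assume "c \<in> P_class \<omega>"
    then obtain h where h: "h \<in> harmonic_cochains G" "c = beta G (h + \<omega>)" by (auto simp: P_class_eq[OF \<omega>])
    then have "induced ?F c = ?F (h + \<omega>)" using b \<omega> by (simp add: harmonic_iff Z_pow_closed)
    then show "induced ?F c = ?F \<omega>" using h by (simp add: codifferential_add harmonic_iff)
  qed
qed

lemma q_star_beta:
  assumes \<omega>: "\<omega> \<in> carrier CE"
  shows "q_star G (beta G \<omega>) = delta G (- codifferential G \<omega>)"
proof (rule q_star_eq)
  show "\<omega> \<in> beta G \<omega>" unfolding beta_def
    by (rule group.rcos_self[OF comm_group.axioms(2)[OF comm_group_Z_pow] \<omega> subgroup_coboundaries])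
qed (auto simp: beta_def coset_CE)

lemma q_bar_P_class:
  assumes \<omega>: "\<omega> \<in> carrier CE"
  shows "q_bar G (P_class \<omega>) = delta G (- codifferential G \<omega>)"
  unfolding q_bar_def
proof (rule induced_eq)
  show "beta G (0 + \<omega>) \<in> P_class \<omega>"
    unfolding P_class_eq[OF \<omega>] using subgroup.one_closed[OF subgroup_harmonic]
    by (intro image_eqI[of _ _ 0]) (simp_all only: Z_pow_simps)
  fix c assume "c \<in> P_class \<omega>"
  then obtain h where h: "h \<in> harmonic_cochains G" "c = beta G (h + \<omega>)" by (auto simp: P_class_eq[OF \<omega>])
  then have "q_star G c = delta G (- codifferential G (h + \<omega>))"
    using q_star_beta[of "h + \<omega>"] \<omega> by (simp add: harmonic_iff Z_pow_closed)
  then show "q_star G c = delta G (- codifferential G \<omega>)" using h by (simp add: codifferential_add harmonic_iff)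
qed

lemma Cl_hat0_carrier:
  "carrier (Cl_hat0 G) = (\<lambda>\<omega>. box0_image G #>\<^bsub>CV\<^esub> codifferential G \<omega>) ` carrier CE"
  by (auto simp: Cl_hat0_def FactGroup_def RCOSETS_def r_coset_def)

text \<open>The product of cosets is a product of sets and does not see the carrier, so it may be
  computed in the quotient of all of \<open>CV\<close>.\<close>

lemma Cl_hat0_mult:
  assumes "f \<in> carrier CV" "g \<in> carrier CV"
  shows "(box0_image G #>\<^bsub>CV\<^esub> f) \<otimes>\<^bsub>Cl_hat0 G\<^esub> (box0_image G #>\<^bsub>CV\<^esub> g) = box0_image G #>\<^bsub>CV\<^esub> (f + g)"
  using comm_group.quotient_mult[OF comm_group_Z_pow subgroup_box0_image assms]
  by (simp add: Cl_hat0_def FactGroup_def set_mult_def Z_pow_simps)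

lemma Pic0_carrier: "carrier (Pic0 G) = (\<lambda>\<omega>. delta G (codifferential G \<omega>)) ` carrier CE"
proof (intro equalityI subsetI)
  fix c assume c: "c \<in> carrier (Pic0 G)"
  then have "c \<in> carrier (Pic G)" by (simp add: Pic0_def kernel_def)
  then obtain f where "f \<in> carrier CV" "c = delta G f" unfolding Pic_carrier by blast
  then show "c \<in> (\<lambda>\<omega>. delta G (codifferential G \<omega>)) ` carrier CE" using c delta_in_Pic0_iff by blast
qed (use delta_in_Pic0_iff[OF codifferential_in] in blast)

lemma Pic0_mult: "x \<otimes>\<^bsub>Pic0 G\<^esub> y = x \<otimes>\<^bsub>Pic G\<^esub> y"
  by (simp add: Pic0_def)

text \<open>The inverse is a definite description, so uniqueness has to be shown: any other
  candidate is some \<open>delta G g\<close>, and additivity of \<open>delta G\<close> forces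
  \<open>delta G g = delta G (- f)\<close>.\<close>

lemma Pic_inv: "inv\<^bsub>Pic G\<^esub> (delta G f) = delta G (- f)"
  unfolding m_inv_def
proof (rule the_equality)
  show "delta G (- f) \<in> carrier (Pic G) \<and> delta G f \<otimes>\<^bsub>Pic G\<^esub> delta G (- f) = \<one>\<^bsub>Pic G\<^esub> \<and>
      delta G (- f) \<otimes>\<^bsub>Pic G\<^esub> delta G f = \<one>\<^bsub>Pic G\<^esub>"
    by (simp add: delta_in_Pic delta_mult Pic_one)
  fix y assume y: "y \<in> carrier (Pic G) \<and> delta G f \<otimes>\<^bsub>Pic G\<^esub> y = \<one>\<^bsub>Pic G\<^esub> \<and> y \<otimes>\<^bsub>Pic G\<^esub> delta G f = \<one>\<^bsub>Pic G\<^esub>"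
  then obtain g where g: "y = delta G g" unfolding Pic_carrier by blast
  have "delta G g = delta G (f + g) \<otimes>\<^bsub>Pic G\<^esub> delta G (- f)" by (simp add: delta_mult)
  also have "delta G (f + g) = delta G 0" using y g by (simp add: delta_mult Pic_one)
  also have "delta G 0 \<otimes>\<^bsub>Pic G\<^esub> delta G (- f) = delta G (- f)"
    unfolding delta_mult by (rule arg_cong[of _ _ "delta G"]) auto
  finally show "y = delta G (- f)" using g by simp
qed

section \<open>The isomorphisms\<close>

lemma chi_iso: "chi G \<in> iso (P_group G) (Cl_hat0 G)"
  unfolding iso_def hom_def
proof (intro CollectI conjI ballI)
  show "chi G \<in> carrier (P_group G) \<rightarrow> carrier (Cl_hat0 G)"
    by (auto simp: P_carrier Cl_hat0_carrier chi_P_class)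
  show "chi G (x \<otimes>\<^bsub>P_group G\<^esub> y) = chi G x \<otimes>\<^bsub>Cl_hat0 G\<^esub> chi G y"
    if "x \<in> carrier (P_group G)" "y \<in> carrier (P_group G)" for x y
    using that by (auto simp: P_carrier P_mult chi_P_class Cl_hat0_mult codifferential_in codifferential_add Z_pow_closed)
  have "inj_on (chi G) (carrier (P_group G))"
  proof (rule inj_onI)
    fix x y assume "x \<in> carrier (P_group G)" "y \<in> carrier (P_group G)" and eq: "chi G x = chi G y"
    then obtain \<omega> \<eta> where \<omega>: "\<omega> \<in> carrier CE" "x = P_class \<omega>" and \<eta>: "\<eta> \<in> carrier CE" "y = P_class \<eta>"
      by (auto simp: P_carrier)
    then obtain h where "h \<in> box0_image G" "codifferential G \<omega> = h + codifferential G \<eta>"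
      using comm_group.quotient_eqD[OF comm_group_Z_pow subgroup_box0_image codifferential_in] eq
      by (metis chi_P_class Z_pow_simps(1))
    then show "x = y" using P_class_eqI[OF \<omega>(1) \<eta>(1)] \<omega> \<eta> by (auto simp: box0_image_def)
  qed
  moreover have "chi G ` carrier (P_group G) = carrier (Cl_hat0 G)"
    by (auto simp: P_carrier Cl_hat0_carrier image_image chi_P_class)
  ultimately show "bij_betw (chi G) (carrier (P_group G)) (carrier (Cl_hat0 G))" by (simp add: bij_betw_def)
qed

lemma q_bar_iso: "q_bar G \<in> iso (P_group G) (Pic0 G)"
  unfolding iso_def hom_def
proof (intro CollectI conjI ballI)
  have im: "q_bar G ` carrier (P_group G) = carrier (Pic0 G)"
  proof -
    \<comment> \<open>The sign in the formula for \<open>q_bar G\<close> is absorbed by the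
      bijection \<open>\<omega> \<mapsto> - \<omega>\<close> of the cochain group.\<close>
    have "q_bar G ` carrier (P_group G) = (\<lambda>\<omega>. delta G (codifferential G (- \<omega>))) ` carrier CE"
      by (auto simp: P_carrier image_image q_bar_P_class codifferential_uminus)
    also have "\<dots> = (\<lambda>\<omega>. delta G (codifferential G \<omega>)) ` uminus ` carrier CE" by (simp add: image_image)
    also have "uminus ` carrier CE = carrier CE"
      using Z_pow_closed(4) by (metis (no_types, lifting) equalityI image_iff image_subsetI minus_minus subsetI)
    finally show ?thesis using Pic0_carrier by simp
  qed
  then show "q_bar G \<in> carrier (P_group G) \<rightarrow> carrier (Pic0 G)" by blast
  show "q_bar G (x \<otimes>\<^bsub>P_group G\<^esub> y) = q_bar G x \<otimes>\<^bsub>Pic0 G\<^esub> q_bar G y"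
    if "x \<in> carrier (P_group G)" "y \<in> carrier (P_group G)" for x y
    using that by (auto simp: P_carrier P_mult q_bar_P_class Pic0_mult delta_mult codifferential_add Z_pow_closed)
  have "inj_on (q_bar G) (carrier (P_group G))"
  proof (rule inj_onI)
    fix x y assume "x \<in> carrier (P_group G)" "y \<in> carrier (P_group G)" and eq: "q_bar G x = q_bar G y"
    then obtain \<omega> \<eta> where \<omega>: "\<omega> \<in> carrier CE" "x = P_class \<omega>" and \<eta>: "\<eta> \<in> carrier CE" "y = P_class \<eta>"
      by (auto simp: P_carrier)
    then have "delta G (- codifferential G \<omega>) = delta G (- codifferential G \<eta>)"
      using eq by (simp add: q_bar_P_class)
    then obtain \<phi> where \<phi>: "\<phi> \<in> carrier CV"
      "\<And>v. v \<in> verts G \<Longrightarrow> (- codifferential G \<eta>) v - (- codifferential G \<omega>) v = box0 G \<phi> v"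
      using delta_eq_imp_box0 by blast
    \<comment> \<open>Equality of classes gives the relation at vertices; elsewhere both sides are
      \<open>0\<close> by the conventions for cochains.\<close>
    have "codifferential G \<omega> - codifferential G \<eta> = box0 G \<phi>"
    proof
      fix v show "(codifferential G \<omega> - codifferential G \<eta>) v = box0 G \<phi> v"
        using \<phi>(2)[of v] by (cases "v \<in> verts G") (simp_all add: box0_def codifferential_def)
    qed
    then show "x = y" using P_class_eqI[OF \<omega>(1) \<eta>(1) \<phi>(1)] \<omega> \<eta> by simp
  qed
  then show "bij_betw (q_bar G) (carrier (P_group G)) (carrier (Pic0 G))" using im by (simp add: bij_betw_def)
qed

end

theorem theorem2p5p16:
  fixes G :: "('v, 'e) pre_digraph"
  assumes "wf_digraph G"
    and "verts G \<noteq> {}"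
    and "countable (verts G)" and "countable (arcs G)"
    and locally_finite: "\<And>v. v \<in> verts G \<Longrightarrow> finite (in_arcs G v) \<and> finite (out_arcs G v)"
    and no_isolated: "\<And>v. v \<in> verts G \<Longrightarrow> in_arcs G v \<union> out_arcs G v \<noteq> {}"
  shows "delta_bar G ` carrier (Cl_hat0 G) = carrier (Pic0 G) \<and>
    (\<forall>c\<in>beta G ` harmonic_cochains G. q_star G c = \<one>\<^bsub>Pic G\<^esub>) \<and>
    q_bar G \<in> iso (P_group G) (Pic0 G) \<and>
    chi G \<in> iso (P_group G) (Cl_hat0 G) \<and>
    (\<forall>c\<in>carrier (P_group G). inv\<^bsub>Pic G\<^esub> (delta_bar G (chi G c)) = q_bar G c)"
proof -
  interpret lf_graph G
    using assms(1) locally_finite no_isolated by (intro lf_graph.intro lf_graph_axioms.intro)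
  have "delta_bar G ` carrier (Cl_hat0 G) = carrier (Pic0 G)"
    by (simp add: Cl_hat0_carrier Pic0_carrier image_image delta_bar_coset)
  moreover have "\<forall>c\<in>beta G ` harmonic_cochains G. q_star G c = \<one>\<^bsub>Pic G\<^esub>"
    by (auto simp: harmonic_iff q_star_beta Pic_one)
  moreover have "\<forall>c\<in>carrier (P_group G). inv\<^bsub>Pic G\<^esub> (delta_bar G (chi G c)) = q_bar G c"
    by (auto simp: P_carrier chi_P_class delta_bar_coset Pic_inv q_bar_P_class)
  ultimately show ?thesis using q_bar_iso chi_iso by blast
qed

end
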